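(* Let $\Sigma=\{0,1\}$. There exists a function $G:\Sigma^*\to\Sigma^*$ such that: (i) $G$ has stretch factor $n+1$, i.e. $|G(x)|=|x|+1$ for every $x\in\Sigma^*$; (ii) $G$ is almost one-to-one; (iii) $G$ is a pseudorandom generator against $\mathrm{CFL}/n$; and (iv) $G\in \mathrm{FL}\cap \mathrm{CFLMV}(2)/n$.
   Context: Alphabets are finite nonempty sets; $\mathbb{N}=\{0,1,2,\dots\}$, $\mathbb{N}^+=\mathbb{N}\setminus\{0\}$. For strings $x=x_1\cdots x_n\in\Sigma^n$, $y=y_1\cdots y_n\in\Gamma^n$ of equal length, $[\begin{smallmatrix} x \\ y \end{smallmatrix}]$ denotes the string $[\begin{smallmatrix} x_1 \\ y_1 \end{smallmatrix}]\cdots[\begin{smallmatrix} x_n \\ y_n \end{smallmatrix}]$ over the alphabet of pairs $\Sigma\times\Gamma$. A length-preserving advice function over an alphabet $\Gamma$ is a map $h:\mathbb{N}\to\Gamma^*$ with $|h(n)|=n$ for all $n$ (no computability requirement). CFL is the family of context-free languages. A language $L$ over $\Sigma$ is in $\mathrm{CFL}/n$ if there are an alphabet $\Gamma$, a length-preserving advice function $h:\mathbb{N}\to\Gamma^*$ and a language $S\in\mathrm{CFL}$ over the pair alphabet such that for all $x\in\Sigma^*$: $x\in L \iff [\begin{smallmatrix} x \\ h(|x|) \end{smallmatrix}]\in S$. A function $\mu:\mathbb{N}\to\mathbb{R}^{\ge 0}$ is negligible if for every positive-valued polynomial $p$ with integer coefficients there is $n_0$ with $\mu(n)\le 1/p(n)$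 for all $n\ge n_0$. A function $G:\Sigma^*\to\Sigma^*$ with stretch factor $s(n)$ (meaning $|G(x)|=s(|x|)$) fools a language $A\subseteq\Sigma^*$ if $\ell(n)=\left|\mathrm{Prob}_{x\in\Sigma^n}[G(x)\in A]-\mathrm{Prob}_{y\in\Sigma^{s(n)}}[y\in A]\right|$ is negligible ($x,y$ uniform). $G$ is a pseudorandom generator against a language family $\mathcal{C}$ if it fools every language over $\Sigma$ in $\mathcal{C}$. $G$ is almost one-to-one if there is a negligible $\varepsilon$ with $|\{G(x):x\in\Sigma^n\}|=|\Sigma^n|(1-\varepsilon(n))$ for all $n\in\mathbb{N}^+$. Function classes. An npda is a one-way one-head nondeterministic pushdown automaton, whose input is surrounded by two endmarkers, whose head may stay stationary, and all of whose computation paths terminate in $O(n)$ steps on inputs of length $n$. $\mathrm{CFLMV}$ is the set of multi-valued partial functions $f$ from $\Sigma^*$ to $\Gamma^*$ (for alphabets $\Sigma,\Gamma$) for which some npda equipped with a one-way write-only output tape satisfies: for every input $x$, $f(x)$ is the set of all strings produced on the output tape along accepting computation paths on $x$ ($f(x)$ is undefined when this set is empty). A multi-valued partial function $f$ is in $\mathrm{CFLMV}(2)$ if there are $g_1,g_2\in\mathrm{CFLMV}$ with $f(x)=g_1(x)\cap g_2(x)$ for all $x$; $f$ is in $\mathrm{CFLMV}(2)/n$ if there are $g\in\mathrm{CFLMV}(2)$ and a length-preserving advice function $h$ with $f(x)=g([\begin{smallmatrix} x \\ h(|x|) \end{smallmatrix}])$ for all $x$. A single-valued total function $G$ is identified with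 $x\mapsto\{G(x)\}$. $\mathrm{FL}$ is the class of single-valued total functions computable by deterministic Turing machines with a two-way read-only input tape, a read/write work tape using $O(\log n)$ space, and a write-only output tape using polynomial space. *)

theory Defs
  imports
    "HOL-Probability.Probability"
    "HOL-Computational_Algebra.Polynomial"
begin

text \<open>
  Alphabets are finite nonempty sets. HOL cannot quantify existentially over types, so wherever a
  definition asks for some further alphabet or finite set of states (advice symbols, nonterminals,
  states, stack and tape symbols), it is taken to be a finite subset of \<^typ>\<open>nat\<close>; up to renaming
  this covers every finite set.
\<close>

definition alphabet :: "'a set \<Rightarrow> bool" where
  "alphabet \<Sigma> \<longleftrightarrow> finite \<Sigma> \<and> \<Sigma> \<noteq> {}"

definition words :: "'a set \<Rightarrow> nat \<Rightarrow> 'a list set" where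
  "words \<Sigma> n = {w \<in> lists \<Sigma>. length w = n}"

definition length_preserving_advice :: "'c set \<Rightarrow> (nat \<Rightarrow> 'c list) \<Rightarrow> bool" where
  "length_preserving_advice \<Gamma> h \<longleftrightarrow> (\<forall>n. h n \<in> words \<Gamma> n)"


section \<open>Context-free languages, with and without advice\<close>

datatype ('n, 'a) gsymbol = NT 'n | T 'a

record ('n, 'a) cfg =
  nonterminals :: "'n set"
  productions :: "('n \<times> ('n, 'a) gsymbol list) set"
  start :: 'n

definition wf_cfg :: "'a set \<Rightarrow> ('n, 'a) cfg \<Rightarrow> bool" where
  "wf_cfg \<Sigma> K \<longleftrightarrow>
     finite (nonterminals K) \<and> start K \<in> nonterminals K \<and> finite (productions K) \<and>
     productions K \<subseteq> nonterminals K \<times> lists (NT ` nonterminals K \<union> T ` \<Sigma>)"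

inductive cfg_step ::
  "('n, 'a) cfg \<Rightarrow> ('n, 'a) gsymbol list \<Rightarrow> ('n, 'a) gsymbol list \<Rightarrow> bool" for K where
  "(A, w) \<in> productions K \<Longrightarrow> cfg_step K (u @ [NT A] @ v) (u @ w @ v)"

definition cfg_language :: "('n, 'a) cfg \<Rightarrow> 'a list set" where
  "cfg_language K = {w. (cfg_step K)\<^sup>*\<^sup>* [NT (start K)] (map T w)}"

definition CFL :: "'a set \<Rightarrow> 'a list set set" where
  "CFL \<Sigma> = {cfg_language K |K :: (nat, 'a) cfg. wf_cfg \<Sigma> K}"

text \<open>The pairing of two strings of equal length into one string of pairs is \<^const>\<open>zip\<close>.\<close>

definition CFL_advice :: "'a set \<Rightarrow> 'a list set set" where
  "CFL_advice \<Sigma> = {L. L \<subseteq> lists \<Sigma> \<and>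
     (\<exists>(\<Gamma> :: nat set) h S. alphabet \<Gamma> \<and> length_preserving_advice \<Gamma> h \<and> S \<in> CFL (\<Sigma> \<times> \<Gamma>) \<and>
        (\<forall>x \<in> lists \<Sigma>. x \<in> L \<longleftrightarrow> zip x (h (length x)) \<in> S))}"


section \<open>Pseudorandom generators\<close>

definition negligible_fun :: "(nat \<Rightarrow> real) \<Rightarrow> bool" where
  "negligible_fun \<mu> \<longleftrightarrow> (\<forall>n. \<mu> n \<ge> 0) \<and>
     (\<forall>p :: int poly. (\<forall>n. poly p (int n) > 0) \<longrightarrow>
        (\<exists>n0. \<forall>n \<ge> n0. \<mu> n \<le> 1 / real_of_int (poly p (int n))))"

definition has_stretch :: "'a set \<Rightarrow> (nat \<Rightarrow> nat) \<Rightarrow> ('a list \<Rightarrow> 'a list) \<Rightarrow> bool" where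
  "has_stretch \<Sigma> s G \<longleftrightarrow> (\<forall>x \<in> lists \<Sigma>. G x \<in> lists \<Sigma> \<and> length (G x) = s (length x))"

definition fools ::
  "'a set \<Rightarrow> (nat \<Rightarrow> nat) \<Rightarrow> ('a list \<Rightarrow> 'a list) \<Rightarrow> 'a list set \<Rightarrow> bool" where
  "fools \<Sigma> s G A \<longleftrightarrow> negligible_fun (\<lambda>n.
     \<bar>measure_pmf.prob (pmf_of_set (words \<Sigma> n)) {x. G x \<in> A}
      - measure_pmf.prob (pmf_of_set (words \<Sigma> (s n))) {y. y \<in> A}\<bar>)"

definition pseudorandom_against ::
  "'a set \<Rightarrow> (nat \<Rightarrow> nat) \<Rightarrow> ('a list \<Rightarrow> 'a list) \<Rightarrow> 'a list set set \<Rightarrow> bool" where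
  "pseudorandom_against \<Sigma> s G \<C> \<longleftrightarrow>
     has_stretch \<Sigma> s G \<and> (\<forall>A \<in> \<C>. A \<subseteq> lists \<Sigma> \<longrightarrow> fools \<Sigma> s G A)"

definition almost_one_to_one :: "'a set \<Rightarrow> ('a list \<Rightarrow> 'b list) \<Rightarrow> bool" where
  "almost_one_to_one \<Sigma> G \<longleftrightarrow> (\<exists>\<epsilon>. negligible_fun \<epsilon> \<and>
     (\<forall>n > 0. real (card (G ` words \<Sigma> n)) = real (card (words \<Sigma> n)) * (1 - \<epsilon> n)))"


section \<open>Pushdown automata with output\<close>

datatype 'a endmarked = LEnd | Letter 'a | REnd

definition endmarked_symbols :: "'a set \<Rightarrow> 'a endmarked set" where
  "endmarked_symbols \<Sigma> = {LEnd, REnd} \<union> Letter ` \<Sigma>"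

definition endmarked_word :: "'a list \<Rightarrow> 'a endmarked list" where
  "endmarked_word x = LEnd # map Letter x @ [REnd]"

definition written :: "'b option \<Rightarrow> 'b list" where
  "written b = (case b of None \<Rightarrow> [] | Some y \<Rightarrow> [y])"

text \<open>
  A transition \<open>((q, a, Z), (q', \<gamma>, adv, b))\<close>, enabled in state \<open>q\<close> with \<open>a\<close> under the input head
  and \<open>Z\<close> on top of the stack, enters \<open>q'\<close>, replaces \<open>Z\<close> by \<open>\<gamma>\<close> (top first), advances the input
  head iff \<open>adv\<close> (otherwise the head stays), and writes \<open>b\<close> on the output tape (\<^const>\<open>None\<close>:
  nothing). Accepting states are halting; a computation also ends, without acceptance, where no
  transition is enabled, so explicit rejecting states are not needed.
\<close>

record ('q, 'g, 'a, 'b) npda =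
  states :: "'q set"
  stack_symbols :: "'g set"
  transitions :: "(('q \<times> 'a endmarked \<times> 'g) \<times> ('q \<times> 'g list \<times> bool \<times> 'b option)) set"
  initial :: 'q
  bottom :: 'g
  accepting :: "'q set"

definition wf_npda :: "'a set \<Rightarrow> 'b set \<Rightarrow> ('q, 'g, 'a, 'b) npda \<Rightarrow> bool" where
  "wf_npda \<Sigma> \<Gamma> M \<longleftrightarrow>
     finite (states M) \<and> finite (stack_symbols M) \<and> finite (transitions M) \<and>
     initial M \<in> states M \<and> bottom M \<in> stack_symbols M \<and> accepting M \<subseteq> states M \<and>
     transitions M \<subseteq>
       ((states M - accepting M) \<times> endmarked_symbols \<Sigma> \<times> stack_symbols M) \<times>
       (states M \<times> lists (stack_symbols M) \<times> UNIV \<times> insert None (Some ` \<Gamma>))"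

text \<open>
  Configurations: state, input from the head position to the right end, stack (top first), output.
\<close>

type_synonym ('q, 'g, 'a, 'b) npda_config =
  "'q \<times> 'a endmarked list \<times> 'g list \<times> 'b list"

inductive npda_step ::
  "('q, 'g, 'a, 'b) npda \<Rightarrow>
   ('q, 'g, 'a, 'b) npda_config \<Rightarrow> ('q, 'g, 'a, 'b) npda_config \<Rightarrow> bool" for M where
  "((q, a, Z), (q', \<gamma>, adv, b)) \<in> transitions M \<Longrightarrow>
   npda_step M (q, a # w, Z # st, out)
     (q', (if adv then w else a # w), \<gamma> @ st, out @ written b)"

definition npda_init ::
  "('q, 'g, 'a, 'b) npda \<Rightarrow> 'a list \<Rightarrow> ('q, 'g, 'a, 'b) npda_config" where
  "npda_init M x = (initial M, endmarked_word x, [bottom M], [])"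

text \<open>
  The bound \<open>c * (n + 1)\<close> is \<open>O(n)\<close> with the empty input covered: branching is finite, so
  termination on each of finitely many short inputs already gives a constant bound on them.
\<close>

definition npda_linear_time :: "'a set \<Rightarrow> ('q, 'g, 'a, 'b) npda \<Rightarrow> bool" where
  "npda_linear_time \<Sigma> M \<longleftrightarrow> (\<exists>c :: nat. \<forall>x \<in> lists \<Sigma>. \<forall>k cf.
     (npda_step M ^^ k) (npda_init M x) cf \<longrightarrow> k \<le> c * (length x + 1))"

definition npda_outputs :: "('q, 'g, 'a, 'b) npda \<Rightarrow> 'a list \<Rightarrow> 'b list set" where
  "npda_outputs M x =
     {out. \<exists>q w st. (npda_step M)\<^sup>*\<^sup>* (npda_init M x) (q, w, st, out) \<and> q \<in> accepting M}"

text \<open>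
  A multi-valued partial function maps each input to its set of values, empty where undefined.
\<close>

definition CFLMV :: "'a set \<Rightarrow> 'b set \<Rightarrow> ('a list \<Rightarrow> 'b list set) set" where
  "CFLMV \<Sigma> \<Gamma> = {f. \<exists>M :: (nat, nat, 'a, 'b) npda.
     wf_npda \<Sigma> \<Gamma> M \<and> npda_linear_time \<Sigma> M \<and> (\<forall>x \<in> lists \<Sigma>. f x = npda_outputs M x)}"

definition CFLMV2 :: "'a set \<Rightarrow> 'b set \<Rightarrow> ('a list \<Rightarrow> 'b list set) set" where
  "CFLMV2 \<Sigma> \<Gamma> = {f. \<exists>g1 \<in> CFLMV \<Sigma> \<Gamma>. \<exists>g2 \<in> CFLMV \<Sigma> \<Gamma>. \<forall>x \<in> lists \<Sigma>. f x = g1 x \<inter> g2 x}"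

definition CFLMV2_advice :: "'a set \<Rightarrow> 'b set \<Rightarrow> ('a list \<Rightarrow> 'b list set) set" where
  "CFLMV2_advice \<Sigma> \<Gamma> = {f. \<exists>(\<Theta> :: nat set) h. \<exists>g \<in> CFLMV2 (\<Sigma> \<times> \<Theta>) \<Gamma>.
     alphabet \<Theta> \<and> length_preserving_advice \<Theta> h \<and>
     (\<forall>x \<in> lists \<Sigma>. f x = g (zip x (h (length x))))}"


section \<open>Logarithmic-space transducers\<close>

datatype dir = Left | Stay | Right

primrec move :: "dir \<Rightarrow> nat \<Rightarrow> nat" where
  "move Left i = i - 1"
| "move Stay i = i"
| "move Right i = Suc i"

record ('q, 'g, 'a, 'b) tm =
  tm_states :: "'q set"
  tm_symbols :: "'g set"
  tm_blank :: 'g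
  tm_initial :: 'q
  tm_halting :: "'q set"
  tm_delta :: "'q \<Rightarrow> 'a endmarked \<Rightarrow> 'g \<Rightarrow> 'q \<times> dir \<times> 'g \<times> dir \<times> 'b option"

definition wf_tm :: "'a set \<Rightarrow> 'b set \<Rightarrow> ('q, 'g, 'a, 'b) tm \<Rightarrow> bool" where
  "wf_tm \<Sigma> \<Gamma> M \<longleftrightarrow>
     finite (tm_states M) \<and> finite (tm_symbols M) \<and> tm_blank M \<in> tm_symbols M \<and>
     tm_initial M \<in> tm_states M \<and> tm_halting M \<subseteq> tm_states M \<and>
     (\<forall>q \<in> tm_states M - tm_halting M. \<forall>a \<in> endmarked_symbols \<Sigma>. \<forall>g \<in> tm_symbols M.
        tm_delta M q a g \<in>
          tm_states M \<times> UNIV \<times> tm_symbols M \<times> UNIV \<times> insert None (Some ` \<Gamma>))"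

text \<open>
  Configurations: state, input head position, work tape head position, work tape contents, output.
  The input head is confined to the endmarked input, and the work tape is infinite to the right; a
  move past either end of the input or past the left end of the work tape leaves the head in place.
\<close>

type_synonym ('q, 'g, 'b) tm_config = "'q \<times> nat \<times> nat \<times> (nat \<Rightarrow> 'g) \<times> 'b list"

definition tm_step ::
  "('q, 'g, 'a, 'b) tm \<Rightarrow> 'a list \<Rightarrow> ('q, 'g, 'b) tm_config \<Rightarrow> ('q, 'g, 'b) tm_config" where
  "tm_step M x = (\<lambda>(q, i, j, tape, out).
     if q \<in> tm_halting M then (q, i, j, tape, out)
     else (case tm_delta M q (endmarked_word x ! i) (tape j) of (q', d, g, e, b) \<Rightarrow>
       (q', min (length x + 1) (move d i), move e j, tape(j := g), out @ written b)))"

definition tm_run ::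
  "('q, 'g, 'a, 'b) tm \<Rightarrow> 'a list \<Rightarrow> nat \<Rightarrow> ('q, 'g, 'b) tm_config" where
  "tm_run M x t = (tm_step M x ^^ t) (tm_initial M, 0, 0, (\<lambda>_. tm_blank M), [])"

definition tm_computes :: "'a set \<Rightarrow> ('q, 'g, 'a, 'b) tm \<Rightarrow> ('a list \<Rightarrow> 'b list) \<Rightarrow> bool" where
  "tm_computes \<Sigma> M f \<longleftrightarrow> (\<forall>x \<in> lists \<Sigma>. \<exists>t q i j tape.
     tm_run M x t = (q, i, j, tape, f x) \<and> q \<in> tm_halting M)"

text \<open>
  The bound \<open>c * log 2 (n + 2)\<close> is \<open>O(log n)\<close> with the lengths 0 and 1 covered.
\<close>

definition tm_log_space :: "'a set \<Rightarrow> ('q, 'g, 'a, 'b) tm \<Rightarrow> bool" where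
  "tm_log_space \<Sigma> M \<longleftrightarrow> (\<exists>c :: real. \<forall>x \<in> lists \<Sigma>. \<forall>t q i j tape out.
     tm_run M x t = (q, i, j, tape, out) \<longrightarrow> real (j + 1) \<le> c * log 2 (real (length x + 2)))"

definition tm_poly_output :: "'a set \<Rightarrow> ('q, 'g, 'a, 'b) tm \<Rightarrow> bool" where
  "tm_poly_output \<Sigma> M \<longleftrightarrow> (\<exists>p :: nat poly. \<forall>x \<in> lists \<Sigma>. \<forall>t q i j tape out.
     tm_run M x t = (q, i, j, tape, out) \<longrightarrow> length out \<le> poly p (length x))"

definition FL :: "'a set \<Rightarrow> 'b set \<Rightarrow> ('a list \<Rightarrow> 'b list) set" where
  "FL \<Sigma> \<Gamma> = {f. \<exists>M :: (nat, nat, 'a, 'b) tm.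
     wf_tm \<Sigma> \<Gamma> M \<and> tm_computes \<Sigma> M f \<and> tm_log_space \<Sigma> M \<and> tm_poly_output \<Sigma> M}"


text \<open>The binary alphabet, with \<^const>\<open>False\<close> and \<^const>\<open>True\<close> for 0 and 1.\<close>

abbreviation bits :: "bool set" where
  "bits \<equiv> UNIV"

end

theory Submission
  imports
    Defs
    "HOL-Library.Sublist"
    "HOL-Real_Asymp.Real_Asymp"
begin

text \<open>
  The input is split into \<open>X\<^sub>1\<close>, pairs \<open>(Y\<^sub>2, D\<^sub>2)\<close>, pairs \<open>(Y\<^sub>3, D\<^sub>3)\<close>, \<open>X\<^sub>4\<close> and at most five further
  bits. The generator appends the parity \<open>f\<close> of the products \<open>X\<^sub>1[t] Y\<^sub>2[m-1-t] Y\<^sub>3[t] X\<^sub>4[m-1-t]\<close> and adds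
  the partial products of two and of three factors to \<open>D\<^sub>2\<close> and \<open>D\<^sub>3\<close>. This masking is an involution
  that leaves \<open>f\<close> unchanged, so the generator is injective and the advantage of a distinguisher \<open>A\<close>
  is a correlation of \<open>f\<close> with \<open>A\<close>. It also makes the graph of the generator an intersection of
  two pushdown relations: since the order of the indices alternates, a stack can multiply two
  neighbouring blocks; one machine guesses the masked \<open>D\<^sub>3\<close>, the other the masked \<open>D\<^sub>2\<close> and the parity.

  For the correlation bound, cut a derivation at a suffix of a right-hand side that separates the blocks.
  This writes a context-free language as a union of polynomially many pairs \<open>P \<inter> Q\<close> in which either
  \<open>P\<close> does not depend on \<open>X\<^sub>1\<close> and \<open>Q\<close> not on \<open>Y\<^sub>3\<close>, or \<open>P\<close> not on \<open>X\<^sub>4\<close> and \<open>Q\<close> not on \<open>Y\<^sub>2\<close>. With the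
  other two blocks fixed, each union of rectangles is close to a short sum of products: as long as
  many points lie in many rectangles, branch on the rectangle that covers most of them, and where
  few rectangles overlap, a Chebyshev polynomial of the number of rectangles approximates the
  union. The union of both kinds becomes a short sum of products of four functions, each
  independent of one block, and three applications of the Cauchy-Schwarz inequality show that such
  a product has correlation at most \<open>(7/8)\<^bsup>m/8\<^esup>\<close> with \<open>f\<close>. The parameters leave a total of
  \<open>O(2\<^bsup>-w\<^esup>)\<close> with \<open>w \<approx> m\<^bsup>1/8\<^esup>\<close>.
\<close>


section \<open>Cutting derivations of context-free grammars\<close>

text \<open>An ambiguous grammar makes the pieces \<open>P \<inter> Q\<close> overlap, so the
  correlation with their union is not controlled by summing over the pieces, and inclusion-exclusion
  has exponentially many terms. The approximation by few products removes this obstacle. It may be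
  expensive: the cube norm argument gains a factor exponentially small in \<open>m\<close>, so
  \<open>2 ^ o(m)\<close> products are affordable. With \<open>m\<close> about \<open>w ^ 8\<close>
  there are \<open>O(w ^ 16)\<close> cuts. If points in more than \<open>D\<close> rectangles count
  as heavy, the polynomial has degree about \<open>sqrt D * w\<close> and a branch has about
  \<open>w ^ 16 / D * w\<close> successes; \<open>D = w ^ 10\<close> makes these
  \<open>w ^ 6\<close> and \<open>w ^ 7\<close>, which stay below \<open>w ^ 8\<close> even after
  multiplication by \<open>log w\<close>. Four blocks are forced by the two kinds of cuts: the four
  predicates involved each miss a different block, the pattern of number-on-forehead protocols with
  four parties. The masked bits act as one-time pads: they publish the partial products on which the
  two machines have to agree, yet their distribution stays uniform.\<close>

text \<open>The sentential form is consumed from left to right, one symbol at a time, so an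
  induction follows the derivation in the order in which the word grows. Started from a right-hand
  side, this walk only meets suffixes of right-hand sides, which yields finitely many cut labels for
  arbitrary grammars.\<close>

inductive derives :: "('n, 'a) cfg \<Rightarrow> ('n, 'a) gsymbol list \<Rightarrow> 'a list \<Rightarrow> bool" for K where
  derives_Nil: "derives K [] []"
| derives_T: "derives K \<gamma> w \<Longrightarrow> derives K (T a # \<gamma>) (a # w)"
| derives_NT: "(A, r) \<in> productions K \<Longrightarrow> derives K r w1 \<Longrightarrow> derives K \<gamma> w2 \<Longrightarrow>
    derives K (NT A # \<gamma>) (w1 @ w2)"

lemma derives_append: "derives K \<gamma> w \<Longrightarrow> derives K \<delta> v \<Longrightarrow> derives K (\<gamma> @ \<delta>) (w @ v)"
proof (induction rule: derives.induct)
  case (derives_NT A r w1 \<gamma> w2)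
  then show ?case using derives.derives_NT[of A r K w1 "\<gamma> @ \<delta>" "w2 @ v"] by simp
qed (auto intro: derives.intros)

lemma derives_appendD:
  "derives K (\<gamma> @ \<delta>) w \<Longrightarrow> \<exists>w1 w2. w = w1 @ w2 \<and> derives K \<gamma> w1 \<and> derives K \<delta> w2"
proof (induction \<gamma> arbitrary: w)
  case Nil
  then show ?case by (auto intro: derives_Nil)
next
  case (Cons s \<gamma>)
  from Cons.prems have "derives K (s # (\<gamma> @ \<delta>)) w" by simp
  then show ?case
  proof cases
    case (derives_T v a)
    with Cons.IH obtain w1 w2 where "v = w1 @ w2" "derives K \<gamma> w1" "derives K \<delta> w2" by blast
    with derives_T show ?thesis by (metis append_Cons derives.derives_T)
  next
    case (derives_NT A r v1 v2)
    with Cons.IH obtain w1 w2 where "v2 = w1 @ w2" "derives K \<gamma> w1" "derives K \<delta> w2" by blast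
    with derives_NT show ?thesis by (metis append_assoc derives.derives_NT)
  qed
qed

lemma derives_terminals: "derives K (map T w) w"
  by (induction w) (auto intro: derives.intros)

lemma derives_step: "cfg_step K \<gamma> \<delta> \<Longrightarrow> derives K \<delta> w \<Longrightarrow> derives K \<gamma> w"
proof (induction rule: cfg_step.induct)
  case (1 A r u v)
  then obtain w1 w2 w3 where w: "w = w1 @ w2 @ w3" "derives K u w1" "derives K r w2" "derives K v w3"
    by (metis derives_appendD)
  have "derives K (NT A # v) (w2 @ w3)" by (rule derives_NT) (use 1 w in auto)
  with w show ?case by (simp add: derives_append)
qed

lemma cfg_step_context: "cfg_step K \<gamma> \<delta> \<Longrightarrow> cfg_step K (u @ \<gamma> @ v) (u @ \<delta> @ v)"
proof (induction rule: cfg_step.induct)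
  case (1 A r u' v')
  then show ?case using cfg_step.intros[of A r K "u @ u'" "v' @ v"] by simp
qed

lemma cfg_steps_context: "(cfg_step K)\<^sup>*\<^sup>* \<gamma> \<delta> \<Longrightarrow> (cfg_step K)\<^sup>*\<^sup>* (u @ \<gamma> @ v) (u @ \<delta> @ v)"
  by (induction rule: rtranclp_induct) (auto intro: rtranclp.rtrancl_into_rtrancl cfg_step_context)

lemma derives_imp_steps: "derives K \<gamma> w \<Longrightarrow> (cfg_step K)\<^sup>*\<^sup>* \<gamma> (map T w)"
proof (induction rule: derives.induct)
  case (derives_T \<gamma> w a)
  then show ?case using cfg_steps_context[of K \<gamma> "map T w" "[T a]" "[]"] by simp
next
  case (derives_NT A r w1 \<gamma> w2)
  have "cfg_step K (NT A # \<gamma>) (r @ \<gamma>)" using cfg_step.intros[of A r K "[]" \<gamma>] derives_NT by simp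
  moreover have "(cfg_step K)\<^sup>*\<^sup>* (r @ \<gamma>) (map T w1 @ \<gamma>)"
    using cfg_steps_context[of K r "map T w1" "[]" \<gamma>] derives_NT by simp
  moreover have "(cfg_step K)\<^sup>*\<^sup>* (map T w1 @ \<gamma>) (map T w1 @ map T w2)"
    using cfg_steps_context[of K \<gamma> "map T w2" "map T w1" "[]"] derives_NT by simp
  ultimately show ?case by (auto intro: converse_rtranclp_into_rtranclp rtranclp_trans)
qed simp

lemma cfg_language_derives: "w \<in> cfg_language K \<longleftrightarrow> derives K [NT (start K)] w"
proof
  assume "w \<in> cfg_language K"
  then have "(cfg_step K)\<^sup>*\<^sup>* [NT (start K)] (map T w)" by (simp add: cfg_language_def)
  then show "derives K [NT (start K)] w"
    by (induction rule: converse_rtranclp_induct) (auto intro: derives_terminals derives_step)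
qed (use derives_imp_steps in \<open>auto simp: cfg_language_def\<close>)

text \<open>The part after the dot in a dotted rule, with the start symbol as an extra right-hand
  side. Their number depends on the grammar alone, so the number of cuts is polynomial in the length
  of the word.\<close>

definition items :: "('n, 'a) cfg \<Rightarrow> ('n, 'a) gsymbol list set" where
  "items K = (\<Union>r \<in> insert [NT (start K)] (snd ` productions K). set (suffixes r))"

lemma finite_items: "finite (productions K) \<Longrightarrow> finite (items K)"
  by (simp add: items_def)

lemma in_items_iff: "\<gamma> \<in> items K \<longleftrightarrow> (\<exists>r \<in> insert [NT (start K)] (snd ` productions K). suffix \<gamma> r)"
  by (simp add: items_def del: suffixes.simps)

lemma items_tl: "s # \<gamma> \<in> items K \<Longrightarrow> \<gamma> \<in> items K"
  unfolding in_items_iff by (meson suffix_ConsD)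

lemma items_rhs: "(A, r) \<in> productions K \<Longrightarrow> r \<in> items K"
  unfolding in_items_iff by force

text \<open>The walk keeps the invariant that the current factor begins at or before
  \<open>b1\<close> and ends at or after \<open>b3\<close>, and looks at where the next symbol ends.
  Up to \<open>b1\<close> it moves on; up to \<open>b2\<close> the symbols after it are the cut; up
  to \<open>b3\<close> the right-hand side of that symbol is the cut; beyond \<open>b3\<close> the
  walk enters that right-hand side. The last assumption carries the context: any other yield of the
  current item may be put in its place.\<close>

lemma cfg_cut_aux:
  assumes "derives K \<gamma> w0" and "b1 < b2" "b2 \<le> b3"
    and "\<gamma> \<in> items K" "length u \<le> b1" "b3 \<le> length u + length w0"
    and "\<forall>w'. derives K \<gamma> w' \<longrightarrow> u @ w' @ v \<in> L"
  shows "\<exists>\<delta> u' w' v'. \<delta> \<in> items K \<and> u @ w0 @ v = u' @ w' @ v' \<and> derives K \<delta> w' \<and>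
    (\<forall>w''. derives K \<delta> w'' \<longrightarrow> u' @ w'' @ v' \<in> L) \<and>
    (b1 \<le> length u' \<and> length u' \<le> b2 \<and> b3 \<le> length u' + length w' \<or>
     length u' \<le> b1 \<and> b2 \<le> length u' + length w' \<and> length u' + length w' \<le> b3)"
  using assms
proof (induction arbitrary: u v rule: derives.induct)
  case derives_Nil
  then show ?case by auto
next
  case (derives_T \<gamma> w a)
  have ctx: "\<forall>w'. derives K \<gamma> w' \<longrightarrow> (u @ [a]) @ w' @ v \<in> L"
    using derives_T.prems(6) by (auto dest: derives.derives_T[of K \<gamma> _ a])
  have it: "\<gamma> \<in> items K" using derives_T.prems items_tl by blast
  show ?case
  proof (cases "length u < b1")
    case True
    then show ?thesis
      using derives_T.IH[OF derives_T.prems(1,2) it _ _ ctx] derives_T.prems(5) by simp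
  next
    case False
    \<comment> \<open>Here \<open>length u = b1\<close>, so the remaining symbols begin at
      \<open>b1 + 1 \<le> b2\<close> and form a cut of the first kind.\<close>
    show ?thesis
      by (rule exI[of _ \<gamma>], rule exI[of _ "u @ [a]"], rule exI[of _ w], rule exI[of _ v])
        (use False derives_T.hyps derives_T.prems(1,2,4,5) ctx it in simp)
  qed
next
  case (derives_NT A r w1 \<gamma> w2)
  have ctxR: "\<forall>w'. derives K \<gamma> w' \<longrightarrow> (u @ w1) @ w' @ v \<in> L"
  proof (intro allI impI)
    fix w' assume "derives K \<gamma> w'"
    then have "derives K (NT A # \<gamma>) (w1 @ w')" using derives_NT.hyps by (intro derives.derives_NT)
    then show "(u @ w1) @ w' @ v \<in> L" using derives_NT.prems(6) by fastforce
  qed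
  have ctxL: "\<forall>w'. derives K r w' \<longrightarrow> u @ w' @ (w2 @ v) \<in> L"
  proof (intro allI impI)
    fix w' assume "derives K r w'"
    then have "derives K (NT A # \<gamma>) (w' @ w2)" using derives_NT.hyps by (intro derives.derives_NT)
    then show "u @ w' @ w2 @ v \<in> L" using derives_NT.prems(6) by fastforce
  qed
  have it: "\<gamma> \<in> items K" "r \<in> items K"
    using items_tl[OF derives_NT.prems(3)] items_rhs[OF derives_NT.hyps(1)] by auto
  consider "length (u @ w1) \<le> b1" | "b1 < length (u @ w1)" "length (u @ w1) \<le> b2"
    | "b2 < length (u @ w1)" "length (u @ w1) \<le> b3" | "b3 < length (u @ w1)" by linarith
  then show ?case
  proof cases
    case 1
    then show ?thesis
      using derives_NT.IH(2)[OF derives_NT.prems(1,2) it(1) 1 _ ctxR] derives_NT.prems(5) by simp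
  next
    case 2
    show ?thesis
      by (rule exI[of _ \<gamma>], rule exI[of _ "u @ w1"], rule exI[of _ w2], rule exI[of _ v])
        (use 2 derives_NT.hyps derives_NT.prems(5) ctxR it in simp)
  next
    case 3
    show ?thesis
      by (rule exI[of _ r], rule exI[of _ u], rule exI[of _ w1], rule exI[of _ "w2 @ v"])
        (use 3 derives_NT.hyps derives_NT.prems(4) ctxL it in simp)
  next
    case 4
    then show ?thesis
      using derives_NT.IH(1)[OF derives_NT.prems(1,2) it(2) derives_NT.prems(4) _ ctxL] by simp
  qed
qed

lemma cfg_cut:
  assumes "w \<in> cfg_language K" and "b1 < b2" "b2 \<le> b3" "b3 \<le> length w"
  shows "\<exists>\<delta> u' w' v'. \<delta> \<in> items K \<and> w = u' @ w' @ v' \<and> derives K \<delta> w' \<and>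
    (\<forall>w''. derives K \<delta> w'' \<longrightarrow> u' @ w'' @ v' \<in> cfg_language K) \<and>
    (b1 \<le> length u' \<and> length u' \<le> b2 \<and> b3 \<le> length u' + length w' \<or>
     length u' \<le> b1 \<and> b2 \<le> length u' + length w' \<and> length u' + length w' \<le> b3)"
  using cfg_cut_aux[of K "[NT (start K)]" w b1 b2 b3 "[]" "[]" "cfg_language K"] assms
  by (simp add: cfg_language_derives in_items_iff)

section \<open>Approximating unions of rectangles\<close>

text \<open>A substitute for rank in which both factors of each product are bounded by one, so that
  a correlation bound for single products loses only the factor \<open>N\<close>.\<close>

definition rect_rep :: "nat \<Rightarrow> ('a \<Rightarrow> 'b \<Rightarrow> real) \<Rightarrow> bool" where
  "rect_rep N g \<longleftrightarrow> (\<exists>\<alpha> \<beta>. (\<forall>j x. \<bar>\<alpha> j x\<bar> \<le> 1) \<and> (\<forall>j y. \<bar>\<beta> j y\<bar> \<le> 1) \<and>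
     (\<forall>x y. g x y = (\<Sum>j<N. \<alpha> j x * \<beta> j y)))"

lemma rect_repI:
  assumes "\<And>j x. \<bar>\<alpha> j x\<bar> \<le> 1" "\<And>j y. \<bar>\<beta> j y\<bar> \<le> 1" "\<And>x y. g x y = (\<Sum>j<N. \<alpha> j x * \<beta> j y)"
  shows "rect_rep N g"
  unfolding rect_rep_def using assms by blast

lemma rect_rep_add:
  assumes "rect_rep M f" "rect_rep N g"
  shows "rect_rep (M + N) (\<lambda>x y. f x y + g x y)"
proof -
  obtain \<alpha> \<beta> where f: "\<And>j x. \<bar>\<alpha> j x\<bar> \<le> 1" "\<And>j y. \<bar>\<beta> j y\<bar> \<le> 1"
    "\<And>x y. f x y = (\<Sum>j<M. \<alpha> j x * \<beta> j y)" using assms(1) unfolding rect_rep_def by blast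
  obtain \<alpha>' \<beta>' where g: "\<And>j x. \<bar>\<alpha>' j x\<bar> \<le> 1" "\<And>j y. \<bar>\<beta>' j y\<bar> \<le> 1"
    "\<And>x y. g x y = (\<Sum>j<N. \<alpha>' j x * \<beta>' j y)" using assms(2) unfolding rect_rep_def by blast
  have split: "(\<Sum>j<M + N. h j) = (\<Sum>j<M. h j) + (\<Sum>j<N. h (M + j))" for h :: "nat \<Rightarrow> real"
    by (induction N) auto
  show ?thesis
    by (rule rect_repI[of "\<lambda>j x. if j < M then \<alpha> j x else \<alpha>' (j - M) x"
          "\<lambda>j y. if j < M then \<beta> j y else \<beta>' (j - M) y"]) (auto simp: f g split)
qed

lemma rect_rep_mult:
  assumes "rect_rep M f" "rect_rep N g"
  shows "rect_rep (M * N) (\<lambda>x y. f x y * g x y)"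
proof -
  obtain \<alpha> \<beta> where f: "\<And>j x. \<bar>\<alpha> j x\<bar> \<le> 1" "\<And>j y. \<bar>\<beta> j y\<bar> \<le> 1"
    "\<And>x y. f x y = (\<Sum>j<M. \<alpha> j x * \<beta> j y)" using assms(1) unfolding rect_rep_def by blast
  obtain \<alpha>' \<beta>' where g: "\<And>j x. \<bar>\<alpha>' j x\<bar> \<le> 1" "\<And>j y. \<bar>\<beta>' j y\<bar> \<le> 1"
    "\<And>x y. g x y = (\<Sum>j<N. \<alpha>' j x * \<beta>' j y)" using assms(2) unfolding rect_rep_def by blast
  have split: "(\<Sum>j<M * N. h j) = (\<Sum>i<M. \<Sum>j<N. h (i * N + j))" for h :: "nat \<Rightarrow> real"
  proof -
    have "(\<Sum>j<M * N. h j) = (\<Sum>i<M. sum h {i * N..<i * N + N})"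
      by (rule sum.nat_group[symmetric])
    also have "\<dots> = (\<Sum>i<M. \<Sum>j<N. h (i * N + j))"
    proof (rule sum.cong[OF refl])
      fix i
      show "sum h {i * N..<i * N + N} = (\<Sum>j<N. h (i * N + j))"
        using sum.shift_bounds_nat_ivl[of h 0 "i * N" N] by (simp add: atLeast0LessThan add.commute)
    qed
    finally show ?thesis .
  qed
  have dm: "(i * N + j) div N = i" "(i * N + j) mod N = j" if "j < N" for i j using that by auto
  have "f x y * g x y = (\<Sum>i<M. \<Sum>j<N. (\<alpha> i x * \<alpha>' j x) * (\<beta> i y * \<beta>' j y))" for x y
    unfolding f g sum_product by (simp add: mult_ac)
  then have "f x y * g x y = (\<Sum>j<M * N. (\<alpha> (j div N) x * \<alpha>' (j mod N) x) * (\<beta> (j div N) y * \<beta>' (j mod N) y))" for x y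
    by (simp add: split dm)
  then show ?thesis
    by (intro rect_repI[of "\<lambda>j x. \<alpha> (j div N) x * \<alpha>' (j mod N) x" "\<lambda>j y. \<beta> (j div N) y * \<beta>' (j mod N) y"])
      (auto simp: abs_mult f g intro: mult_le_one)
qed

lemma rect_rep_left:
  assumes "\<And>x. \<bar>a x\<bar> \<le> 1" shows "rect_rep 1 (\<lambda>x y. a x)"
  using assms by (intro rect_repI[of "\<lambda>_. a" "\<lambda>_ _. 1"]) auto

lemma rect_rep_right:
  assumes "\<And>y. \<bar>b y\<bar> \<le> 1" shows "rect_rep 1 (\<lambda>x y. b y)"
  using assms by (intro rect_repI[of "\<lambda>_ _. 1" "\<lambda>_. b"]) auto

lemma rect_rep_scale_left:
  assumes "\<And>x. \<bar>a x\<bar> \<le> 1" "rect_rep N g" shows "rect_rep N (\<lambda>x y. a x * g x y)"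
  using rect_rep_mult[OF rect_rep_left[OF assms(1)] assms(2)] by simp

lemma rect_rep_scale_right:
  assumes "\<And>y. \<bar>b y\<bar> \<le> 1" "rect_rep N g" shows "rect_rep N (\<lambda>x y. b y * g x y)"
  using rect_rep_mult[OF rect_rep_right[OF assms(1)] assms(2)] by simp

lemma rect_rep_zero: "rect_rep N (\<lambda>x y. 0)"
  by (intro rect_repI[of "\<lambda>_ _. 0" "\<lambda>_ _. 0"]) auto

lemma rect_rep_mono:
  assumes "rect_rep M g" "M \<le> N" shows "rect_rep N g"
  using rect_rep_add[OF assms(1) rect_rep_zero[of "N - M"]] assms(2) by simp

lemma rect_rep_power:
  assumes "rect_rep N g" shows "rect_rep (N ^ s) (\<lambda>x y. g x y ^ s)"
proof (induction s)
  case 0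
  then show ?case using rect_rep_left[of "\<lambda>_. 1"] by simp
next
  case (Suc s)
  then show ?case using rect_rep_mult[OF assms Suc] by simp
qed

lemma rect_rep_sum:
  assumes "finite I" "\<And>k. k \<in> I \<Longrightarrow> rect_rep 1 (g k)"
  shows "rect_rep (card I) (\<lambda>x y. \<Sum>k\<in>I. g k x y)"
  using assms
proof (induction rule: finite_induct)
  case (insert k I)
  then show ?case using rect_rep_add[of 1 "g k" "card I"] by simp
qed (simp add: rect_rep_zero)

text \<open>Chebyshev polynomials of degree \<open>2 ^ k\<close>, obtained by iterating \<open>T\<^sub>2\<close>.\<close>

primrec cheb :: "nat \<Rightarrow> real \<Rightarrow> real" where
  "cheb 0 t = t"
| "cheb (Suc k) t = 2 * (cheb k t)\<^sup>2 - 1"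

lemma cheb_le_1: "\<bar>t\<bar> \<le> 1 \<Longrightarrow> \<bar>cheb k t\<bar> \<le> 1"
proof (induction k)
  case (Suc k)
  then have "(cheb k t)\<^sup>2 \<le> 1" by (simp add: abs_square_le_1)
  then show ?case by (simp add: abs_if)
qed simp

text \<open>Each doubling of the degree multiplies the excess over 1 by at least four; hence a
  degree of about \<open>sqrt D\<close> lifts the point \<open>1 + 1 / D\<close> to 2.\<close>

lemma cheb_growth: "0 \<le> d \<Longrightarrow> 1 + 4 ^ k * d \<le> cheb k (1 + d)"
proof (induction k)
  case (Suc k)
  let ?e = "4 ^ k * d"
  have e: "0 \<le> ?e" using Suc by simp
  have "2 * (1 + ?e)\<^sup>2 - 1 = 1 + 4 * ?e + 2 * ?e\<^sup>2" by (simp add: power2_eq_square algebra_simps)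
  then have "1 + 4 * ?e \<le> 2 * (1 + ?e)\<^sup>2 - 1" by simp
  also have "\<dots> \<le> 2 * (cheb k (1 + d))\<^sup>2 - 1"
    using power_mono[of "1 + ?e" "cheb k (1 + d)" 2] Suc e by simp
  finally show ?case by simp
qed simp

lemma rect_rep_cheb:
  assumes "rect_rep N g" "1 \<le> N"
  shows "rect_rep ((3 * N) ^ (2 ^ k)) (\<lambda>x y. cheb k (g x y))"
proof -
  \<comment> \<open>A doubling step turns \<open>M\<close> products into
    \<open>2 * M * M + 1 \<le> 3 * M * M\<close>; for the quantity \<open>3 * M\<close> this
    recursion is exact squaring.\<close>
  have "\<exists>M\<ge>1. 3 * M = (3 * N) ^ (2 ^ k) \<and> rect_rep M (\<lambda>x y. cheb k (g x y))"
  proof (induction k)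
    case 0
    then show ?case using assms by auto
  next
    case (Suc k)
    then obtain M where M: "1 \<le> M" "3 * M = (3 * N) ^ (2 ^ k)" "rect_rep M (\<lambda>x y. cheb k (g x y))"
      by blast
    have "rect_rep (M * M + M * M) (\<lambda>x y. cheb k (g x y) * cheb k (g x y) + cheb k (g x y) * cheb k (g x y))"
      by (intro rect_rep_add rect_rep_mult M)
    from rect_rep_add[OF this rect_rep_left[of "\<lambda>_. -1"]]
    have "rect_rep (M * M + M * M + 1) (\<lambda>x y. cheb (Suc k) (g x y))"
      by (simp add: power2_eq_square)
    then have "rect_rep (3 * M * M) (\<lambda>x y. cheb (Suc k) (g x y))"
      by (rule rect_rep_mono) (use M(1) in \<open>simp add: Suc_le_eq\<close>)
    moreover have "3 * (3 * M * M) = (3 * N) ^ (2 ^ Suc k)"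
    proof -
      have "3 * (3 * M * M) = (3 * M) * (3 * M)" by simp
      also have "\<dots> = ((3 * N) ^ (2 ^ k))\<^sup>2" by (simp only: M(2) power2_eq_square)
      also have "\<dots> = (3 * N) ^ (2 ^ Suc k)" by (simp only: power_mult[symmetric] power_Suc2)
      finally show ?thesis .
    qed
    ultimately show ?case using M(1) by (intro exI[of _ "3 * M * M"]) (auto simp: Suc_le_eq)
  qed
  then obtain M where "3 * M = (3 * N) ^ (2 ^ k)" "rect_rep M (\<lambda>x y. cheb k (g x y))" by blast
  moreover from this have "M \<le> (3 * N) ^ (2 ^ k)" by linarith
  ultimately show ?thesis using rect_rep_mono by blast
qed

section \<open>Unions of rectangles: few overlaps by polynomials, many by branching\<close>

definition rect_union :: "'k set \<Rightarrow> ('k \<Rightarrow> 'a \<Rightarrow> bool) \<Rightarrow> ('k \<Rightarrow> 'b \<Rightarrow> bool) \<Rightarrow> 'a \<Rightarrow> 'b \<Rightarrow> real" where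
  "rect_union I P Q x y = of_bool (\<exists>k\<in>I. P k x \<and> Q k y)"

text \<open>Only the sides \<open>P k\<close> are counted: a light point lies in at most
  \<open>D\<close> rectangles whatever \<open>y\<close> is.\<close>

definition heavy :: "nat \<Rightarrow> 'k set \<Rightarrow> ('k \<Rightarrow> 'a \<Rightarrow> bool) \<Rightarrow> 'a set \<Rightarrow> 'a set" where
  "heavy D I P X = {x \<in> X. card {k \<in> I. P k x} > D}"

text \<open>For light \<open>x\<close> the number \<open>u\<close> of rectangles containing
  \<open>(x, y)\<close> is 0 or between 1 and \<open>D\<close>. The affine argument of
  \<open>cheb\<close> sends the range from 1 to \<open>D\<close> into \<open>[-1, 1]\<close> and 0
  to \<open>1 + 1 / D\<close>. After division by \<open>c\<close> the polynomial is 1 at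
  \<open>u = 0\<close> and at most 1/2 in absolute value otherwise, and the power \<open>s\<close>
  sharpens 1/2 to \<open>1 / 2 ^ s\<close>. The indicator \<open>a\<close> silences all other
  \<open>x\<close>.\<close>

lemma light_approx:
  fixes P :: "'k \<Rightarrow> 'a \<Rightarrow> bool" and Q :: "'k \<Rightarrow> 'b \<Rightarrow> bool"
  assumes "finite I" "1 \<le> D" "D \<le> 4 ^ d"
  shows "\<exists>g. rect_rep (1 + (3 * (2 + card I)) ^ (2 ^ d * s)) g \<and>
    (\<forall>x y. x \<notin> X \<longrightarrow> g x y = 0) \<and>
    (\<forall>x y. x \<in> heavy D I P X \<longrightarrow> g x y = 0) \<and>
    (\<forall>x y. x \<in> X - heavy D I P X \<longrightarrow> \<bar>rect_union I P Q x y - g x y\<bar> \<le> 1 / 2 ^ s)"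
proof -
  define u where "u x y = (\<Sum>k\<in>I. of_bool (P k x) * of_bool (Q k y) :: real)" for x y
  define c where "c = cheb d (1 + 1 / D)"
  define p where "p x y = cheb d (1 + (1 - u x y) / D) / c" for x y
  define a where "a x = (of_bool (x \<in> X - heavy D I P X) :: real)" for x
  define g where "g x y = a x * (1 - p x y ^ s)" for x y
  have c2: "2 \<le> c"
  proof -
    have "1 \<le> 4 ^ d * (1 / real D)" using assms by (simp add: field_simps)
    then show ?thesis using cheb_growth[of "1 / real D" d] unfolding c_def by simp
  qed
  have "rect_rep 1 (\<lambda>x y. - (1 / real D) * (of_bool (P k x) * of_bool (Q k y)))" for k
    by (rule rect_repI[of "\<lambda>_ x. - (1 / real D) * of_bool (P k x)" "\<lambda>_ y. of_bool (Q k y)"])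
      (use assms in auto)
  then have "rect_rep (card I) (\<lambda>x y. \<Sum>k\<in>I. - (1 / real D) * (of_bool (P k x) * of_bool (Q k y)))"
    by (intro rect_rep_sum assms)
  then have "rect_rep (card I) (\<lambda>x y. - (1 / real D) * u x y)"
    unfolding u_def sum_distrib_left .
  from rect_rep_add[OF rect_rep_add[OF rect_rep_left[of "\<lambda>_. 1"] rect_rep_left[of "\<lambda>_. 1 / real D"]] this]
  have "rect_rep (2 + card I) (\<lambda>x y. 1 + (1 - u x y) / D)"
    using assms by (simp add: diff_divide_distrib algebra_simps)
  from rect_rep_cheb[OF this, of d]
  have "rect_rep ((3 * (2 + card I)) ^ (2 ^ d)) (\<lambda>x y. cheb d (1 + (1 - u x y) / D))" by simp
  from rect_rep_scale_left[OF _ this, of "\<lambda>_. 1 / c"]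
  have "rect_rep ((3 * (2 + card I)) ^ (2 ^ d)) p" using c2 unfolding p_def by simp
  from rect_rep_power[OF this, of s] rect_rep_scale_left[of "\<lambda>_. -1"]
  have "rect_rep ((3 * (2 + card I)) ^ (2 ^ d * s)) (\<lambda>x y. - 1 * p x y ^ s)"
    unfolding power_mult by (metis abs_1 abs_minus order_refl)
  from rect_rep_scale_left[OF _ rect_rep_add[OF rect_rep_left[of "\<lambda>_. 1"] this], of a]
  have rep: "rect_rep (1 + (3 * (2 + card I)) ^ (2 ^ d * s)) g" unfolding g_def a_def by simp
  have near: "\<bar>rect_union I P Q x y - g x y\<bar> \<le> 1 / 2 ^ s" if x: "x \<in> X - heavy D I P X" for x y
  proof -
    have u: "u x y = card {k \<in> I. P k x \<and> Q k y}"
      unfolding u_def using assms(1) by (simp flip: of_bool_conj add: sum_of_bool_eq Int_def)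
    have "card {k \<in> I. P k x \<and> Q k y} \<le> card {k \<in> I. P k x}"
      by (intro card_mono) (use assms in auto)
    then have uD: "u x y \<le> D" using x unfolding u heavy_def by auto
    show ?thesis
    proof (cases "\<exists>k\<in>I. P k x \<and> Q k y")
      case False
      then have "{k \<in> I. P k x \<and> Q k y} = {}" by blast
      then have "u x y = 0" by (simp only: u card.empty of_nat_0)
      then have "p x y = 1" using c2 unfolding p_def c_def by simp
      then show ?thesis using False by (auto simp add: g_def rect_union_def)
    next
      case True
      then have "card {k \<in> I. P k x \<and> Q k y} \<noteq> 0" using assms(1) by auto
      then have u1: "1 \<le> u x y" unfolding u by simp
      have "\<bar>1 + (1 - u x y) / D\<bar> \<le> 1" using u1 uD assms(2) by (auto simp: abs_le_iff field_simps)
      then have "\<bar>cheb d (1 + (1 - u x y) / D)\<bar> \<le> 1" by (rule cheb_le_1)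
      then have "\<bar>p x y\<bar> \<le> 1 / 2" using c2 unfolding p_def by (simp add: field_simps)
      then have "\<bar>p x y\<bar> ^ s \<le> (1 / 2) ^ s" by (intro power_mono) auto
      then show ?thesis using True x by (simp add: g_def a_def rect_union_def power_abs power_one_over)
    qed
  qed
  show ?thesis
    by (rule exI[of _ g]) (use rep near in \<open>auto simp: g_def a_def\<close>)
qed

text \<open>For the \<open>P k\<close> that covers most heavy points, branch on \<open>Q k\<close>: if it contains \<open>y\<close>, all of \<open>P k\<close>
  is decided and a fraction \<open>D / K\<close> of the heavy points disappears; if not, the rectangle itself does. Hence at most
  \<open>j\<close> successes are needed along any branch.\<close>

lemma greedy_approx:
  fixes P :: "'k \<Rightarrow> 'a \<Rightarrow> bool" and Q :: "'k \<Rightarrow> 'b \<Rightarrow> bool" and K e :: real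
  assumes "finite I" "finite X" "1 \<le> D" "D \<le> 4 ^ d"
    and "real D \<le> K" "card I \<le> n" "real n \<le> K" "0 \<le> e"
    and "real (card (heavy D I P X)) * (1 - D / K) ^ j \<le> e"
  shows "\<exists>g. rect_rep ((1 + (3 * (2 + n)) ^ (2 ^ d * s)) * (2 * card I + 2) ^ j) g \<and>
    (\<forall>x y. x \<notin> X \<longrightarrow> g x y = 0) \<and>
    (\<forall>x y. x \<in> X \<longrightarrow> \<bar>rect_union I P Q x y - g x y\<bar> \<le> 1) \<and>
    (\<forall>y. (\<Sum>x\<in>X. \<bar>rect_union I P Q x y - g x y\<bar>) \<le> e + card X / 2 ^ s)"
  using assms
proof (induction "card I" arbitrary: I X j rule: less_induct)
  case less
  define M where "M = 1 + (3 * (2 + n)) ^ (2 ^ d * s)"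
  let ?H = "heavy D I P X"
  have H: "?H \<subseteq> X" "finite ?H" using less.prems(2) unfolding heavy_def by auto
  show ?case
  proof (cases "card ?H \<le> e")
    case True
    obtain g where g: "rect_rep (1 + (3 * (2 + card I)) ^ (2 ^ d * s)) g"
      "\<And>x y. x \<notin> X \<Longrightarrow> g x y = 0" "\<And>x y. x \<in> ?H \<Longrightarrow> g x y = 0"
      "\<And>x y. x \<in> X - ?H \<Longrightarrow> \<bar>rect_union I P Q x y - g x y\<bar> \<le> 1 / 2 ^ s"
      using light_approx[OF less.prems(1,3,4), of s X P Q] by blast
    have "(3 * (2 + card I)) ^ (2 ^ d * s) \<le> (3 * (2 + n)) ^ (2 ^ d * s)"
      by (intro power_mono) (use less.prems(6) in auto)
    then have "1 + (3 * (2 + card I)) ^ (2 ^ d * s) \<le> M" unfolding M_def by simp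
    also have "M \<le> M * (2 * card I + 2) ^ j" by simp
    finally have rep: "rect_rep (M * (2 * card I + 2) ^ j) g" using g(1) rect_rep_mono by blast
    have H1: "\<bar>rect_union I P Q x y - g x y\<bar> \<le> 1" if "x \<in> ?H" for x y
      using g(3)[OF that] by (simp add: rect_union_def)
    have "1 / 2 ^ s \<le> (1 :: real)" by simp
    then have le1: "\<bar>rect_union I P Q x y - g x y\<bar> \<le> 1" if "x \<in> X" for x y
      using H1[of x y] g(4)[of x y] that by (cases "x \<in> ?H") (simp, meson DiffI order_trans)
    have "(\<Sum>x\<in>X. \<bar>rect_union I P Q x y - g x y\<bar>) \<le> e + card X / 2 ^ s" for y
    proof -
      have "(\<Sum>x\<in>X. \<bar>rect_union I P Q x y - g x y\<bar>) =
          (\<Sum>x\<in>X - ?H. \<bar>rect_union I P Q x y - g x y\<bar>) + (\<Sum>x\<in>?H. \<bar>rect_union I P Q x y - g x y\<bar>)"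
        by (intro sum.subset_diff H less.prems(2))
      also have "(\<Sum>x\<in>X - ?H. \<bar>rect_union I P Q x y - g x y\<bar>) \<le> card (X - ?H) * (1 / 2 ^ s)"
        by (intro sum_bounded_above g(4))
      also have "\<dots> \<le> card X * (1 / 2 ^ s)"
        by (intro mult_right_mono) (auto intro!: card_mono less.prems(2))
      also have "(\<Sum>x\<in>?H. \<bar>rect_union I P Q x y - g x y\<bar>) \<le> real (card ?H) * 1"
        by (intro sum_bounded_above H1)
      finally show ?thesis using True by simp
    qed
    then show ?thesis using rep g(2) le1 unfolding M_def by blast
  next
    case False
    have K: "0 < K" using less.prems by linarith
    have "j \<noteq> 0"
    proof
      assume "j = 0"
      with less.prems(9) False show False by simp
    qed
    then obtain i where j: "j = Suc i" using not0_implies_Suc by blast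
    have Hne: "?H \<noteq> {}" using False less.prems(8) by (metis card.empty of_nat_0)
    \<comment> \<open>Averaging: every heavy point lies in more than \<open>D\<close> of the at most
      \<open>K\<close> sides, so by double counting some side contains a share of at least
      \<open>D / K\<close> of the heavy points.\<close>
    have "\<exists>k\<in>I. D / K * card ?H \<le> card {x \<in> ?H. P k x}"
    proof (rule ccontr)
      assume "\<not> ?thesis"
      then have small: "card {x \<in> ?H. P k x} \<le> D / K * card ?H" if "k \<in> I" for k using that by force
      have "D * card ?H < (\<Sum>x\<in>?H. card {k \<in> I. P k x})"
      proof -
        have "D * card ?H = (\<Sum>x\<in>?H. D)" by simp
        also have "\<dots> < (\<Sum>x\<in>?H. card {k \<in> I. P k x})"
          by (rule sum_strict_mono[OF H(2) Hne]) (auto simp: heavy_def)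
        finally show ?thesis .
      qed
      also have "\<dots> = (\<Sum>k\<in>I. card {x \<in> ?H. P k x})"
        by (rule sum_multicount_gen) (use H less.prems in auto)
      finally have "real (D * card ?H) < real (\<Sum>k\<in>I. card {x \<in> ?H. P k x})" by linarith
      also have "\<dots> \<le> card I * (D / K * card ?H)"
        using sum_bounded_above[of I "\<lambda>k. real (card {x \<in> ?H. P k x})", OF small] by simp
      also have "\<dots> \<le> K * (D / K * card ?H)"
        by (intro mult_right_mono) (use less.prems K in auto)
      also have "\<dots> = real (D * card ?H)" using K by simp
      finally show False by simp
    qed
    then obtain k where k: "k \<in> I" "D / K * card ?H \<le> card {x \<in> ?H. P k x}" by blast
    let ?I = "I - {k}" and ?X = "X - {x. P k x}"
    have cI: "card I = Suc (card ?I)" using k(1) less.prems(1) by (metis card_Suc_Diff1)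
    have sub: "card {l \<in> ?I. P l x} \<le> card {l \<in> I. P l x}" for x
      by (intro card_mono) (use less.prems in auto)
    have "card (heavy D ?I P ?X) \<le> card (?H - {x \<in> ?H. P k x})"
      by (intro card_mono) (use H sub in \<open>auto simp: heavy_def intro: less_le_trans\<close>)
    also have "\<dots> = card ?H - card {x \<in> ?H. P k x}" by (intro card_Diff_subset) (use H in auto)
    finally have "card (heavy D ?I P ?X) \<le> card ?H - card {x \<in> ?H. P k x}" .
    moreover have "card {x \<in> ?H. P k x} \<le> card ?H" by (intro card_mono) (use H in auto)
    ultimately have "real (card (heavy D ?I P ?X)) \<le> real (card ?H) - real (card {x \<in> ?H. P k x})"
      by linarith
    also have "\<dots> \<le> card ?H * (1 - D / K)" using k(2) by (simp add: algebra_simps)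
    \<comment> \<open>A success removes one factor \<open>1 - D / K\<close>, so the branch inside
      \<open>Q k\<close> continues with the smaller budget \<open>i\<close>.\<close>
    finally have "card (heavy D ?I P ?X) * (1 - D / K) ^ i \<le> card ?H * (1 - D / K) * (1 - D / K) ^ i"
      by (intro mult_right_mono) (use less.prems K in auto)
    also have "\<dots> \<le> e" using less.prems(9) unfolding j by (simp add: mult.assoc)
    finally have e1: "card (heavy D ?I P ?X) * (1 - D / K) ^ i \<le> e" .
    have "card (heavy D ?I P X) \<le> card ?H"
      by (intro card_mono) (use H sub in \<open>auto simp: heavy_def intro: less_le_trans\<close>)
    then have "card (heavy D ?I P X) * (1 - D / K) ^ j \<le> card ?H * (1 - D / K) ^ j"
      by (intro mult_right_mono) (use less.prems K in auto)
    then have e2: "card (heavy D ?I P X) * (1 - D / K) ^ j \<le> e" using less.prems(9) by linarith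
    have n: "card ?I \<le> n" "card ?I < card I" using cI less.prems(6) by auto
    obtain g1 where g1: "rect_rep (M * (2 * card ?I + 2) ^ i) g1"
      "\<And>x y. x \<notin> ?X \<Longrightarrow> g1 x y = 0"
      "\<And>x y. x \<in> ?X \<Longrightarrow> \<bar>rect_union ?I P Q x y - g1 x y\<bar> \<le> 1"
      "\<And>y. (\<Sum>x\<in>?X. \<bar>rect_union ?I P Q x y - g1 x y\<bar>) \<le> e + card ?X / 2 ^ s"
      using less.hyps[OF n(2) _ _ less.prems(3,4,5) n(1) less.prems(7,8) e1] less.prems(1,2)
      unfolding M_def by blast
    obtain g2 where g2: "rect_rep (M * (2 * card ?I + 2) ^ j) g2"
      "\<And>x y. x \<notin> X \<Longrightarrow> g2 x y = 0"
      "\<And>x y. x \<in> X \<Longrightarrow> \<bar>rect_union ?I P Q x y - g2 x y\<bar> \<le> 1"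
      "\<And>y. (\<Sum>x\<in>X. \<bar>rect_union ?I P Q x y - g2 x y\<bar>) \<le> e + card X / 2 ^ s"
      using less.hyps[OF n(2) _ _ less.prems(3,4,5) n(1) less.prems(7,8) e2] less.prems(1,2)
      unfolding M_def by blast
    \<comment> \<open>Inside \<open>Q k\<close> the points of \<open>P k\<close> get the value 1 and
      \<open>g1\<close>, which vanishes on them, treats the rest of \<open>X\<close>; outside
      \<open>Q k\<close> the rectangle is simply dropped, and \<open>g2\<close> treats all of
      \<open>X\<close> with the full budget \<open>j\<close>.\<close>
    define g where "g x y = of_bool (Q k y) * of_bool (x \<in> X \<and> P k x) + of_bool (Q k y) * g1 x y
      + of_bool (\<not> Q k y) * g2 x y" for x y
    have "rect_rep (1 + M * (2 * card ?I + 2) ^ i + M * (2 * card ?I + 2) ^ j) g"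
      unfolding g_def
      by (intro rect_rep_add rect_rep_scale_right rect_rep_left g1 g2) auto
    \<comment> \<open>Dropping one rectangle lowers the base by 2, and
      \<open>(c + 2) * c ^ i\<close> has room for the extra \<open>2 * c ^ i\<close>, which pays for
      \<open>g1\<close> and for the single product of the settled points.\<close>
    moreover have "1 + M * (2 * card ?I + 2) ^ i + M * (2 * card ?I + 2) ^ j \<le> M * (2 * card I + 2) ^ j"
    proof -
      let ?c = "2 * card ?I + 2"
      have "1 \<le> M * ?c ^ i" unfolding M_def by (simp add: Suc_le_eq)
      then have "1 + M * ?c ^ i + M * ?c ^ j \<le> M * ((?c + 2) * ?c ^ i)"
        unfolding j by (simp add: algebra_simps)
      also have "\<dots> \<le> M * ((?c + 2) * (?c + 2) ^ i)"
        by (intro mult_left_mono power_mono) auto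
      finally show ?thesis unfolding cI j by simp
    qed
    ultimately have rep: "rect_rep (M * (2 * card I + 2) ^ j) g" using rect_rep_mono by blast
    have I: "I = insert k ?I" using k(1) by auto
    have un: "rect_union I P Q x y = (if P k x \<and> Q k y then 1 else rect_union ?I P Q x y)" for x y
      unfolding rect_union_def using k(1) by auto
    have diff: "\<bar>rect_union I P Q x y - g x y\<bar> = (if Q k y then if P k x then 0 else
        \<bar>rect_union ?I P Q x y - g1 x y\<bar> else \<bar>rect_union ?I P Q x y - g2 x y\<bar>)" if "x \<in> X" for x y
      unfolding un g_def using that g1(2)[of x y] by auto
    have zero: "g x y = 0" if "x \<notin> X" for x y
      unfolding g_def using that g1(2)[of x y] g2(2)[of x y] by auto
    have le1: "\<bar>rect_union I P Q x y - g x y\<bar> \<le> 1" if "x \<in> X" for x y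
      unfolding diff[OF that] using g1(3)[of x y] g2(3)[of x y] that by auto
    \<comment> \<open>A fixed \<open>y\<close> follows exactly one of the two branches, so their
      errors are not added and the bound does not grow with the depth.\<close>
    have "(\<Sum>x\<in>X. \<bar>rect_union I P Q x y - g x y\<bar>) \<le> e + card X / 2 ^ s" for y
    proof (cases "Q k y")
      case True
      have "(\<Sum>x\<in>X. \<bar>rect_union I P Q x y - g x y\<bar>) = (\<Sum>x\<in>?X. \<bar>rect_union ?I P Q x y - g1 x y\<bar>)"
        by (rule sum.mono_neutral_cong_right) (use less.prems(2) diff True in auto)
      also have "\<dots> \<le> e + card ?X / 2 ^ s" by (rule g1(4))
      also have "\<dots> \<le> e + card X / 2 ^ s"
        by (intro add_left_mono divide_right_mono) (auto intro!: card_mono less.prems(2))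
      finally show ?thesis .
    next
      case False
      then have "(\<Sum>x\<in>X. \<bar>rect_union I P Q x y - g x y\<bar>) = (\<Sum>x\<in>X. \<bar>rect_union ?I P Q x y - g2 x y\<bar>)"
        by (intro sum.cong) (auto simp: diff)
      then show ?thesis using g2(4) by simp
    qed
    then show ?thesis using rep zero le1 unfolding M_def by blast
  qed
qed

section \<open>Generalized inner product and cube norms\<close>

lemma words_bits: "words bits n = {w. length w = n}"
  by (auto simp: words_def)

lemma words_0 [simp]: "words bits 0 = {[]}"
  by (auto simp: words_bits)

lemma words_Suc: "words bits (Suc n) = (#) True ` words bits n \<union> (#) False ` words bits n"
  by (auto simp: words_bits length_Suc_conv image_iff)

lemma finite_words [simp]: "finite (words bits n)"
  by (induction n) (auto simp: words_Suc)

lemma sum_words_Suc: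
  "(\<Sum>w\<in>words bits (Suc n). f w) = (\<Sum>w\<in>words bits n. f (True # w)) + (\<Sum>w\<in>words bits n. f (False # w))"
  unfolding words_Suc by (subst sum.union_disjoint) (auto simp: sum.reindex)

lemma card_words [simp]: "card (words bits n) = 2 ^ n"
  using sum_words_Suc[of "\<lambda>_. 1 :: nat"] by (induction n) auto

lemma sum_bool: "(\<Sum>x\<in>UNIV. f x) = f True + f False"
  for f :: "bool \<Rightarrow> 'a :: comm_monoid_add"
  by (simp add: UNIV_bool add.commute)

lemma sum_words_prod:
  fixes g :: "nat \<Rightarrow> bool \<Rightarrow> 'a :: comm_semiring_1"
  shows "(\<Sum>w\<in>words bits n. \<Prod>t<n. g t (w ! t)) = (\<Prod>t<n. \<Sum>x\<in>UNIV. g t x)"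
proof (induction n arbitrary: g)
  case (Suc n)
  show ?case
    using Suc[of "\<lambda>t. g (Suc t)"]
    by (simp add: sum_bool sum_words_Suc prod.lessThan_Suc_shift algebra_simps flip: sum_distrib_left del: prod.lessThan_Suc)
qed simp

text \<open>A bounded factor \<open>\<phi>\<close> that does not depend on \<open>c\<close>
  disappears at the price of a second copy of \<open>c\<close>.\<close>

lemma cauchy_schwarz_square:
  fixes \<phi> :: "'a \<Rightarrow> real" and g :: "'a \<Rightarrow> 'b \<Rightarrow> real"
  assumes "\<And>a. a \<in> A \<Longrightarrow> \<bar>\<phi> a\<bar> \<le> 1"
  shows "(\<Sum>a\<in>A. \<phi> a * (\<Sum>c\<in>C. g a c))\<^sup>2 \<le> card A * (\<Sum>a\<in>A. \<Sum>c\<in>C. \<Sum>c'\<in>C. g a c * g a c')"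
proof -
  have "(\<Sum>a\<in>A. \<phi> a * (\<Sum>c\<in>C. g a c))\<^sup>2 \<le> (\<Sum>a\<in>A. (\<phi> a)\<^sup>2) * (\<Sum>a\<in>A. (\<Sum>c\<in>C. g a c)\<^sup>2)"
    by (rule Cauchy_Schwarz_ineq_sum)
  also have "\<dots> \<le> card A * (\<Sum>a\<in>A. (\<Sum>c\<in>C. g a c)\<^sup>2)"
    using sum_bounded_above[of A "\<lambda>a. (\<phi> a)\<^sup>2" 1] assms
    by (intro mult_right_mono sum_nonneg) (auto simp: abs_square_le_1)
  also have "(\<Sum>a\<in>A. (\<Sum>c\<in>C. g a c)\<^sup>2) = (\<Sum>a\<in>A. \<Sum>c\<in>C. \<Sum>c'\<in>C. g a c * g a c')"
    by (simp add: power2_eq_square sum_product)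
  finally show ?thesis .
qed

text \<open>The three versions below have three, four and five outer variables: each application in
  \<open>nof_bound\<close> leaves two copies of the variable that it doubles.\<close>

lemma cauchy_schwarz_square3:
  fixes \<phi> :: "'a \<Rightarrow> 'a \<Rightarrow> 'a \<Rightarrow> real" and g :: "'a \<Rightarrow> 'a \<Rightarrow> 'a \<Rightarrow> 'a \<Rightarrow> real"
  assumes "\<And>a b c. \<bar>\<phi> a b c\<bar> \<le> 1"
  shows "(\<Sum>a\<in>W. \<Sum>b\<in>W. \<Sum>c\<in>W. \<phi> a b c * (\<Sum>x\<in>W. g a b c x))\<^sup>2 \<le>
    card W ^ 3 * (\<Sum>a\<in>W. \<Sum>b\<in>W. \<Sum>c\<in>W. \<Sum>x\<in>W. \<Sum>x'\<in>W. g a b c x * g a b c x')"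
  using cauchy_schwarz_square[of "W \<times> W \<times> W" "\<lambda>(a, b, c). \<phi> a b c" "\<lambda>(a, b, c). g a b c" W] assms
  by (simp add: sum.cartesian_product' card_cartesian_product power3_eq_cube mult.assoc case_prod_unfold)

lemma cauchy_schwarz_square4:
  fixes \<phi> :: "'a \<Rightarrow> 'a \<Rightarrow> 'a \<Rightarrow> 'a \<Rightarrow> real" and g :: "'a \<Rightarrow> 'a \<Rightarrow> 'a \<Rightarrow> 'a \<Rightarrow> 'a \<Rightarrow> real"
  assumes "\<And>a b c d. \<bar>\<phi> a b c d\<bar> \<le> 1"
  shows "(\<Sum>a\<in>W. \<Sum>b\<in>W. \<Sum>c\<in>W. \<Sum>d\<in>W. \<phi> a b c d * (\<Sum>x\<in>W. g a b c d x))\<^sup>2 \<le>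
    card W ^ 4 * (\<Sum>a\<in>W. \<Sum>b\<in>W. \<Sum>c\<in>W. \<Sum>d\<in>W. \<Sum>x\<in>W. \<Sum>x'\<in>W. g a b c d x * g a b c d x')"
  using cauchy_schwarz_square[of "W \<times> W \<times> W \<times> W" "\<lambda>(a, b, c, d). \<phi> a b c d" "\<lambda>(a, b, c, d). g a b c d" W] assms
  by (simp add: sum.cartesian_product' card_cartesian_product power4_eq_xxxx mult.assoc case_prod_unfold)

lemma cauchy_schwarz_square5:
  fixes \<phi> :: "'a \<Rightarrow> 'a \<Rightarrow> 'a \<Rightarrow> 'a \<Rightarrow> 'a \<Rightarrow> real" and g :: "'a \<Rightarrow> 'a \<Rightarrow> 'a \<Rightarrow> 'a \<Rightarrow> 'a \<Rightarrow> 'a \<Rightarrow> real"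
  assumes "\<And>a b c d e. \<bar>\<phi> a b c d e\<bar> \<le> 1"
  shows "(\<Sum>a\<in>W. \<Sum>b\<in>W. \<Sum>c\<in>W. \<Sum>d\<in>W. \<Sum>e\<in>W. \<phi> a b c d e * (\<Sum>x\<in>W. g a b c d e x))\<^sup>2 \<le>
    card W ^ 5 * (\<Sum>a\<in>W. \<Sum>b\<in>W. \<Sum>c\<in>W. \<Sum>d\<in>W. \<Sum>e\<in>W. \<Sum>x\<in>W. \<Sum>x'\<in>W. g a b c d e x * g a b c d e x')"
  using cauchy_schwarz_square[of "W \<times> W \<times> W \<times> W \<times> W" "\<lambda>(a, b, c, d, e). \<phi> a b c d e"
      "\<lambda>(a, b, c, d, e). g a b c d e" W] assms
  by (simp add: sum.cartesian_product' card_cartesian_product eval_nat_numeral mult.assoc case_prod_unfold)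

definition sgb :: "bool \<Rightarrow> real" where
  "sgb b = (if b then -1 else 1)"

lemma abs_sgb [simp]: "\<bar>sgb b\<bar> = 1"
  by (simp add: sgb_def)

definition gip :: "nat \<Rightarrow> bool list \<Rightarrow> bool list \<Rightarrow> bool list \<Rightarrow> bool list \<Rightarrow> real" where
  "gip m a b c d = (\<Prod>t<m. sgb (a ! t \<and> b ! t \<and> c ! t \<and> d ! t))"

text \<open>All eight terms cancel unless \<open>a\<close>, \<open>b\<close> and \<open>c\<close> all differ from their copies.\<close>

lemma sgb_cube:
  "sgb (a \<and> b \<and> c \<and> d) * sgb (a' \<and> b \<and> c \<and> d) * (sgb (a \<and> b' \<and> c \<and> d) * sgb (a' \<and> b' \<and> c \<and> d)) *
   (sgb (a \<and> b \<and> c' \<and> d) * sgb (a' \<and> b \<and> c' \<and> d) * (sgb (a \<and> b' \<and> c' \<and> d) * sgb (a' \<and> b' \<and> c' \<and> d))) =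
   sgb (a \<noteq> a' \<and> b \<noteq> b' \<and> c \<noteq> c' \<and> d)"
  by (cases a; cases a'; cases b; cases b'; cases c; cases c'; cases d) (simp_all add: sgb_def)

lemma gip_cube:
  "gip m a b c d * gip m a' b c d * (gip m a b' c d * gip m a' b' c d) *
   (gip m a b c' d * gip m a' b c' d * (gip m a b' c' d * gip m a' b' c' d)) =
   (\<Prod>t<m. sgb (a ! t \<noteq> a' ! t \<and> b ! t \<noteq> b' ! t \<and> c ! t \<noteq> c' ! t \<and> d ! t))"
  unfolding gip_def prod.distrib[symmetric] sgb_cube ..

text \<open>The coordinates are independent, so the sum is an \<open>m\<close>-th power. In one
  coordinate there are 64 choices of three pairs of bits. In 8 of them all three pairs differ and
  the two values of \<open>d\<close> cancel; each of the other 56 contributes 2, which makes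
  112.\<close>

lemma gip_cube_sum:
  "(\<Sum>a\<in>words bits m. \<Sum>a'\<in>words bits m. \<Sum>b\<in>words bits m. \<Sum>b'\<in>words bits m.
    \<Sum>c\<in>words bits m. \<Sum>c'\<in>words bits m. \<bar>\<Sum>d\<in>words bits m.
     (\<Prod>t<m. sgb (a ! t \<noteq> a' ! t \<and> b ! t \<noteq> b' ! t \<and> c ! t \<noteq> c' ! t \<and> d ! t))\<bar>) = 112 ^ m"
proof -
  let ?W = "words bits m"
  define h where "h a a' b b' c c' = (if a \<noteq> a' \<and> b \<noteq> b' \<and> c \<noteq> c' then 0 else 2 :: real)" for a a' b b' c c' :: bool
  have 0: "\<bar>\<Sum>d\<in>?W. (\<Prod>t<m. sgb (a ! t \<noteq> a' ! t \<and> b ! t \<noteq> b' ! t \<and> c ! t \<noteq> c' ! t \<and> d ! t))\<bar>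
    = (\<Prod>t<m. h (a ! t) (a' ! t) (b ! t) (b' ! t) (c ! t) (c' ! t))" for a a' b b' c c'
    by (subst sum_words_prod[where g = "\<lambda>t e. sgb (a ! t \<noteq> a' ! t \<and> b ! t \<noteq> b' ! t \<and> c ! t \<noteq> c' ! t \<and> e)"])
      (auto simp: abs_prod h_def sgb_def sum_bool intro!: prod.cong)
  have 1: "(\<Sum>c'\<in>?W. \<Prod>t<m. h (a ! t) (a' ! t) (b ! t) (b' ! t) (c ! t) (c' ! t)) =
    (\<Prod>t<m. \<Sum>c'\<in>UNIV. h (a ! t) (a' ! t) (b ! t) (b' ! t) (c ! t) c')" for a a' b b' c
    by (rule sum_words_prod[where g = "\<lambda>t c'. h (a ! t) (a' ! t) (b ! t) (b' ! t) (c ! t) c'"])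
  have 2: "(\<Sum>c\<in>?W. \<Prod>t<m. \<Sum>c'\<in>UNIV. h (a ! t) (a' ! t) (b ! t) (b' ! t) (c ! t) c') =
    (\<Prod>t<m. \<Sum>c\<in>UNIV. \<Sum>c'\<in>UNIV. h (a ! t) (a' ! t) (b ! t) (b' ! t) c c')" for a a' b b'
    by (rule sum_words_prod[where g = "\<lambda>t c. \<Sum>c'\<in>UNIV. h (a ! t) (a' ! t) (b ! t) (b' ! t) c c'"])
  have 3: "(\<Sum>b'\<in>?W. \<Prod>t<m. \<Sum>c\<in>UNIV. \<Sum>c'\<in>UNIV. h (a ! t) (a' ! t) (b ! t) (b' ! t) c c') =
    (\<Prod>t<m. \<Sum>b'\<in>UNIV. \<Sum>c\<in>UNIV. \<Sum>c'\<in>UNIV. h (a ! t) (a' ! t) (b ! t) b' c c')" for a a' b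
    by (rule sum_words_prod[where g = "\<lambda>t b'. \<Sum>c\<in>UNIV. \<Sum>c'\<in>UNIV. h (a ! t) (a' ! t) (b ! t) b' c c'"])
  have 4: "(\<Sum>b\<in>?W. \<Prod>t<m. \<Sum>b'\<in>UNIV. \<Sum>c\<in>UNIV. \<Sum>c'\<in>UNIV. h (a ! t) (a' ! t) (b ! t) b' c c') =
    (\<Prod>t<m. \<Sum>b\<in>UNIV. \<Sum>b'\<in>UNIV. \<Sum>c\<in>UNIV. \<Sum>c'\<in>UNIV. h (a ! t) (a' ! t) b b' c c')" for a a'
    by (rule sum_words_prod[where g = "\<lambda>t b. \<Sum>b'\<in>UNIV. \<Sum>c\<in>UNIV. \<Sum>c'\<in>UNIV. h (a ! t) (a' ! t) b b' c c'"])
  have 5: "(\<Sum>a'\<in>?W. \<Prod>t<m. \<Sum>b\<in>UNIV. \<Sum>b'\<in>UNIV. \<Sum>c\<in>UNIV. \<Sum>c'\<in>UNIV. h (a ! t) (a' ! t) b b' c c') =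
    (\<Prod>t<m. \<Sum>a'\<in>UNIV. \<Sum>b\<in>UNIV. \<Sum>b'\<in>UNIV. \<Sum>c\<in>UNIV. \<Sum>c'\<in>UNIV. h (a ! t) a' b b' c c')" for a
    by (rule sum_words_prod[where g = "\<lambda>t a'. \<Sum>b\<in>UNIV. \<Sum>b'\<in>UNIV. \<Sum>c\<in>UNIV. \<Sum>c'\<in>UNIV. h (a ! t) a' b b' c c'"])
  have 6: "(\<Sum>a\<in>?W. \<Prod>t<m. \<Sum>a'\<in>UNIV. \<Sum>b\<in>UNIV. \<Sum>b'\<in>UNIV. \<Sum>c\<in>UNIV. \<Sum>c'\<in>UNIV. h (a ! t) a' b b' c c') =
    (\<Prod>t<m. \<Sum>a\<in>UNIV. \<Sum>a'\<in>UNIV. \<Sum>b\<in>UNIV. \<Sum>b'\<in>UNIV. \<Sum>c\<in>UNIV. \<Sum>c'\<in>UNIV. h a a' b b' c c')"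
    by (rule sum_words_prod[where g = "\<lambda>t a. \<Sum>a'\<in>UNIV. \<Sum>b\<in>UNIV. \<Sum>b'\<in>UNIV. \<Sum>c\<in>UNIV. \<Sum>c'\<in>UNIV. h a a' b b' c c'"])
  have "(\<Sum>a\<in>UNIV. \<Sum>a'\<in>UNIV. \<Sum>b\<in>UNIV. \<Sum>b'\<in>UNIV. \<Sum>c\<in>UNIV. \<Sum>c'\<in>UNIV. h a a' b b' c c') = 112"
    by (simp add: sum_bool h_def)
  then show ?thesis unfolding 0 1 2 3 4 5 6 by simp
qed

text \<open>The eighth power stands for three squarings. Each one removes the function that misses
  the variable about to be doubled: \<open>\<phi>1\<close> for \<open>a\<close>,
  \<open>\<phi>2\<close> for \<open>b\<close>, \<open>\<phi>3\<close> for \<open>c\<close>. The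
  copies of \<open>\<phi>4\<close> do not depend on \<open>d\<close> and are bounded by 1 outside
  the sum over \<open>d\<close>. The exponent 25 is \<open>3 * 4 + 4 * 2 + 5\<close>.\<close>

lemma nof_bound:
  fixes \<phi>1 \<phi>2 \<phi>3 \<phi>4 :: "bool list \<Rightarrow> bool list \<Rightarrow> bool list \<Rightarrow> real"
  assumes "\<And>b c d. \<bar>\<phi>1 b c d\<bar> \<le> 1" "\<And>a c d. \<bar>\<phi>2 a c d\<bar> \<le> 1"
    "\<And>a b d. \<bar>\<phi>3 a b d\<bar> \<le> 1" "\<And>a b c. \<bar>\<phi>4 a b c\<bar> \<le> 1"
  shows "(\<Sum>a\<in>words bits m. \<Sum>b\<in>words bits m. \<Sum>c\<in>words bits m. \<Sum>d\<in>words bits m.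
      gip m a b c d * \<phi>1 b c d * \<phi>2 a c d * \<phi>3 a b d * \<phi>4 a b c) ^ 8 \<le> (2 ^ m) ^ 25 * 112 ^ m"
proof -
  let ?W = "words bits m"
  let ?N = "2 ^ m :: real"
  define p where "p a b c d = gip m a b c d * \<phi>2 a c d * \<phi>3 a b d * \<phi>4 a b c" for a b c d
  define q where "q a a' b c d = gip m a b c d * gip m a' b c d * (\<phi>3 a b d * \<phi>3 a' b d) *
    (\<phi>4 a b c * \<phi>4 a' b c)" for a a' b c d
  define r where "r a a' b b' c d = gip m a b c d * gip m a' b c d * (gip m a b' c d * gip m a' b' c d) *
    ((\<phi>4 a b c * \<phi>4 a' b c) * (\<phi>4 a b' c * \<phi>4 a' b' c))" for a a' b b' c d
  define e where "e a a' b b' c = (\<phi>4 a b c * \<phi>4 a' b c) * (\<phi>4 a b' c * \<phi>4 a' b' c)" for a a' b b' c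
  define S where "S = (\<Sum>a\<in>?W. \<Sum>b\<in>?W. \<Sum>c\<in>?W. \<Sum>d\<in>?W.
      gip m a b c d * \<phi>1 b c d * \<phi>2 a c d * \<phi>3 a b d * \<phi>4 a b c)"
  define S1 where "S1 = (\<Sum>b\<in>?W. \<Sum>c\<in>?W. \<Sum>d\<in>?W. \<Sum>a\<in>?W. \<Sum>a'\<in>?W. p a b c d * p a' b c d)"
  define S2 where "S2 = (\<Sum>a\<in>?W. \<Sum>a'\<in>?W. \<Sum>c\<in>?W. \<Sum>d\<in>?W. \<Sum>b\<in>?W. \<Sum>b'\<in>?W.
    q a a' b c d * q a a' b' c d)"
  define S3 where "S3 = (\<Sum>a\<in>?W. \<Sum>a'\<in>?W. \<Sum>b\<in>?W. \<Sum>b'\<in>?W. \<Sum>d\<in>?W. \<Sum>c\<in>?W. \<Sum>c'\<in>?W.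
    r a a' b b' c d * r a a' b b' c' d)"
  have sw1: "(\<Sum>a\<in>?W. \<Sum>b\<in>?W. \<Sum>c\<in>?W. \<Sum>d\<in>?W. f a b c d) =
      (\<Sum>b\<in>?W. \<Sum>c\<in>?W. \<Sum>d\<in>?W. \<Sum>a\<in>?W. f a b c d)" for f :: "_ \<Rightarrow> _ \<Rightarrow> _ \<Rightarrow> _ \<Rightarrow> real"
    by (subst sum.swap, rule sum.cong[OF refl], subst sum.swap, rule sum.cong[OF refl], rule sum.swap)
  have sw2: "(\<Sum>b\<in>?W. \<Sum>c\<in>?W. \<Sum>d\<in>?W. \<Sum>a\<in>?W. \<Sum>a'\<in>?W. f a a' b c d) =
      (\<Sum>a\<in>?W. \<Sum>a'\<in>?W. \<Sum>c\<in>?W. \<Sum>d\<in>?W. \<Sum>b\<in>?W. f a a' b c d)"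
    for f :: "_ \<Rightarrow> _ \<Rightarrow> _ \<Rightarrow> _ \<Rightarrow> _ \<Rightarrow> real"
    by (subst sw1[symmetric], rule sum.cong[OF refl], subst sw1[symmetric], rule sum.cong[OF refl],
        subst sum.swap, rule sum.cong[OF refl], rule sum.swap)
  have sw4: "(\<Sum>d\<in>?W. \<Sum>c\<in>?W. \<Sum>c'\<in>?W. f c c' d) = (\<Sum>c\<in>?W. \<Sum>c'\<in>?W. \<Sum>d\<in>?W. f c c' d)"
    for f :: "_ \<Rightarrow> _ \<Rightarrow> _ \<Rightarrow> real"
    by (subst sum.swap, rule sum.cong[OF refl], rule sum.swap)
  have sw3: "(\<Sum>c\<in>?W. \<Sum>d\<in>?W. \<Sum>b\<in>?W. \<Sum>b'\<in>?W. f b b' c d) =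
      (\<Sum>b\<in>?W. \<Sum>b'\<in>?W. \<Sum>d\<in>?W. \<Sum>c\<in>?W. f b b' c d)"
    for f :: "_ \<Rightarrow> _ \<Rightarrow> _ \<Rightarrow> _ \<Rightarrow> real"
    by (subst sum.swap, subst sw4[symmetric], rule sum.cong[OF refl], rule sw4)
  have le1: "\<bar>x * y\<bar> \<le> 1" if "\<bar>x\<bar> \<le> 1" "\<bar>y\<bar> \<le> 1" for x y :: real
    using that by (simp add: abs_mult mult_le_one)
  have "S = (\<Sum>b\<in>?W. \<Sum>c\<in>?W. \<Sum>d\<in>?W. \<phi>1 b c d * (\<Sum>a\<in>?W. p a b c d))"
    unfolding S_def by (subst sw1) (simp add: sum_distrib_left p_def mult_ac)
  then have 1: "S\<^sup>2 \<le> ?N ^ 3 * S1"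
    unfolding S1_def using cauchy_schwarz_square3[of \<phi>1 "\<lambda>b c d a. p a b c d" ?W] assms(1) by simp
  have "S1 = (\<Sum>a\<in>?W. \<Sum>a'\<in>?W. \<Sum>c\<in>?W. \<Sum>d\<in>?W. (\<phi>2 a c d * \<phi>2 a' c d) * (\<Sum>b\<in>?W. q a a' b c d))"
    unfolding S1_def by (subst sw2) (simp add: sum_distrib_left p_def q_def mult_ac)
  then have 2: "S1\<^sup>2 \<le> ?N ^ 4 * S2"
    unfolding S2_def
    using cauchy_schwarz_square4[of "\<lambda>a a' c d. \<phi>2 a c d * \<phi>2 a' c d" "\<lambda>a a' c d b. q a a' b c d" ?W]
      assms(2) le1 by simp
  have "S2 = (\<Sum>a\<in>?W. \<Sum>a'\<in>?W. \<Sum>b\<in>?W. \<Sum>b'\<in>?W. \<Sum>d\<in>?W.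
      ((\<phi>3 a b d * \<phi>3 a' b d) * (\<phi>3 a b' d * \<phi>3 a' b' d)) * (\<Sum>c\<in>?W. r a a' b b' c d))"
    unfolding S2_def
    by (rule sum.cong[OF refl], rule sum.cong[OF refl], subst sw3)
      (simp add: sum_distrib_left q_def r_def mult_ac)
  then have 3: "S2\<^sup>2 \<le> ?N ^ 5 * S3"
    unfolding S3_def
    using cauchy_schwarz_square5[of "\<lambda>a a' b b' d. (\<phi>3 a b d * \<phi>3 a' b d) * (\<phi>3 a b' d * \<phi>3 a' b' d)"
        "\<lambda>a a' b b' d c. r a a' b b' c d" ?W] assms(3) le1 by simp
  have "S3 = (\<Sum>a\<in>?W. \<Sum>a'\<in>?W. \<Sum>b\<in>?W. \<Sum>b'\<in>?W. \<Sum>c\<in>?W. \<Sum>c'\<in>?W. (e a a' b b' c * e a a' b b' c') *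
      (\<Sum>d\<in>?W. (\<Prod>t<m. sgb (a ! t \<noteq> a' ! t \<and> b ! t \<noteq> b' ! t \<and> c ! t \<noteq> c' ! t \<and> d ! t))))"
    unfolding S3_def gip_cube[symmetric]
    by (rule sum.cong[OF refl], rule sum.cong[OF refl], rule sum.cong[OF refl], rule sum.cong[OF refl], subst sw4)
      (simp add: sum_distrib_left r_def e_def mult_ac)
  also have "\<dots> \<le> (\<Sum>a\<in>?W. \<Sum>a'\<in>?W. \<Sum>b\<in>?W. \<Sum>b'\<in>?W. \<Sum>c\<in>?W. \<Sum>c'\<in>?W.
      \<bar>\<Sum>d\<in>?W. (\<Prod>t<m. sgb (a ! t \<noteq> a' ! t \<and> b ! t \<noteq> b' ! t \<and> c ! t \<noteq> c' ! t \<and> d ! t))\<bar>)"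
  proof (intro sum_mono)
    fix a a' b b' c c' and x :: real
    have "\<bar>e a a' b b' c * e a a' b b' c'\<bar> \<le> 1" unfolding e_def by (intro le1 assms)
    then have "\<bar>e a a' b b' c * e a a' b b' c'\<bar> * \<bar>x\<bar> \<le> 1 * \<bar>x\<bar>" for x by (intro mult_right_mono) auto
    then show "(e a a' b b' c * e a a' b b' c') * x \<le> \<bar>x\<bar>" for x
      by (metis abs_ge_self abs_mult mult_1 order_trans)
  qed
  also have "\<dots> = 112 ^ m" by (rule gip_cube_sum)
  finally have 4: "S3 \<le> 112 ^ m" .
  have "S ^ 8 = ((S\<^sup>2)\<^sup>2)\<^sup>2" by (simp flip: power_mult)
  also have "\<dots> \<le> ((?N ^ 3 * S1)\<^sup>2)\<^sup>2" by (intro power_mono 1) auto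
  also have "\<dots> = ?N ^ 12 * (S1\<^sup>2)\<^sup>2" by (simp add: power_mult_distrib flip: power_mult)
  also have "\<dots> \<le> ?N ^ 12 * (?N ^ 4 * S2)\<^sup>2" by (intro mult_left_mono power_mono 2) auto
  also have "\<dots> = ?N ^ 20 * S2\<^sup>2" by (simp add: power_mult_distrib flip: power_mult power_add)
  also have "\<dots> \<le> ?N ^ 20 * (?N ^ 5 * S3)" by (intro mult_left_mono 3) auto
  also have "\<dots> \<le> ?N ^ 20 * (?N ^ 5 * 112 ^ m)" by (intro mult_left_mono 4) auto
  also have "\<dots> = ?N ^ 25 * 112 ^ m" by (simp flip: power_add power_mult)
  finally show ?thesis unfolding S_def .
qed

text \<open>The eighth root of the bound in \<open>nof_bound\<close> relative to the number of
  quadruples: per coordinate \<open>2 ^ 25 * 112 / 2 ^ 32 = 7 / 8\<close>.\<close>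

definition gip_decay :: "nat \<Rightarrow> real" where
  "gip_decay m = (7 / 8) powr (m / 8)"

lemma gip_nof_bound:
  fixes \<phi>1 \<phi>2 \<phi>3 \<phi>4 :: "bool list \<Rightarrow> bool list \<Rightarrow> bool list \<Rightarrow> real"
  assumes "\<And>b c d. \<bar>\<phi>1 b c d\<bar> \<le> 1" "\<And>a c d. \<bar>\<phi>2 a c d\<bar> \<le> 1"
    "\<And>a b d. \<bar>\<phi>3 a b d\<bar> \<le> 1" "\<And>a b c. \<bar>\<phi>4 a b c\<bar> \<le> 1"
  shows "\<bar>\<Sum>a\<in>words bits m. \<Sum>b\<in>words bits m. \<Sum>c\<in>words bits m. \<Sum>d\<in>words bits m.
      gip m a b c d * \<phi>1 b c d * \<phi>2 a c d * \<phi>3 a b d * \<phi>4 a b c\<bar> \<le> (2 ^ m) ^ 4 * gip_decay m"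
    (is "\<bar>?S\<bar> \<le> _")
proof -
  define N where "N = (2 :: real) ^ m"
  have N: "N > 0" by (simp add: N_def)
  have "gip_decay m ^ 8 = gip_decay m powr 8"
    by (simp add: powr_numeral gip_decay_def)
  also have "\<dots> = (7 / 8) ^ m"
    by (simp add: gip_decay_def powr_powr powr_realpow)
  also have "\<dots> = (112 / 2 ^ 7) ^ m" by simp
  also have "\<dots> = 112 ^ m / N ^ 7"
    unfolding N_def by (simp only: power_divide power_mult[symmetric] mult.commute)
  finally have "(N ^ 4 * gip_decay m) ^ 8 = N ^ 32 * (112 ^ m / N ^ 7)"
    by (simp add: power_mult_distrib flip: power_mult)
  also have "\<dots> = (N ^ 25 * N ^ 7) * (112 ^ m / N ^ 7)" by (simp flip: power_add)
  also have "\<dots> = N ^ 25 * 112 ^ m"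
  proof -
    have "x * y * (z / y) = x * z" if "y \<noteq> 0" for x y z :: real using that by simp
    then show ?thesis using N by (metis less_irrefl power_not_zero)
  qed
  finally have "(N ^ 4 * gip_decay m) ^ 8 = N ^ 25 * 112 ^ m" .
  moreover have "\<bar>?S\<bar> ^ 8 \<le> N ^ 25 * 112 ^ m"
    using nof_bound[OF assms, of m] unfolding N_def by (subst power_even_abs) auto
  ultimately have "\<bar>?S\<bar> ^ 8 \<le> (N ^ 4 * gip_decay m) ^ 8" by linarith
  then show ?thesis
    unfolding N_def by (subst (asm) power_mono_iff) (auto simp: gip_decay_def)
qed

text \<open>Both errors enter linearly, since \<open>\<bar>1 - g\<bar> \<le> 2\<close> pointwise for the first approximation \<open>g\<close>.\<close>

lemma gip_rect_bound:
  fixes FR FL :: "bool list \<Rightarrow> bool list \<Rightarrow> bool list \<Rightarrow> bool list \<Rightarrow> real"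
  assumes R: "\<And>b d. \<exists>g. rect_rep B g \<and> (\<forall>c\<in>words bits m. \<forall>a. \<bar>FR b d c a - g c a\<bar> \<le> 1) \<and>
      (\<forall>a. (\<Sum>c\<in>words bits m. \<bar>FR b d c a - g c a\<bar>) \<le> \<epsilon>)"
    and L: "\<And>a c. \<exists>g. rect_rep B g \<and> (\<forall>d. (\<Sum>b\<in>words bits m. \<bar>FL a c b d - g b d\<bar>) \<le> \<epsilon>)"
    and FR: "\<And>b d c a. FR b d c a \<in> {0, 1}" and FL: "\<And>a c b d. FL a c b d \<in> {0, 1}"
  shows "\<bar>\<Sum>a\<in>words bits m. \<Sum>b\<in>words bits m. \<Sum>c\<in>words bits m. \<Sum>d\<in>words bits m.
      gip m a b c d * (1 - (1 - FR b d c a) * (1 - FL a c b d))\<bar>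
    \<le> (2 ^ m) ^ 4 * gip_decay m * (1 + (real B + 1)\<^sup>2) + 3 * (2 ^ m) ^ 3 * \<epsilon>"
proof -
  let ?W = "words bits m"
  \<comment> \<open>The approximations, and below their representations, are chosen once for each
    pair of fixed blocks; this makes them functions of these blocks, so that they can serve as
    factors of a product in four variables.\<close>
  define gR where "gR b d = (SOME g. rect_rep B g \<and> (\<forall>c\<in>?W. \<forall>a. \<bar>FR b d c a - g c a\<bar> \<le> 1) \<and>
      (\<forall>a. (\<Sum>c\<in>?W. \<bar>FR b d c a - g c a\<bar>) \<le> \<epsilon>))" for b d
  define gL where "gL a c = (SOME g. rect_rep B g \<and> (\<forall>d. (\<Sum>b\<in>?W. \<bar>FL a c b d - g b d\<bar>) \<le> \<epsilon>))" for a c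
  note gR = someI_ex[OF R, folded gR_def]
  note gL = someI_ex[OF L, folded gL_def]
  \<comment> \<open>The union of both kinds is \<open>1 - (1 - FR) * (1 - FL)\<close>, so it is the
    complements that get multiplied; each costs one extra product.\<close>
  have compl: "rect_rep (1 + B) (\<lambda>x y. 1 - g x y)" if "rect_rep B g" for g :: "bool list \<Rightarrow> bool list \<Rightarrow> real"
    using rect_rep_add[OF rect_rep_left[of "\<lambda>_. 1"] rect_rep_scale_left[OF _ that, of "\<lambda>_. -1"]] by simp
  define rep where "rep g p \<longleftrightarrow> (\<forall>j x. \<bar>fst p j x\<bar> \<le> 1) \<and> (\<forall>j y. \<bar>snd p j y\<bar> \<le> 1) \<and>
     (\<forall>x y. 1 - g x y = (\<Sum>j<1 + B. fst p j x * snd p j y))"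
    for g and p :: "(nat \<Rightarrow> bool list \<Rightarrow> real) \<times> (nat \<Rightarrow> bool list \<Rightarrow> real)"
  have "\<exists>p. rep g p" if "rect_rep B g" for g
  proof -
    from compl[OF that] obtain \<alpha> \<beta> where "\<forall>j x. \<bar>\<alpha> j x\<bar> \<le> 1" "\<forall>j y. \<bar>\<beta> j y\<bar> \<le> 1"
      "\<forall>x y. 1 - g x y = (\<Sum>j<1 + B. \<alpha> j x * \<beta> j y)"
      unfolding rect_rep_def by blast
    then have "rep g (\<alpha>, \<beta>)" unfolding rep_def by simp
    then show ?thesis ..
  qed
  from someI_ex[OF this] have some: "rep g (SOME p. rep g p)" if "rect_rep B g" for g using that by blast
  define \<alpha>R where "\<alpha>R b d = fst (SOME p. rep (gR b d) p)" for b d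
  define \<beta>R where "\<beta>R b d = snd (SOME p. rep (gR b d) p)" for b d
  define \<alpha>L where "\<alpha>L a c = fst (SOME p. rep (gL a c) p)" for a c
  define \<beta>L where "\<beta>L a c = snd (SOME p. rep (gL a c) p)" for a c
  have r: "\<bar>\<alpha>R b d j c\<bar> \<le> 1" "\<bar>\<beta>R b d j a\<bar> \<le> 1"
    "1 - gR b d c a = (\<Sum>j<1 + B. \<alpha>R b d j c * \<beta>R b d j a)" for a b c d j
  proof -
    have "rep (gR b d) (\<alpha>R b d, \<beta>R b d)"
      unfolding \<alpha>R_def \<beta>R_def prod.collapse by (rule some) (use gR in blast)
    then show "\<bar>\<alpha>R b d j c\<bar> \<le> 1" "\<bar>\<beta>R b d j a\<bar> \<le> 1"
      "1 - gR b d c a = (\<Sum>j<1 + B. \<alpha>R b d j c * \<beta>R b d j a)"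
      unfolding rep_def fst_conv snd_conv by blast+
  qed
  have l: "\<bar>\<alpha>L a c j b\<bar> \<le> 1" "\<bar>\<beta>L a c j d\<bar> \<le> 1"
    "1 - gL a c b d = (\<Sum>j<1 + B. \<alpha>L a c j b * \<beta>L a c j d)" for a b c d j
  proof -
    have "rep (gL a c) (\<alpha>L a c, \<beta>L a c)"
      unfolding \<alpha>L_def \<beta>L_def prod.collapse by (rule some) (use gL in blast)
    then show "\<bar>\<alpha>L a c j b\<bar> \<le> 1" "\<bar>\<beta>L a c j d\<bar> \<le> 1"
      "1 - gL a c b d = (\<Sum>j<1 + B. \<alpha>L a c j b * \<beta>L a c j d)"
      unfolding rep_def fst_conv snd_conv by blast+
  qed
  let ?S = "\<lambda>f. \<Sum>a\<in>?W. \<Sum>b\<in>?W. \<Sum>c\<in>?W. \<Sum>d\<in>?W. f a b c d :: real"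
  \<comment> \<open>The four bounded factors miss \<open>a\<close>, \<open>b\<close>,
    \<open>c\<close> and \<open>d\<close> in this order, as \<open>gip_nof_bound\<close>
    requires.\<close>
  let ?T = "\<lambda>i j. ?S (\<lambda>a b c d. gip m a b c d * \<alpha>R b d i c * \<beta>L a c j d * \<beta>R b d i a * \<alpha>L a c j b)"
  have T: "\<bar>?T i j\<bar> \<le> (2 ^ m) ^ 4 * gip_decay m" for i j
    by (rule gip_nof_bound) (use r l in auto)
  have pull: "?S (\<lambda>a b c d. \<Sum>i\<in>J. f i a b c d) = (\<Sum>i\<in>J. ?S (f i))" for J :: "nat set" and f
  proof (induction J rule: infinite_finite_induct)
    case (insert i J)
    then show ?case by (simp add: sum.distrib)
  qed auto
  have gg: "gip m a b c d * ((1 - gR b d c a) * (1 - gL a c b d)) = (\<Sum>i<1 + B. \<Sum>j<1 + B.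
      gip m a b c d * \<alpha>R b d i c * \<beta>L a c j d * \<beta>R b d i a * \<alpha>L a c j b)" for a b c d
    unfolding r(3) l(3) by (subst sum_product) (simp only: sum_distrib_left mult_ac)
  have eq: "?S (\<lambda>a b c d. gip m a b c d * ((1 - gR b d c a) * (1 - gL a c b d))) = (\<Sum>i<1 + B. \<Sum>j<1 + B. ?T i j)"
    unfolding gg pull ..
  have "\<bar>\<Sum>i<1 + B. \<Sum>j<1 + B. ?T i j\<bar> \<le> (\<Sum>i<1 + B. \<Sum>j<1 + B. (2 ^ m) ^ 4 * gip_decay m)"
    by (rule order_trans[OF sum_abs sum_mono], rule order_trans[OF sum_abs sum_mono], rule T)
  also have "(\<Sum>i<1 + B. \<Sum>j<1 + B. x) = x * (real B + 1)\<^sup>2" for x :: real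
    by (simp add: power2_eq_square add.commute)
  finally have main: "\<bar>?S (\<lambda>a b c d. gip m a b c d * ((1 - gR b d c a) * (1 - gL a c b d)))\<bar> \<le>
    (2 ^ m) ^ 4 * gip_decay m * (real B + 1)\<^sup>2"
    unfolding eq .
  have one: "\<bar>?S (\<lambda>a b c d. gip m a b c d)\<bar> \<le> (2 ^ m) ^ 4 * gip_decay m"
    using gip_nof_bound[of "\<lambda>_ _ _. 1" "\<lambda>_ _ _. 1" "\<lambda>_ _ _. 1" "\<lambda>_ _ _. 1" m] by simp
  have absgip: "\<bar>gip m a b c d\<bar> = 1" for a b c d
    by (simp add: gip_def abs_prod)
  let ?e = "\<lambda>a b c d. (1 - gR b d c a) * (1 - gL a c b d) - (1 - FR b d c a) * (1 - FL a c b d)"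
  have err: "\<bar>?e a b c d\<bar> \<le> \<bar>FR b d c a - gR b d c a\<bar> + 2 * \<bar>FL a c b d - gL a c b d\<bar>" if "c \<in> ?W" for a b c d
  proof -
    have "?e a b c d = (1 - FL a c b d) * (FR b d c a - gR b d c a) + (1 - gR b d c a) * (FL a c b d - gL a c b d)"
      by (simp add: algebra_simps)
    also have "\<bar>\<dots>\<bar> \<le> \<bar>1 - FL a c b d\<bar> * \<bar>FR b d c a - gR b d c a\<bar> + \<bar>1 - gR b d c a\<bar> * \<bar>FL a c b d - gL a c b d\<bar>"
      by (simp add: abs_triangle_ineq order_trans[OF abs_triangle_ineq] abs_mult)
    also have "\<dots> \<le> 1 * \<bar>FR b d c a - gR b d c a\<bar> + 2 * \<bar>FL a c b d - gL a c b d\<bar>"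
    proof (intro add_mono mult_right_mono)
      show "\<bar>1 - FL a c b d\<bar> \<le> 1" using FL[of a c b d] by auto
      have "\<bar>FR b d c a - gR b d c a\<bar> \<le> 1" using gR[of b d] that by blast
      then show "\<bar>1 - gR b d c a\<bar> \<le> 2" using FR[of b d c a] by auto
    qed auto
    finally show ?thesis by simp
  qed
  have "\<bar>?S (\<lambda>a b c d. gip m a b c d * ?e a b c d)\<bar> \<le> ?S (\<lambda>a b c d. \<bar>gip m a b c d * ?e a b c d\<bar>)"
    by (intro order_trans[OF sum_abs sum_mono] order_refl)
  also have "\<dots> \<le> ?S (\<lambda>a b c d. \<bar>FR b d c a - gR b d c a\<bar> + 2 * \<bar>FL a c b d - gL a c b d\<bar>)"
    by (intro sum_mono) (simp add: abs_mult absgip err)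
  also have "\<dots> = ?S (\<lambda>a b c d. \<bar>FR b d c a - gR b d c a\<bar>) + 2 * ?S (\<lambda>a b c d. \<bar>FL a c b d - gL a c b d\<bar>)"
    by (simp add: sum.distrib sum_distrib_left)
  also have "?S (\<lambda>a b c d. \<bar>FR b d c a - gR b d c a\<bar>) \<le> (\<Sum>a\<in>?W. \<Sum>b\<in>?W. \<Sum>d\<in>?W. \<epsilon>)"
    by (rule sum_mono, rule sum_mono, subst sum.swap, rule sum_mono) (use gR in blast)
  also have "?S (\<lambda>a b c d. \<bar>FL a c b d - gL a c b d\<bar>) \<le> (\<Sum>a\<in>?W. \<Sum>c\<in>?W. \<Sum>d\<in>?W. \<epsilon>)"
    by (rule sum_mono, subst sum.swap, rule sum_mono, subst sum.swap, rule sum_mono) (use gL in blast)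
  finally have error: "\<bar>?S (\<lambda>a b c d. gip m a b c d * ?e a b c d)\<bar> \<le> 3 * (2 ^ m) ^ 3 * \<epsilon>"
    by (simp add: power3_eq_cube mult_ac)
  have "?S (\<lambda>a b c d. gip m a b c d * (1 - (1 - FR b d c a) * (1 - FL a c b d))) =
      ?S (\<lambda>a b c d. gip m a b c d) - ?S (\<lambda>a b c d. gip m a b c d * ((1 - gR b d c a) * (1 - gL a c b d)))
      + ?S (\<lambda>a b c d. gip m a b c d * ?e a b c d)"
    unfolding sum_subtractf[symmetric] sum.distrib[symmetric]
    by (intro sum.cong refl) (simp add: algebra_simps)
  moreover have "\<bar>u\<bar> \<le> y * (1 + z) + e" if "u = p - q + r" "\<bar>p\<bar> \<le> y" "\<bar>q\<bar> \<le> y * z" "\<bar>r\<bar> \<le> e"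
    for u p q r y z e :: real
    using that by (simp add: distrib_left)
  ultimately show ?thesis using one main error by blast
qed

section \<open>Choice of the parameters and size of the approximation\<close>

lemma power_two_between: "1 \<le> x \<Longrightarrow> \<exists>d. x \<le> 2 ^ d \<and> 2 ^ d \<le> 2 * x" for x :: nat
proof (induction x rule: nat_induct_at_least)
  case base
  show ?case by (rule exI[of _ 0]) simp
next
  case (Suc x)
  then obtain d where d: "x \<le> 2 ^ d" "2 ^ d \<le> 2 * x" by blast
  show ?case
  proof (cases "Suc x \<le> 2 ^ d")
    case True
    then show ?thesis using d by (intro exI[of _ d]) simp
  next
    case False
    then have "x = 2 ^ d" using d by simp
    then show ?thesis using Suc.hyps by (intro exI[of _ "Suc d"]) simp
  qed
qed

lemma one_minus_inverse_power_le:
  assumes "1 \<le> M" shows "(1 - 1 / real M) ^ (M * w) \<le> 1 / 2 ^ w"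
proof -
  have "(1 - 1 / real M) ^ M \<le> exp (- 1 / real M) ^ M"
    using assms exp_ge_add_one_self[of "- 1 / real M"] by (intro power_mono) auto
  also have "\<dots> = exp (- 1)" using assms by (simp flip: exp_of_nat_mult)
  also have "\<dots> \<le> 1 / 2"
    using exp_ge_add_one_self[of 1] by (simp add: exp_minus field_simps)
  finally have "((1 - 1 / real M) ^ M) ^ w \<le> (1 / 2) ^ w"
    using assms by (intro power_mono) auto
  then show ?thesis by (simp add: power_mult power_one_over)
qed

text \<open>Nine times the number \<open>C * w ^ 16\<close> of rectangles dominates both bases in
  \<open>greedy_approx\<close>. The exponent collects the degree, at most \<open>2 * w ^ 7\<close>,
  and the \<open>C * w ^ 7\<close> successes, with some slack.\<close>

definition approx_rank :: "nat \<Rightarrow> nat \<Rightarrow> nat" where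
  "approx_rank C w = (9 * C * w ^ 16) ^ ((C + 4) * w ^ 7)"

text \<open>The instance \<open>D = w ^ 10\<close>, \<open>K = C * w ^ 16\<close>,
  \<open>s = w\<close>. The degree \<open>2 ^ d\<close> lies between \<open>w ^ 5\<close> and
  \<open>2 * w ^ 5\<close>, so \<open>D \<le> 4 ^ d\<close>. Since
  \<open>D / K = 1 / (C * w ^ 6)\<close>, a number of \<open>C * w ^ 7\<close> successes leaves at
  most a fraction \<open>1 / 2 ^ w\<close> of heavy points. The bound is
  \<open>approx_rank C w - 1\<close> because passing to the complement adds one product.\<close>

lemma greedy_approx_words:
  fixes P :: "'k \<Rightarrow> bool list \<Rightarrow> bool" and Q :: "'k \<Rightarrow> bool list \<Rightarrow> bool"
  assumes "finite I" "card I \<le> C * w ^ 16" "1 \<le> C" "1 \<le> w"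
  shows "\<exists>g. rect_rep (approx_rank C w - 1) g \<and>
    (\<forall>x\<in>words bits m. \<forall>y. \<bar>rect_union I P Q x y - g x y\<bar> \<le> 1) \<and>
    (\<forall>y. (\<Sum>x\<in>words bits m. \<bar>rect_union I P Q x y - g x y\<bar>) \<le> 2 * 2 ^ m / 2 ^ w)"
proof -
  obtain d where d: "w ^ 5 \<le> 2 ^ d" "2 ^ d \<le> 2 * w ^ 5"
    using power_two_between[of "w ^ 5"] assms(4) by auto
  define n where "n = C * w ^ 16"
  define Z where "Z = 9 * C * w ^ 16"
  have "(w ^ 5)\<^sup>2 \<le> (2 ^ d)\<^sup>2" using d(1) by (intro power_mono) auto
  then have D: "w ^ 10 \<le> 4 ^ d" by (simp flip: power_mult) (simp add: power_mult mult.commute[of d])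
  have n1: "1 \<le> n" unfolding n_def using assms by simp
  have "w ^ 10 \<le> w ^ 16" using assms by (intro power_increasing) auto
  also have "\<dots> \<le> n" unfolding n_def using assms by simp
  finally have Dn: "w ^ 10 \<le> n" .
  have q: "real (w ^ 10) / real n = 1 / real (C * w ^ 6)"
  proof -
    have "n = (C * w ^ 6) * w ^ 10" unfolding n_def by (simp flip: power_add)
    then show ?thesis using assms by simp
  qed
  have "(1 - real (w ^ 10) / real n) ^ (C * w ^ 7) \<le> 1 / 2 ^ w"
  proof -
    have "(1 - 1 / real (C * w ^ 6)) ^ (C * w ^ 6 * w) \<le> 1 / 2 ^ w"
      by (rule one_minus_inverse_power_le) (use assms in auto)
    moreover have "C * w ^ 6 * w = C * w ^ 7" by (simp add: numeral_eq_Suc)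
    ultimately show ?thesis unfolding q by simp
  qed
  moreover have "card (heavy (w ^ 10) I P (words bits m)) \<le> 2 ^ m"
    using card_mono[of "words bits m" "heavy (w ^ 10) I P (words bits m)"] by (simp add: heavy_def)
  then have "real (card (heavy (w ^ 10) I P (words bits m))) \<le> 2 ^ m"
    by (metis of_nat_le_iff of_nat_numeral of_nat_power)
  ultimately have e: "real (card (heavy (w ^ 10) I P (words bits m))) *
      (1 - real (w ^ 10) / real n) ^ (C * w ^ 7) \<le> 2 ^ m * (1 / 2 ^ w)"
    by (intro mult_mono) (use Dn n1 in auto)
  have "w ^ 10 \<ge> 1" using assms by simp
  from greedy_approx[OF assms(1) finite_words this D _ assms(2)[folded n_def] order_refl _ e, of w Q]
  obtain g where g: "rect_rep ((1 + (3 * (2 + n)) ^ (2 ^ d * w)) * (2 * card I + 2) ^ (C * w ^ 7)) g"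
    "\<And>x y. x \<in> words bits m \<Longrightarrow> \<bar>rect_union I P Q x y - g x y\<bar> \<le> 1"
    "\<And>y. (\<Sum>x\<in>words bits m. \<bar>rect_union I P Q x y - g x y\<bar>) \<le> 2 ^ m * (1 / 2 ^ w) + card (words bits m) / 2 ^ w"
    using Dn by (auto simp del: card_words)
  have Z: "3 * (2 + n) \<le> Z" "2 * card I + 2 \<le> Z" "2 \<le> Z"
  proof -
    have "Z = 9 * n" by (simp add: Z_def n_def)
    then show "3 * (2 + n) \<le> Z" "2 * card I + 2 \<le> Z" "2 \<le> Z"
      using n1 assms(2) unfolding n_def[symmetric] by auto
  qed
  have "2 ^ d * w \<le> 2 * w ^ 5 * w" using d(2) by (intro mult_right_mono) auto
  also have "\<dots> = 2 * w ^ 6" using power_Suc2[of w 5] by simp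
  also have "\<dots> \<le> 2 * w ^ 7" using power_increasing[of 6 7 w] assms by simp
  finally have "2 ^ d * w \<le> 2 * w ^ 7" .
  then have "(3 * (2 + n)) ^ (2 ^ d * w) \<le> Z ^ (2 * w ^ 7)"
    using Z by (intro order_trans[OF power_mono power_increasing]) auto
  then have "1 + (3 * (2 + n)) ^ (2 ^ d * w) \<le> 2 * Z ^ (2 * w ^ 7)"
    using one_le_power[of Z "2 * w ^ 7"] Z(3) by linarith
  also have "\<dots> \<le> Z ^ (1 + 2 * w ^ 7)" using Z by simp
  finally have le: "1 + (3 * (2 + n)) ^ (2 ^ d * w) \<le> Z ^ (1 + 2 * w ^ 7)" .
  have "(1 + (3 * (2 + n)) ^ (2 ^ d * w)) * (2 * card I + 2) ^ (C * w ^ 7) \<le> Z ^ (1 + 2 * w ^ 7) * Z ^ (C * w ^ 7)"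
    by (rule mult_mono[OF le power_mono[OF Z(2)]]) simp_all
  also have "\<dots> = Z ^ (1 + 2 * w ^ 7 + C * w ^ 7)" by (simp only: power_add)
  also have "\<dots> \<le> Z ^ ((C + 4) * w ^ 7) - 1"
  proof -
    have "Z ^ (1 + 2 * w ^ 7 + C * w ^ 7) < Z ^ ((C + 4) * w ^ 7)"
    proof (rule power_strict_increasing)
      have "1 + 2 * x + C * x < (C + 4) * x" if "1 \<le> x" for x using that by (simp add: algebra_simps)
      then show "1 + 2 * w ^ 7 + C * w ^ 7 < (C + 4) * w ^ 7" using assms by simp
    qed (use Z in simp)
    then show ?thesis by simp
  qed
  finally have "rect_rep (approx_rank C w - 1) g"
    using g(1) rect_rep_mono unfolding approx_rank_def Z_def by blast
  then show ?thesis using g(2,3) by (intro exI[of _ g]) simp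
qed

text \<open>The logarithm of the rank is of order \<open>w ^ 7 * ln w\<close>, whereas
  \<open>m \<ge> w ^ 8\<close> makes that of the decay at most a negative multiple of
  \<open>w ^ 8\<close>.\<close>

lemma approx_rank_decay:
  assumes "1 \<le> C"
  shows "\<forall>\<^sub>F w in sequentially. \<forall>m\<ge>w ^ 8.
    (7 / 8) powr (real m / 8) * (1 + (real (approx_rank C w))\<^sup>2) \<le> 1 / 2 ^ w"
proof -
  have "\<forall>\<^sub>F w in sequentially. ln 2 + 2 * ((real C + 4) * real w ^ 7 * ln (9 * real C * real w ^ 16)) + real w * ln 2
      \<le> real w ^ 8 / 8 * ln (8 / 7)"
    using assms by real_asymp
  moreover have "\<forall>\<^sub>F w in sequentially. 1 \<le> w" by (rule eventually_ge_at_top)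
  ultimately show ?thesis
  proof eventually_elim
    case (elim w)
    let ?L = "(real C + 4) * real w ^ 7 * ln (9 * real C * real w ^ 16)"
    have pos: "0 < 9 * real C * real w ^ 16" using elim assms by simp
    have r: "real (approx_rank C w) = exp ?L"
    proof -
      have "exp ?L = exp (real ((C + 4) * w ^ 7) * ln (9 * real C * real w ^ 16))" by simp
      also have "\<dots> = (9 * real C * real w ^ 16) ^ ((C + 4) * w ^ 7)"
        using pos by (simp only: exp_of_nat_mult exp_ln)
      finally show ?thesis by (simp add: approx_rank_def)
    qed
    have "1 \<le> 9 * real C * real w ^ 16"
      using elim assms by (smt (verit) mult_le_cancel_left1 of_nat_1 of_nat_le_iff one_le_power mult_left_mono)
    then have L: "0 \<le> ?L" by simp
    show ?case
    proof (intro allI impI)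
      fix m assume m: "w ^ 8 \<le> m"
      have "(7 / 8 :: real) powr (real m / 8) = exp (- (real m / 8 * ln (8 / 7)))"
        by (simp add: powr_def ln_div algebra_simps)
      also have "\<dots> \<le> exp (- (real w ^ 8 / 8 * ln (8 / 7)))"
        using m by (simp flip: of_nat_power)
      also have "\<dots> \<le> exp (- (ln 2 + 2 * ?L + real w * ln 2))" using elim by simp
      also have "\<dots> = 1 / (2 * (exp ?L)\<^sup>2 * 2 ^ w)"
      proof -
        have "exp (ln 2 + 2 * y + real w * ln 2) = 2 * (exp y)\<^sup>2 * 2 ^ w" for y :: real
          by (simp add: exp_add exp_double exp_of_nat_mult)
        then show ?thesis by (simp only: exp_minus inverse_eq_divide)
      qed
      finally have 1: "(7 / 8 :: real) powr (real m / 8) \<le> 1 / (2 * (exp ?L)\<^sup>2 * 2 ^ w)" .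
      have "1 + (exp ?L)\<^sup>2 \<le> 2 * (exp ?L)\<^sup>2" using L by simp
      then have "(7 / 8) powr (real m / 8) * (1 + (exp ?L)\<^sup>2) \<le> 1 / (2 * (exp ?L)\<^sup>2 * 2 ^ w) * (2 * (exp ?L)\<^sup>2)"
        using 1 by (intro mult_mono) auto
      also have "\<dots> = 1 / 2 ^ w" by simp
      finally show "(7 / 8) powr (real m / 8) * (1 + (real (approx_rank C w))\<^sup>2) \<le> 1 / 2 ^ w"
        unfolding r .
    qed
  qed
qed

section \<open>Correlation of context-free languages with the generalized inner product\<close>

text \<open>For a cut with positions \<open>i \<le> j\<close>, \<open>yields\<close> inspects only
  the factor between them and \<open>fits\<close> only what surrounds it; their conjunction is
  therefore a rectangle.\<close>

definition yields :: "('n, 'a) cfg \<Rightarrow> ('n, 'a) gsymbol list \<times> nat \<times> nat \<Rightarrow> 'a list \<Rightarrow> bool" where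
  "yields K = (\<lambda>(\<gamma>, i, j) w. derives K \<gamma> (drop i (take j w)))"

definition fits :: "('n, 'a) cfg \<Rightarrow> ('n, 'a) gsymbol list \<times> nat \<times> nat \<Rightarrow> 'a list \<Rightarrow> bool" where
  "fits K = (\<lambda>(\<gamma>, i, j) w. \<forall>v. derives K \<gamma> v \<longrightarrow> take i w @ v @ drop j w \<in> cfg_language K)"

text \<open>The blocks have lengths \<open>m\<close>, \<open>2 * m\<close>, \<open>2 * m\<close>,
  \<open>m\<close>, with borders at \<open>m\<close>, \<open>3 * m\<close>, \<open>5 * m\<close>. In
  a right cut the factor begins after the first block and covers the third; in a left cut it covers
  the second and ends before the fourth. Either way one block is invisible to \<open>yields\<close>
  and another one to \<open>fits\<close>.\<close>

definition right_cuts :: "('n, 'a) cfg \<Rightarrow> nat \<Rightarrow> nat \<Rightarrow> (('n, 'a) gsymbol list \<times> nat \<times> nat) set" where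
  "right_cuts K m n = items K \<times> {m..3 * m} \<times> {5 * m..n}"

definition left_cuts :: "('n, 'a) cfg \<Rightarrow> nat \<Rightarrow> (('n, 'a) gsymbol list \<times> nat \<times> nat) set" where
  "left_cuts K m = items K \<times> {..m} \<times> {3 * m..5 * m}"

lemma cfg_language_cuts:
  assumes "1 \<le> m" "5 * m \<le> length w"
  shows "w \<in> cfg_language K \<longleftrightarrow> (\<exists>k\<in>right_cuts K m (length w). yields K k w \<and> fits K k w) \<or>
    (\<exists>k\<in>left_cuts K m. yields K k w \<and> fits K k w)"
proof
  assume "w \<in> cfg_language K"
  from cfg_cut[OF this, of m "3 * m" "5 * m"] assms obtain \<delta> u v w' where *: "\<delta> \<in> items K" "w = u @ v @ w'"
    "derives K \<delta> v" "\<forall>v'. derives K \<delta> v' \<longrightarrow> u @ v' @ w' \<in> cfg_language K"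
    "m \<le> length u \<and> length u \<le> 3 * m \<and> 5 * m \<le> length u + length v \<or>
     length u \<le> m \<and> 3 * m \<le> length u + length v \<and> length u + length v \<le> 5 * m"
    by auto
  let ?k = "(\<delta>, length u, length u + length v)"
  have "yields K ?k w" "fits K ?k w" using * by (auto simp: yields_def fits_def)
  moreover have "?k \<in> right_cuts K m (length w) \<or> ?k \<in> left_cuts K m"
    using * by (auto simp: right_cuts_def left_cuts_def)
  ultimately show "(\<exists>k\<in>right_cuts K m (length w). yields K k w \<and> fits K k w) \<or>
    (\<exists>k\<in>left_cuts K m. yields K k w \<and> fits K k w)" by blast
next
  have mem: "w \<in> cfg_language K" if "yields K (\<gamma>, i, j) w" "fits K (\<gamma>, i, j) w" "i \<le> j" for \<gamma> i j
  proof -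
    have "take i w @ drop i (take j w) @ drop j w \<in> cfg_language K"
      using that by (auto simp: yields_def fits_def)
    also have "take i w @ drop i (take j w) @ drop j w = take i (take j w) @ drop i (take j w) @ drop j w"
      using that by (simp add: min_def)
    also have "\<dots> = w" by (metis append_assoc append_take_drop_id)
    finally show ?thesis .
  qed
  assume "(\<exists>k\<in>right_cuts K m (length w). yields K k w \<and> fits K k w) \<or>
    (\<exists>k\<in>left_cuts K m. yields K k w \<and> fits K k w)"
  then show "w \<in> cfg_language K"
    using mem by (fastforce simp: right_cuts_def left_cuts_def)
qed

lemma take_zip_eqI: "take i x = take i y \<Longrightarrow> take i (zip x h) = take i (zip y h)"
  by (simp add: take_zip)

lemma drop_zip_eqI: "drop i x = drop i y \<Longrightarrow> drop i (zip x h) = drop i (zip y h)"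
  by (simp add: drop_zip)

text \<open>The advice depends on the length only, so pairing with a fixed \<open>h\<close>
  preserves equality of prefixes and of suffixes, and the claims follow from the positions of the
  cut relative to the block borders.\<close>

lemma cuts_miss_blocks:
  assumes "length a = m" "length a' = m" "length b = 2 * m" "length b' = 2 * m"
    "length c = 2 * m" "length c' = 2 * m" "length d = m" "length d' = m"
  shows "k \<in> right_cuts K m n \<Longrightarrow> yields K k (zip (a @ b @ c @ d @ r) h) = yields K k (zip (a' @ b @ c @ d @ r) h)"
    and "k \<in> right_cuts K m n \<Longrightarrow> fits K k (zip (a @ b @ c @ d @ r) h) = fits K k (zip (a @ b @ c' @ d @ r) h)"
    and "k \<in> left_cuts K m \<Longrightarrow> yields K k (zip (a @ b @ c @ d @ r) h) = yields K k (zip (a @ b @ c @ d' @ r) h)"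
    and "k \<in> left_cuts K m \<Longrightarrow> fits K k (zip (a @ b @ c @ d @ r) h) = fits K k (zip (a @ b' @ c @ d @ r) h)"
proof -
  obtain \<gamma> i j where k: "k = (\<gamma>, i, j)" by (cases k)
  have t: "take p (x @ y) = take p x" if "p \<le> length x" for p and x y :: "'e list" using that by simp
  have u: "drop p (x @ y) = drop (p - length x) y" if "length x \<le> p" for p and x y :: "'e list" using that by simp
  {
    assume "k \<in> right_cuts K m n"
    then have ij: "m \<le> i" "i \<le> 3 * m" "5 * m \<le> j" by (auto simp: k right_cuts_def)
    have "drop i (zip (a @ b @ c @ d @ r) h) = drop i (zip (a' @ b @ c @ d @ r) h)"
      by (rule drop_zip_eqI) (use ij assms in \<open>simp only: u\<close>)
    then show "yields K k (zip (a @ b @ c @ d @ r) h) = yields K k (zip (a' @ b @ c @ d @ r) h)"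
      by (simp add: yields_def k drop_take)
    have "take i (zip ((a @ b) @ c @ d @ r) h) = take i (zip ((a @ b) @ c' @ d @ r) h)"
      by (rule take_zip_eqI, subst (1 2) t) (use ij assms in auto)
    moreover have "drop j (zip ((a @ b @ c) @ d @ r) h) = drop j (zip ((a @ b @ c') @ d @ r) h)"
      by (rule drop_zip_eqI, subst (1 2) u) (use ij assms in auto)
    ultimately show "fits K k (zip (a @ b @ c @ d @ r) h) = fits K k (zip (a @ b @ c' @ d @ r) h)"
      by (simp add: fits_def k)
  }
  {
    assume "k \<in> left_cuts K m"
    then have ij: "i \<le> m" "3 * m \<le> j" "j \<le> 5 * m" by (auto simp: k left_cuts_def)
    have "take j (zip ((a @ b @ c) @ d @ r) h) = take j (zip ((a @ b @ c) @ d' @ r) h)"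
      by (rule take_zip_eqI, subst (1 2) t) (use ij assms in auto)
    then show "yields K k (zip (a @ b @ c @ d @ r) h) = yields K k (zip (a @ b @ c @ d' @ r) h)"
      by (simp add: yields_def k)
    have "take i (zip (a @ b @ c @ d @ r) h) = take i (zip (a @ b' @ c @ d @ r) h)"
      by (rule take_zip_eqI, subst (1 2) t) (use ij assms in auto)
    moreover have "drop j (zip ((a @ b) @ c @ d @ r) h) = drop j (zip ((a @ b') @ c @ d @ r) h)"
      by (rule drop_zip_eqI, subst (1 2) u) (use ij assms in auto)
    ultimately show "fits K k (zip (a @ b @ c @ d @ r) h) = fits K k (zip (a @ b' @ c @ d @ r) h)"
      by (simp add: fits_def k)
  }
qed

text \<open>There are at most \<open>(6 * m + 7)\<^sup>2\<close> pairs of positions, and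
  \<open>6 * m + 7 \<le> 13 * m\<close>, whence \<open>169 = 13 * 13\<close>. The factor
  \<open>2 ^ 16\<close> comes from \<open>m < (w + 1) ^ 8 \<le> (2 * w) ^ 8\<close>.\<close>

lemma card_cuts:
  assumes "finite (productions K)" "1 \<le> m" "n \<le> 6 * m + 6" "m < (w + 1) ^ 8" "1 \<le> w"
  defines "C \<equiv> card (items K) * (169 * 2 ^ 16)"
  shows "1 \<le> C" "finite (right_cuts K m n)" "card (right_cuts K m n) \<le> C * w ^ 16"
    "finite (left_cuts K m)" "card (left_cuts K m) \<le> C * w ^ 16"
proof -
  have "[] \<in> items K" unfolding in_items_iff by auto
  then show "1 \<le> C" using finite_items[OF assms(1)] unfolding C_def by (auto simp: Suc_le_eq card_gt_0_iff)
  let ?A = "items K \<times> {..6 * m + 6} \<times> {..6 * m + 6}"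
  have A: "finite ?A" using finite_items[OF assms(1)] by auto
  have "m \<le> (2 * w) ^ 8"
    using power_mono[of "w + 1" "2 * w" 8] assms by linarith
  then have "m ^ 2 \<le> ((2 * w) ^ 8) ^ 2" by (intro power_mono) auto
  also have "\<dots> = 2 ^ 16 * w ^ 16" by (simp add: power_mult_distrib flip: power_mult)
  finally have m2: "m ^ 2 \<le> 2 ^ 16 * w ^ 16" .
  have "(6 * m + 7) * (6 * m + 7) \<le> (13 * m) * (13 * m)" using assms by (intro mult_mono) auto
  also have "\<dots> = 169 * m ^ 2" by (simp add: power2_eq_square)
  also have "\<dots> \<le> 169 * (2 ^ 16 * w ^ 16)" using m2 by simp
  finally have "card (items K) * ((6 * m + 7) * (6 * m + 7)) \<le> card (items K) * (169 * (2 ^ 16 * w ^ 16))"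
    by (intro mult_left_mono) auto
  then have cA: "card ?A \<le> C * w ^ 16"
    unfolding C_def by (simp add: card_cartesian_product mult_ac add_ac)
  have "right_cuts K m n \<subseteq> ?A" "left_cuts K m \<subseteq> ?A"
    using assms by (auto simp: right_cuts_def left_cuts_def)
  with A cA show "finite (right_cuts K m n)" "card (right_cuts K m n) \<le> C * w ^ 16"
    "finite (left_cuts K m)" "card (left_cuts K m) \<le> C * w ^ 16"
    by (auto intro: finite_subset order_trans[OF card_mono])
qed

section \<open>Splitting the input into blocks\<close>

primrec flat :: "('a \<times> 'a) list \<Rightarrow> 'a list" where
  "flat [] = []"
| "flat (p # ps) = fst p # snd p # flat ps"

lemma length_flat [simp]: "length (flat ps) = 2 * length ps"
  by (induction ps) auto

text \<open>The input in terms of the words \<open>a\<close>, \<open>b\<close>, \<open>c\<close>,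
  \<open>d\<close> that \<open>gip\<close> multiplies at a common index; the second and the fourth
  are stored backwards. The bits \<open>e\<close> and \<open>f\<close> are those to be masked,
  \<open>r\<close> is the rest.\<close>

definition gip_word :: "bool list \<Rightarrow> bool list \<Rightarrow> bool list \<Rightarrow> bool list \<Rightarrow> bool list \<Rightarrow> bool list \<Rightarrow> bool list \<Rightarrow> bool list" where
  "gip_word e f r a b c d = a @ flat (zip (rev b) e) @ flat (zip c f) @ rev d @ r"

text \<open>All of \<open>e\<close>, \<open>f\<close>, \<open>r\<close> and the advice are fixed,
  which leaves exactly the four words of \<open>gip\<close> as variables; the grammar enters through
  the number of its items alone.\<close>

lemma cfl_gip_correlation:
  fixes K :: "('n, bool \<times> 'c) cfg"
  assumes "finite (productions K)" "length e = m" "length f = m" "length h = 6 * m + length r" "length r \<le> 6"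
    and w: "w ^ 8 \<le> m" "m < (w + 1) ^ 8" "1 \<le> w"
    and rank: "gip_decay m * (1 + (real (approx_rank (card (items K) * (169 * 2 ^ 16)) w))\<^sup>2) \<le> 1 / 2 ^ w"
  shows "\<bar>\<Sum>a\<in>words bits m. \<Sum>b\<in>words bits m. \<Sum>c\<in>words bits m. \<Sum>d\<in>words bits m.
      gip m a b c d * of_bool (zip (gip_word e f r a b c d) h \<in> cfg_language K)\<bar> \<le> (2 ^ m) ^ 4 * (7 / 2 ^ w)"
proof -
  let ?W = "words bits m"
  let ?R = "approx_rank (card (items K) * (169 * 2 ^ 16)) w"
  define z where "z a b c d = zip (gip_word e f r a b c d) h" for a b c d
  \<comment> \<open>A dummy block: a predicate is evaluated with \<open>o'\<close> in place of the
    block that it misses, which makes it visibly independent of that block.\<close>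
  define o' where "o' = replicate m False"
  define IR where "IR = right_cuts K m (6 * m + length r)"
  define IL where "IL = left_cuts K m"
  define FR where "FR b d c a = rect_union IR (\<lambda>k c. yields K k (z o' b c d)) (\<lambda>k a. fits K k (z a b o' d)) c a" for b d c a
  define FL where "FL a c b d = rect_union IL (\<lambda>k b. yields K k (z a b c o')) (\<lambda>k d. fits K k (z a o' c d)) b d" for a c b d
  have "1 \<le> w ^ 8" using w(3) by simp
  then have m1: "1 \<le> m" using w(1) by linarith
  have C: "6 * m + length r \<le> 6 * m + 6" using assms by simp
  note cards = card_cuts[OF assms(1) m1 C w(2,3), folded IR_def IL_def]
  have o': "length o' = m" by (simp add: o'_def)
  have "1 \<le> ?R" unfolding approx_rank_def using cards(1) w(3) by (intro one_le_power) simp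
  then have B: "real (?R - 1) + 1 = ?R" by simp
  have mem: "of_bool (z a b c d \<in> cfg_language K) = 1 - (1 - FR b d c a) * (1 - FL a c b d)"
    if "a \<in> ?W" "b \<in> ?W" "c \<in> ?W" "d \<in> ?W" for a b c d
  proof -
    have l: "length a = m" "length b = m" "length c = m" "length d = m" using that by (auto simp: words_bits)
    have lz: "length (z a b c d) = 6 * m + length r"
      using l assms(2,3,4) by (simp add: z_def gip_word_def)
    have "z a b c d \<in> cfg_language K \<longleftrightarrow> (\<exists>k\<in>IR. yields K k (z a b c d) \<and> fits K k (z a b c d)) \<or>
      (\<exists>k\<in>IL. yields K k (z a b c d) \<and> fits K k (z a b c d))"
      using cfg_language_cuts[OF m1, of "z a b c d" K] unfolding IR_def IL_def lz by simp
    also have "(\<exists>k\<in>IR. yields K k (z a b c d) \<and> fits K k (z a b c d)) \<longleftrightarrow>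
        (\<exists>k\<in>IR. yields K k (z o' b c d) \<and> fits K k (z a b o' d))"
    proof (rule bex_cong[OF refl])
      fix k assume "k \<in> IR"
      then show "(yields K k (z a b c d) \<and> fits K k (z a b c d)) = (yields K k (z o' b c d) \<and> fits K k (z a b o' d))"
        unfolding z_def gip_word_def IR_def
        by (intro arg_cong2[of _ _ _ _ "(\<and>)"]
            cuts_miss_blocks(1)[where b' = "flat (zip (rev o') e)" and c' = "flat (zip o' f)" and d' = "rev o'"]
            cuts_miss_blocks(2)[where a' = o' and b' = "flat (zip (rev o') e)" and d' = "rev o'"])
          (use l o' assms(2,3) in auto)
    qed
    also have "(\<exists>k\<in>IL. yields K k (z a b c d) \<and> fits K k (z a b c d)) \<longleftrightarrow>
        (\<exists>k\<in>IL. yields K k (z a b c o') \<and> fits K k (z a o' c d))"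
    proof (rule bex_cong[OF refl])
      fix k assume "k \<in> IL"
      then show "(yields K k (z a b c d) \<and> fits K k (z a b c d)) = (yields K k (z a b c o') \<and> fits K k (z a o' c d))"
        unfolding z_def gip_word_def IL_def
        by (intro arg_cong2[of _ _ _ _ "(\<and>)"]
            cuts_miss_blocks(3)[where a' = o' and b' = "flat (zip (rev o') e)" and c' = "flat (zip o' f)"]
            cuts_miss_blocks(4)[where a' = o' and c' = "flat (zip o' f)" and d' = "rev o'"])
          (use l o' assms(2,3) in auto)
    qed
    finally show ?thesis unfolding FR_def FL_def rect_union_def by auto
  qed
  \<comment> \<open>The error \<open>3 * p ^ 3 * (2 * p / q)\<close> is
    \<open>p ^ 4 * (6 / q)\<close>; the main term adds another \<open>1 / q\<close>, which explains
    the constant 7.\<close>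
  have eq: "p ^ 4 * g * x + 3 * p ^ 3 * (2 * p / q) = p ^ 4 * (g * x) + p ^ 4 * (6 / q)" for p g x q :: real
    by (simp add: power4_eq_xxxx power3_eq_cube)
  have "\<bar>\<Sum>a\<in>?W. \<Sum>b\<in>?W. \<Sum>c\<in>?W. \<Sum>d\<in>?W. gip m a b c d * of_bool (z a b c d \<in> cfg_language K)\<bar> =
    \<bar>\<Sum>a\<in>?W. \<Sum>b\<in>?W. \<Sum>c\<in>?W. \<Sum>d\<in>?W. gip m a b c d * (1 - (1 - FR b d c a) * (1 - FL a c b d))\<bar>"
    by (intro arg_cong[of _ _ abs] sum.cong refl) (simp add: mem)
  also have "\<dots> \<le> (2 ^ m) ^ 4 * gip_decay m * (1 + (real (?R - 1) + 1)\<^sup>2) + 3 * (2 ^ m) ^ 3 * (2 * 2 ^ m / 2 ^ w)"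
  proof (rule gip_rect_bound)
    fix b d
    show "\<exists>g. rect_rep (?R - 1) g \<and> (\<forall>c\<in>?W. \<forall>a. \<bar>FR b d c a - g c a\<bar> \<le> 1) \<and>
      (\<forall>a. (\<Sum>c\<in>?W. \<bar>FR b d c a - g c a\<bar>) \<le> 2 * 2 ^ m / 2 ^ w)"
      unfolding FR_def by (rule greedy_approx_words[OF cards(2,3,1) w(3)])
  next
    fix a c
    show "\<exists>g. rect_rep (?R - 1) g \<and> (\<forall>d. (\<Sum>b\<in>?W. \<bar>FL a c b d - g b d\<bar>) \<le> 2 * 2 ^ m / 2 ^ w)"
      using greedy_approx_words[OF cards(4,5,1) w(3), of m] unfolding FL_def by blast
  qed (auto simp: FR_def FL_def rect_union_def)
  also have "\<dots> = (2 ^ m) ^ 4 * (gip_decay m * (1 + (real ?R)\<^sup>2)) + (2 ^ m) ^ 4 * (6 / 2 ^ w)"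
    unfolding B eq ..
  also have "\<dots> \<le> (2 ^ m) ^ 4 * (1 / 2 ^ w) + (2 ^ m) ^ 4 * (6 / 2 ^ w)"
    by (intro add_right_mono mult_left_mono rank) auto
  also have "\<dots> = (2 ^ m) ^ 4 * (7 / 2 ^ w)" by (simp add: field_simps)
  finally show ?thesis unfolding z_def .
qed

section \<open>The generator\<close>

fun unflat :: "'a list \<Rightarrow> ('a \<times> 'a) list" where
  "unflat (x # y # xs) = (x, y) # unflat xs"
| "unflat _ = []"

lemma unflat_flat [simp]: "unflat (flat ps) = ps"
  by (induction ps) auto

lemma flat_unflat: "even (length xs) \<Longrightarrow> flat (unflat xs) = xs"
  by (induction xs rule: unflat.induct) auto

lemma length_unflat [simp]: "length (unflat xs) = length xs div 2"
  by (induction xs rule: unflat.induct) auto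

primrec parity :: "bool list \<Rightarrow> bool" where
  "parity [] = False"
| "parity (x # xs) = (x \<noteq> parity xs)"

lemma parity_append: "parity (xs @ ys) = (parity xs \<noteq> parity ys)"
  by (induction xs) auto

lemma parity_rev [simp]: "parity (rev xs) = parity xs"
  by (induction xs) (auto simp: parity_append)

lemma sgb_parity: "sgb (parity xs) = (\<Prod>t<length xs. sgb (xs ! t))"
  by (induction xs) (auto simp: sgb_def prod.lessThan_Suc_shift simp del: prod.lessThan_Suc)

text \<open>The products that a stack filled with \<open>s\<close> can form with the first
  components of \<open>ps\<close>; the reversal is the last-in-first-out order.\<close>

definition carry :: "bool list \<Rightarrow> (bool \<times> bool) list \<Rightarrow> bool list" where
  "carry s ps = map2 (\<and>) (rev s) (map fst ps)"

definition mask :: "bool list \<Rightarrow> (bool \<times> bool) list \<Rightarrow> (bool \<times> bool) list" where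
  "mask s ps = map2 (\<lambda>p v. (fst p, snd p \<noteq> v)) ps (carry s ps)"

definition inner_bit :: "bool list \<Rightarrow> (bool \<times> bool) list \<Rightarrow> (bool \<times> bool) list \<Rightarrow> bool list \<Rightarrow> bool" where
  "inner_bit a ps qs d = parity (map2 (\<and>) (rev (carry (carry a ps) qs)) d)"

definition masked_word ::
  "bool list \<Rightarrow> (bool \<times> bool) list \<Rightarrow> (bool \<times> bool) list \<Rightarrow> bool list \<Rightarrow> bool list \<Rightarrow> bool list" where
  "masked_word a ps qs d r = a @ flat (mask a ps) @ flat (mask (carry a ps) qs) @ d @ r"

definition gip_gen :: "bool list \<Rightarrow> bool list" where
  "gip_gen x = (let m = length x div 6;
      a = take m x; ps = unflat (take (2 * m) (drop m x));
      qs = unflat (take (2 * m) (drop (3 * m) x)); d = take m (drop (5 * m) x); r = drop (6 * m) x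
    in masked_word a ps qs d r @ [inner_bit a ps qs d])"

lemma length_carry [simp]: "length (carry s ps) = min (length s) (length ps)"
  by (simp add: carry_def)

lemma length_mask [simp]: "length s = length ps \<Longrightarrow> length (mask s ps) = length ps"
  by (simp add: mask_def)

lemma map_fst_mask: "length s = length ps \<Longrightarrow> map fst (mask s ps) = map fst ps"
  by (auto simp: mask_def list_eq_iff_nth_eq)

lemma carry_mask [simp]: "length s = length ps \<Longrightarrow> carry s' (mask s ps) = carry s' ps"
  by (simp add: carry_def map_fst_mask)

lemma mask_mask [simp]: "length s = length ps \<Longrightarrow> mask s (mask s ps) = ps"
  unfolding mask_def[of s "mask s ps"] carry_mask
  by (auto simp: mask_def list_eq_iff_nth_eq prod_eq_iff)

lemma length_masked_word:
  "length a = m \<Longrightarrow> length ps = m \<Longrightarrow> length qs = m \<Longrightarrow> length d = m \<Longrightarrow>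
    length (masked_word a ps qs d r) = 6 * m + length r"
  by (simp add: masked_word_def)

lemma blocks_cases:
  fixes x :: "bool list"
  obtains a ps qs d r m where "x = a @ flat ps @ flat qs @ d @ r"
    "length a = m" "length ps = m" "length qs = m" "length d = m" "length r < 6"
proof -
  define m where "m = length x div 6"
  have m: "6 * m \<le> length x" "length x - 6 * m < 6" unfolding m_def by linarith+
  have f: "flat (unflat (take (2 * m) (drop i x))) = take (2 * m) (drop i x)" if "i + 2 * m \<le> length x" for i
    using that by (intro flat_unflat) simp
  have d: "drop i x = take k (drop i x) @ drop (k + i) x" for i k
    by (metis append_take_drop_id drop_drop)
  have "take m x @ flat (unflat (take (2 * m) (drop m x))) @ flat (unflat (take (2 * m) (drop (3 * m) x)))
      @ take m (drop (5 * m) x) @ drop (6 * m) x = x"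
    using m d[of m "2 * m"] d[of "3 * m" "2 * m"] d[of "5 * m" m] append_take_drop_id[of m x] by (simp add: f)
  note that[OF this[symmetric]]
  then show ?thesis using m by simp
qed

lemma gip_gen_blocks:
  assumes "length a = m" "length ps = m" "length qs = m" "length d = m" "length r < 6"
  shows "gip_gen (a @ flat ps @ flat qs @ d @ r) = masked_word a ps qs d r @ [inner_bit a ps qs d]"
proof -
  have "length (a @ flat ps @ flat qs @ d @ r) div 6 = m" using assms by simp
  then show ?thesis
    unfolding gip_gen_def Let_def using assms by simp
qed

lemma length_gip_gen: "length (gip_gen x) = length x + 1"
  by (rule blocks_cases[of x]) (simp add: gip_gen_blocks length_masked_word)

text \<open>Masking changes second components only, while the carries and the inner bit depend only
  on \<open>a\<close>, \<open>d\<close> and first components. A second application thus uses the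
  same masks, which cancel, and appends the same bit.\<close>

lemma gip_gen_involution: "gip_gen (butlast (gip_gen x)) = x @ [last (gip_gen x)]"
proof (rule blocks_cases[of x])
  fix a ps qs d r m
  assume x: "x = a @ flat ps @ flat qs @ d @ r"
    and l: "length a = m" "length ps = m" "length qs = m" "length d = m" "length r < 6"
  have "butlast (gip_gen x) = a @ flat (mask a ps) @ flat (mask (carry a ps) qs) @ d @ r"
    using l unfolding x by (simp add: gip_gen_blocks masked_word_def butlast_append)
  moreover have "gip_gen \<dots> = x @ [last (gip_gen x)]"
    using l unfolding x by (simp add: gip_gen_blocks masked_word_def inner_bit_def)
  ultimately show ?thesis by simp
qed

lemma gip_gen_split: "gip_gen x = butlast (gip_gen x) @ [last (gip_gen x)]"
  using length_gip_gen[of x] by (metis Suc_eq_plus1 append_butlast_last_id length_0_conv nat.distinct(1))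

lemma bij_butlast_gip_gen: "bij_betw (\<lambda>x. butlast (gip_gen x)) (words bits n) (words bits n)"
proof (rule bij_betw_byWitness[where f' = "\<lambda>x. butlast (gip_gen x)"])
  show "(\<lambda>x. butlast (gip_gen x)) ` words bits n \<subseteq> words bits n"
    by (auto simp: words_bits length_gip_gen)
qed (auto simp: gip_gen_involution words_bits length_gip_gen)

lemma last_gip_gen_butlast: "last (gip_gen (butlast (gip_gen x))) = last (gip_gen x)"
  by (simp add: gip_gen_involution)

lemma inj_gip_gen: "inj gip_gen"
  by (rule injI) (metis butlast_snoc gip_gen_involution)

text \<open>Each stack reverses the order once, and this cancels against the backward storage of
  \<open>b\<close> and \<open>d\<close>.\<close>

lemma last_gip_gen_word:
  assumes "length e = m" "length f = m" "length a = m" "length b = m" "length c = m" "length d = m" "length r < 6"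
  shows "sgb (last (gip_gen (gip_word e f r a b c d))) = gip m a b c d"
proof -
  have rr: "map2 (\<and>) (rev u) (rev v) = rev (map2 (\<and>) u v)" if "length u = length v" for u v
    using that by (simp add: zip_rev rev_map)
  have "carry a (zip (rev b) e) = rev (map2 (\<and>) a b)"
    using assms by (simp add: carry_def rr)
  then have "rev (carry (carry a (zip (rev b) e)) (zip c f)) = rev (map2 (\<and>) (map2 (\<and>) a b) c)"
    using assms by (simp add: carry_def)
  then have "map2 (\<and>) (rev (carry (carry a (zip (rev b) e)) (zip c f))) (rev d) =
      rev (map2 (\<and>) (map2 (\<and>) (map2 (\<and>) a b) c) d)"
    using assms by (simp only: rr length_map length_zip min.idem)
  then show ?thesis
    unfolding gip_word_def using assms
    by (simp add: gip_gen_blocks inner_bit_def sgb_parity gip_def conj_assoc)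
qed

lemma sum_gip_word:
  fixes g :: "bool list \<Rightarrow> 'b :: comm_monoid_add"
  assumes "n = 6 * m + l"
  shows "(\<Sum>x\<in>words bits n. g x) = (\<Sum>e\<in>words bits m. \<Sum>f\<in>words bits m. \<Sum>r\<in>words bits l.
    \<Sum>a\<in>words bits m. \<Sum>b\<in>words bits m. \<Sum>c\<in>words bits m. \<Sum>d\<in>words bits m. g (gip_word e f r a b c d))"
proof -
  let ?W = "words bits m"
  let ?A = "?W \<times> ?W \<times> words bits l \<times> ?W \<times> ?W \<times> ?W \<times> ?W"
  let ?F = "\<lambda>(e, f, r, a, b, c, d). gip_word e f r a b c d"
  have inj: "inj_on ?F ?A"
  proof (rule inj_onI)
    fix p q assume pq: "p \<in> ?A" "q \<in> ?A" "?F p = ?F q"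
    obtain e f r a b c d where p: "p = (e, f, r, a, b, c, d)" by (rule prod_cases7)
    obtain e' f' r' a' b' c' d' where q: "q = (e', f', r', a', b', c', d')" by (rule prod_cases7)
    from pq have w: "e \<in> ?W" "f \<in> ?W" "r \<in> words bits l" "a \<in> ?W" "b \<in> ?W" "c \<in> ?W" "d \<in> ?W"
        "e' \<in> ?W" "f' \<in> ?W" "r' \<in> words bits l" "a' \<in> ?W" "b' \<in> ?W" "c' \<in> ?W" "d' \<in> ?W"
      and eq: "gip_word e f r a b c d = gip_word e' f' r' a' b' c' d'"
      unfolding p q by auto
    have "a = a' \<and> flat (zip (rev b) e) = flat (zip (rev b') e') \<and> flat (zip c f) = flat (zip c' f') \<and> d = d' \<and> r = r'"
      using eq w by (simp add: gip_word_def words_bits)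
    then have "a = a' \<and> zip (rev b) e = zip (rev b') e' \<and> zip c f = zip c' f' \<and> d = d' \<and> r = r'"
      by (metis unflat_flat)
    then show "p = q"
      using w unfolding p q by (auto simp: words_bits zip_eq_conv)
  qed
  \<comment> \<open>Surjectivity by counting: six words of length \<open>m\<close> and one of length
    \<open>l\<close> form \<open>2 ^ n\<close> tuples.\<close>
  have "?F ` ?A = words bits n"
  proof (rule card_subset_eq)
    show "?F ` ?A \<subseteq> words bits n" using assms by (auto simp: words_bits gip_word_def)
    show "card (?F ` ?A) = card (words bits n)"
      using assms unfolding card_image[OF inj] by (simp add: card_cartesian_product flip: power_add)
  qed simp
  then have "(\<Sum>x\<in>words bits n. g x) = (\<Sum>x\<in>?F ` ?A. g x)" by simp
  also have "\<dots> = (\<Sum>p\<in>?A. g (?F p))" unfolding sum.reindex[OF inj] by simp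
  finally show ?thesis by (simp add: sum.cartesian_product' case_prod_unfold)
qed

section \<open>From correlation bounds to pseudorandomness\<close>

lemma measure_words:
  "measure_pmf.prob (pmf_of_set (words bits n)) {x. P x} = (\<Sum>x\<in>words bits n. of_bool (P x)) / 2 ^ n"
proof -
  have "words bits n \<noteq> {}" using card_words[of n] by (metis card.empty power_not_zero zero_neq_numeral)
  then show ?thesis
    by (simp add: measure_pmf_of_set Int_def sum_of_bool_eq)
qed

lemma sum_words_snoc:
  fixes g :: "bool list \<Rightarrow> real"
  shows "(\<Sum>x\<in>words bits (n + 1). g x) = (\<Sum>x\<in>words bits n. g (x @ [True]) + g (x @ [False]))"
proof -
  have "words bits (n + 1) = (\<lambda>x. x @ [True]) ` words bits n \<union> (\<lambda>x. x @ [False]) ` words bits n"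
    by (auto simp: words_bits image_iff length_Suc_conv_rev)
  then show ?thesis
    by (simp only:) (subst sum.union_disjoint; auto simp: sum.reindex inj_on_def sum.distrib)
qed

text \<open>Reindexing along the masking bijection turns the output into \<open>y\<close> followed
  by its own inner bit, which masking leaves unchanged. For each \<open>y\<close>, twice the
  indicator at this bit minus the indicators at both bits is the sign of the bit times the
  difference of the indicators at \<open>False\<close> and \<open>True\<close>.\<close>

lemma distinguishing_advantage:
  "\<bar>measure_pmf.prob (pmf_of_set (words bits n)) {x. gip_gen x \<in> A} -
    measure_pmf.prob (pmf_of_set (words bits (n + 1))) {y. y \<in> A}\<bar> \<le>
   (\<bar>\<Sum>y\<in>words bits n. sgb (last (gip_gen y)) * of_bool (y @ [True] \<in> A)\<bar> +
    \<bar>\<Sum>y\<in>words bits n. sgb (last (gip_gen y)) * of_bool (y @ [False] \<in> A)\<bar>) / (2 * 2 ^ n)"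
proof -
  let ?W = "words bits n"
  let ?s = "\<lambda>y. sgb (last (gip_gen y))"
  have "(\<Sum>x\<in>?W. of_bool (gip_gen x \<in> A) :: real) =
      (\<Sum>x\<in>?W. of_bool (butlast (gip_gen x) @ [last (gip_gen (butlast (gip_gen x)))] \<in> A))"
    by (simp add: last_gip_gen_butlast flip: gip_gen_split)
  also have "\<dots> = (\<Sum>y\<in>?W. of_bool (y @ [last (gip_gen y)] \<in> A))"
    by (rule sum.reindex_bij_betw[OF bij_butlast_gip_gen])
  finally have "2 * (\<Sum>x\<in>?W. of_bool (gip_gen x \<in> A) :: real) - (\<Sum>x\<in>words bits (n + 1). of_bool (x \<in> A)) =
      (\<Sum>y\<in>?W. 2 * of_bool (y @ [last (gip_gen y)] \<in> A) - (of_bool (y @ [True] \<in> A) + of_bool (y @ [False] \<in> A)))"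
    unfolding sum_words_snoc by (simp add: sum_subtractf sum_distrib_left)
  also have "\<dots> = (\<Sum>y\<in>?W. ?s y * of_bool (y @ [False] \<in> A) - ?s y * of_bool (y @ [True] \<in> A))"
    by (intro sum.cong refl) (auto simp: sgb_def)
  also have "\<dots> = (\<Sum>y\<in>?W. ?s y * of_bool (y @ [False] \<in> A)) - (\<Sum>y\<in>?W. ?s y * of_bool (y @ [True] \<in> A))"
    by (rule sum_subtractf)
  finally have "\<bar>2 * (\<Sum>x\<in>?W. of_bool (gip_gen x \<in> A) :: real) - (\<Sum>x\<in>words bits (n + 1). of_bool (x \<in> A))\<bar> \<le>
     \<bar>\<Sum>y\<in>?W. ?s y * of_bool (y @ [True] \<in> A)\<bar> + \<bar>\<Sum>y\<in>?W. ?s y * of_bool (y @ [False] \<in> A)\<bar>"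
    by linarith
  moreover have "measure_pmf.prob (pmf_of_set (words bits n)) {x. gip_gen x \<in> A} -
      measure_pmf.prob (pmf_of_set (words bits (n + 1))) {y. y \<in> A} =
      (2 * (\<Sum>x\<in>?W. of_bool (gip_gen x \<in> A) :: real) - (\<Sum>x\<in>words bits (n + 1). of_bool (x \<in> A))) / (2 * 2 ^ n)"
    unfolding measure_words by (simp add: field_simps)
  ultimately show ?thesis by (simp add: divide_right_mono)
qed

lemma ex_eighth_root: "\<exists>w. w ^ 8 \<le> m \<and> m < (w + 1) ^ 8" for m :: nat
proof (induction m)
  case 0
  show ?case by (rule exI[of _ 0]) simp
next
  case (Suc m)
  then obtain w where w: "w ^ 8 \<le> m" "m < (w + 1) ^ 8" by blast
  show ?case
  proof (cases "Suc m < (w + 1) ^ 8")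
    case True
    then show ?thesis using w by (intro exI[of _ w]) simp
  next
    case False
    then have "Suc m = (w + 1) ^ 8" using w by simp
    moreover have "(w + 1) ^ 8 < (w + 1 + 1) ^ 8" by (rule power_strict_mono) auto
    ultimately show ?thesis by (intro exI[of _ "w + 1"]) simp
  qed
qed

lemma poly_le_power:
  fixes p :: "int poly"
  shows "\<exists>c k. \<forall>n. real_of_int (poly p (int n)) \<le> real c * (real n + 1) ^ k"
proof -
  have "real_of_int (poly p (int n)) \<le> real (nat (\<Sum>i\<le>degree p. \<bar>coeff p i\<bar>)) * (real n + 1) ^ degree p" for n
  proof -
    have "poly p (int n) \<le> (\<Sum>i\<le>degree p. \<bar>coeff p i\<bar> * (int n + 1) ^ degree p)"
      unfolding poly_altdef
    proof (rule sum_mono)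
      fix i assume "i \<in> {..degree p}"
      then have "int n ^ i \<le> (int n + 1) ^ degree p"
        by (intro order_trans[OF power_mono power_increasing]) auto
      then show "coeff p i * int n ^ i \<le> \<bar>coeff p i\<bar> * (int n + 1) ^ degree p"
        by (intro mult_mono) auto
    qed
    also have "\<dots> = (\<Sum>i\<le>degree p. \<bar>coeff p i\<bar>) * (int n + 1) ^ degree p" by (rule sum_distrib_right[symmetric])
    finally have "real_of_int (poly p (int n)) \<le> real_of_int ((\<Sum>i\<le>degree p. \<bar>coeff p i\<bar>) * (int n + 1) ^ degree p)"
      by linarith
    also have "\<dots> = real (nat (\<Sum>i\<le>degree p. \<bar>coeff p i\<bar>)) * (real n + 1) ^ degree p"
      by (simp add: sum_nonneg)
    finally show ?thesis .
  qed
  then show ?thesis by blast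
qed

text \<open>Since \<open>n + 1 \<le> 12 * (w + 1) ^ 8\<close>, a polynomial in \<open>n\<close> is
  bounded by one in \<open>w\<close>, and \<open>2 ^ w\<close> outgrows it.\<close>

lemma negligible_eighth_root:
  assumes "\<And>n. 0 \<le> \<mu> n"
    and "\<forall>\<^sub>F w in sequentially. \<forall>n. w ^ 8 \<le> n div 6 \<longrightarrow> n div 6 < (w + 1) ^ 8 \<longrightarrow> \<mu> n \<le> 7 / 2 ^ w"
  shows "negligible_fun \<mu>"
  unfolding negligible_fun_def
proof (intro conjI allI impI assms(1))
  fix p :: "int poly" assume pos: "\<forall>n. 0 < poly p (int n)"
  obtain c k where p: "\<And>n. real_of_int (poly p (int n)) \<le> real c * (real n + 1) ^ k"
    using poly_le_power by blast
  have "((\<lambda>w. 7 * real c * (12 * (real w + 1) ^ 8) powr real k / 2 ^ w) \<longlongrightarrow> 0) sequentially"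
    by real_asymp
  then have "\<forall>\<^sub>F w in sequentially. 7 * real c * (12 * (real w + 1) ^ 8) powr real k / 2 ^ w < 1"
    by (rule order_tendstoD) simp
  with assms(2) have "\<forall>\<^sub>F w in sequentially.
      (\<forall>n. w ^ 8 \<le> n div 6 \<longrightarrow> n div 6 < (w + 1) ^ 8 \<longrightarrow> \<mu> n \<le> 1 / real_of_int (poly p (int n)))"
  proof eventually_elim
    case (elim w)
    show ?case
    proof (intro allI impI)
      fix n assume n: "w ^ 8 \<le> n div 6" "n div 6 < (w + 1) ^ 8"
      then have "n + 1 \<le> 12 * (w + 1) ^ 8" by linarith
      then have "real (n + 1) \<le> real (12 * (w + 1) ^ 8)" by (rule of_nat_mono)
      then have "(real n + 1) ^ k \<le> (12 * (real w + 1) ^ 8) ^ k"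
        by (intro power_mono) (simp_all add: add.commute)
      then have "real c * (real n + 1) ^ k \<le> real c * (12 * (real w + 1) ^ 8) ^ k"
        by (intro mult_left_mono) auto
      with p[of n] have "7 * real_of_int (poly p (int n)) \<le> 7 * real c * (12 * (real w + 1) ^ 8) ^ k"
        by linarith
      also have "\<dots> \<le> 2 ^ w" using elim(2) by (simp add: powr_realpow)
      finally have "7 / 2 ^ w \<le> 1 / real_of_int (poly p (int n))"
        using pos by (simp add: field_simps)
      then show "\<mu> n \<le> 1 / real_of_int (poly p (int n))" using elim(1) n by fastforce
    qed
  qed
  then obtain W where W: "\<And>w n. W \<le> w \<Longrightarrow> w ^ 8 \<le> n div 6 \<Longrightarrow> n div 6 < (w + 1) ^ 8 \<Longrightarrow>
      \<mu> n \<le> 1 / real_of_int (poly p (int n))"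
    unfolding eventually_sequentially by blast
  show "\<exists>n0. \<forall>n\<ge>n0. \<mu> n \<le> 1 / real_of_int (poly p (int n))"
  proof (intro exI[of _ "6 * W ^ 8"] allI impI)
    fix n assume n: "6 * W ^ 8 \<le> n"
    obtain w where w: "w ^ 8 \<le> n div 6" "n div 6 < (w + 1) ^ 8" using ex_eighth_root by blast
    have "W ^ 8 < (w + 1) ^ 8" using n w(2) by linarith
    then have "W \<le> w" using power_less_imp_less_base[of W 8 "w + 1"] by simp
    then show "\<mu> n \<le> 1 / real_of_int (poly p (int n))" using W w by blast
  qed
qed

text \<open>For fixed \<open>e\<close>, \<open>f\<close>, \<open>r\<close> the inner sum is that of
  \<open>cfl_gip_correlation\<close>. The appended bit \<open>\<beta>\<close> is counted as part of
  the rest, which therefore has up to six letters there.\<close>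

lemma gip_gen_correlation:
  fixes K :: "('n, bool \<times> 'c) cfg"
  assumes "finite (productions K)" "length h = n + 1" "m = n div 6"
    and w: "w ^ 8 \<le> m" "m < (w + 1) ^ 8" "1 \<le> w"
    and rank: "gip_decay m * (1 + (real (approx_rank (card (items K) * (169 * 2 ^ 16)) w))\<^sup>2) \<le> 1 / 2 ^ w"
  shows "\<bar>\<Sum>y\<in>words bits n. sgb (last (gip_gen y)) * of_bool (zip (y @ [\<beta>]) h \<in> cfg_language K)\<bar>
    \<le> 2 ^ n * (7 / 2 ^ w)"
proof -
  let ?W = "words bits m"
  define l where "l = n mod 6"
  have nm: "n = 6 * m + l" "l < 6" unfolding assms(3) l_def by auto
  define T where "T e f r = (\<Sum>a\<in>?W. \<Sum>b\<in>?W. \<Sum>c\<in>?W. \<Sum>d\<in>?W.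
    gip m a b c d * of_bool (zip (gip_word e f (r @ [\<beta>]) a b c d) h \<in> cfg_language K))" for e f r
  have "(\<Sum>y\<in>words bits n. sgb (last (gip_gen y)) * of_bool (zip (y @ [\<beta>]) h \<in> cfg_language K)) =
      (\<Sum>e\<in>?W. \<Sum>f\<in>?W. \<Sum>r\<in>words bits l. T e f r)"
    unfolding sum_gip_word[OF nm(1)] T_def
  proof (intro sum.cong refl)
    fix e f r a b c d
    assume v: "e \<in> ?W" "f \<in> ?W" "r \<in> words bits l" "a \<in> ?W" "b \<in> ?W" "c \<in> ?W" "d \<in> ?W"
    have "gip_word e f r a b c d @ [\<beta>] = gip_word e f (r @ [\<beta>]) a b c d"
      by (simp add: gip_word_def)
    moreover have "sgb (last (gip_gen (gip_word e f r a b c d))) = gip m a b c d"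
      by (rule last_gip_gen_word) (use v nm(2) in \<open>auto simp: words_bits\<close>)
    ultimately show "sgb (last (gip_gen (gip_word e f r a b c d))) *
        of_bool (zip (gip_word e f r a b c d @ [\<beta>]) h \<in> cfg_language K) =
      gip m a b c d * of_bool (zip (gip_word e f (r @ [\<beta>]) a b c d) h \<in> cfg_language K)"
      by simp
  qed
  also have "\<bar>\<dots>\<bar> \<le> (\<Sum>e\<in>?W. \<Sum>f\<in>?W. \<Sum>r\<in>words bits l. (2 ^ m) ^ 4 * (7 / 2 ^ w))"
  proof (rule order_trans[OF sum_abs sum_mono], rule order_trans[OF sum_abs sum_mono],
      rule order_trans[OF sum_abs sum_mono])
    fix e f r assume v: "e \<in> ?W" "f \<in> ?W" "r \<in> words bits l"
    show "\<bar>T e f r\<bar> \<le> (2 ^ m) ^ 4 * (7 / 2 ^ w)"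
      unfolding T_def
    proof (rule cfl_gip_correlation[OF assms(1) _ _ _ _ w rank])
      show "length e = m" "length f = m" using v by (auto simp: words_bits)
      show "length h = 6 * m + length (r @ [\<beta>])" "length (r @ [\<beta>]) \<le> 6"
        using v nm assms(2) by (auto simp: words_bits)
    qed
  qed
  also have "\<dots> = 2 ^ n * (7 / 2 ^ w)"
  proof -
    have "(2 :: real) ^ n = (2 ^ m) ^ 6 * 2 ^ l"
      unfolding nm(1) by (simp add: power_add mult.commute flip: power_mult)
    moreover have "N ^ 6 = N * N * N ^ 4" for N :: real by (simp add: numeral_eq_Suc)
    ultimately show ?thesis by (simp add: mult_ac)
  qed
  finally show ?thesis .
qed

lemma gip_gen_fools:
  assumes "A \<in> CFL_advice bits"
  shows "fools bits (\<lambda>n. n + 1) gip_gen A"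
proof -
  obtain \<Gamma> :: "nat set" and h S where h: "length_preserving_advice \<Gamma> h" "S \<in> CFL (bits \<times> \<Gamma>)"
    "\<And>x. x \<in> A \<longleftrightarrow> zip x (h (length x)) \<in> S"
    using assms unfolding CFL_advice_def by auto
  obtain K :: "(nat, bool \<times> nat) cfg" where K: "S = cfg_language K" "finite (productions K)"
    using h(2) unfolding CFL_def wf_cfg_def by blast
  have C: "1 \<le> card (items K) * (169 * 2 ^ 16)"
    by (rule card_cuts(1)[OF K(2), of 1 0 1]) (simp_all del: One_nat_def)
  show ?thesis
    unfolding fools_def
  proof (rule negligible_eighth_root)
    show "\<forall>\<^sub>F w in sequentially. \<forall>n. w ^ 8 \<le> n div 6 \<longrightarrow> n div 6 < (w + 1) ^ 8 \<longrightarrow>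
      \<bar>measure_pmf.prob (pmf_of_set (words bits n)) {x. gip_gen x \<in> A} -
       measure_pmf.prob (pmf_of_set (words bits (n + 1))) {y. y \<in> A}\<bar> \<le> 7 / 2 ^ w"
      using approx_rank_decay[OF C] eventually_ge_at_top[of 1]
    proof eventually_elim
      case (elim w)
      show ?case
      proof (intro allI impI)
        fix n :: nat
        assume w: "w ^ 8 \<le> n div 6" "n div 6 < (w + 1) ^ 8"
        \<comment> \<open>The distinguisher reads words of length \<open>n + 1\<close>, so it works
          with the advice for that length.\<close>
        have lh: "length (h (n + 1)) = n + 1"
          using h(1) unfolding length_preserving_advice_def words_def by blast
        have "(\<Sum>y\<in>words bits n. sgb (last (gip_gen y)) * of_bool (y @ [\<beta>] \<in> A)) =
            (\<Sum>y\<in>words bits n. sgb (last (gip_gen y)) * of_bool (zip (y @ [\<beta>]) (h (n + 1)) \<in> cfg_language K))" for \<beta>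
          by (intro sum.cong refl) (simp add: h(3) K(1) words_bits)
        moreover have "\<bar>\<Sum>y\<in>words bits n. sgb (last (gip_gen y)) *
            of_bool (zip (y @ [\<beta>]) (h (n + 1)) \<in> cfg_language K)\<bar> \<le> 2 ^ n * (7 / 2 ^ w)" for \<beta>
          by (rule gip_gen_correlation[OF K(2) lh refl w elim(2)])
            (use elim(1) w(1) in \<open>unfold gip_decay_def, blast\<close>)
        ultimately have bound: "\<bar>\<Sum>y\<in>words bits n. sgb (last (gip_gen y)) * of_bool (y @ [\<beta>] \<in> A)\<bar>
            \<le> 2 ^ n * (7 / 2 ^ w)" for \<beta>
          by simp
        note distinguishing_advantage[of n A]
        also note divide_right_mono[OF add_mono[OF bound[of True] bound[of False]], of "2 * 2 ^ n"]
        also have "(2 ^ n * (7 / 2 ^ w) + 2 ^ n * (7 / 2 ^ w)) / (2 * 2 ^ n) = (7 / 2 ^ w :: real)" by simp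
        finally show "\<bar>measure_pmf.prob (pmf_of_set (words bits n)) {x. gip_gen x \<in> A} -
          measure_pmf.prob (pmf_of_set (words bits (n + 1))) {y. y \<in> A}\<bar> \<le> 7 / 2 ^ w" by simp
      qed
    qed
  qed simp
qed

lemma gip_gen_pseudorandom: "pseudorandom_against bits (\<lambda>n. n + 1) gip_gen (CFL_advice bits)"
  unfolding pseudorandom_against_def has_stretch_def using length_gip_gen gip_gen_fools by blast

lemma gip_gen_almost_one_to_one: "almost_one_to_one bits gip_gen"
proof -
  have "negligible_fun (\<lambda>_. 0)" by (auto simp: negligible_fun_def less_imp_le)
  moreover have "card (gip_gen ` words bits n) = card (words bits n)" for n
    using inj_gip_gen by (intro card_image) (auto intro: inj_on_subset)
  ultimately show ?thesis unfolding almost_one_to_one_def by (intro exI[of _ "\<lambda>_. 0"]) auto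
qed

section \<open>Pushdown automata for the generator\<close>

text \<open>The advice marks every position with its role, so a machine is just a table of actions,
  one for each mark. \<open>Guess\<close> writes an arbitrary bit and pushes its difference from the
  input bit, the mask that would explain the guess.\<close>

datatype pda_action = Copy | Push | Guess | Pop | Unload

text \<open>Stack symbols 0 and 1 are bits and 2 is the bottom; \<^const>\<open>Pop\<close> adds the product of
  the input bit and the popped bit to the state bit, and \<^const>\<open>Unload\<close> adds the state bit to the
  output and clears it.\<close>

primrec pda_move :: "pda_action \<Rightarrow> bool \<Rightarrow> bool \<Rightarrow> nat \<Rightarrow> bool \<Rightarrow> nat list \<Rightarrow> bool \<Rightarrow> bool" where
  "pda_move Copy v x Z v' \<gamma> y \<longleftrightarrow> v' = v \<and> \<gamma> = [Z] \<and> y = x"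
| "pda_move Push v x Z v' \<gamma> y \<longleftrightarrow> v' = v \<and> \<gamma> = [of_bool x, Z] \<and> y = x"
| "pda_move Guess v x Z v' \<gamma> y \<longleftrightarrow> v' = v \<and> \<gamma> = [of_bool (x \<noteq> y), Z]"
| "pda_move Pop v x Z v' \<gamma> y \<longleftrightarrow> Z < 2 \<and> v' = (v \<noteq> (Z = 1 \<and> x)) \<and> \<gamma> = [] \<and> y = x"
| "pda_move Unload v x Z v' \<gamma> y \<longleftrightarrow> v' = False \<and> \<gamma> = [Z] \<and> y = (x \<noteq> v)"

definition pda_state :: "bool \<Rightarrow> nat" where
  "pda_state v = (if v then 2 else 1)"

text \<open>State 0 starts and state 3 accepts; the states 1 and 2 store a bit. At the right
  endmarker one more bit is written, taken from \<open>fin v\<close>: this allows both a machine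
  that outputs its computed parity and one that guesses the last bit.\<close>

definition pda_transitions ::
  "(nat \<Rightarrow> pda_action) \<Rightarrow> (bool \<Rightarrow> bool set) \<Rightarrow>
   ((nat \<times> (bool \<times> nat) endmarked \<times> nat) \<times> (nat \<times> nat list \<times> bool \<times> bool option)) set" where
  "pda_transitions act fin =
    {((0, LEnd, 2), (pda_state False, [2], True, None))} \<union>
    {((pda_state v, Letter (x, \<kappa>), Z), (pda_state v', \<gamma>, True, Some y)) | v x \<kappa> Z v' \<gamma> y.
      \<kappa> < 7 \<and> Z < 3 \<and> pda_move (act \<kappa>) v x Z v' \<gamma> y} \<union>
    {((pda_state v, REnd, Z), (3, [Z], True, Some y)) | v Z y. Z < 3 \<and> y \<in> fin v}"

definition action_pda ::
  "(nat \<Rightarrow> pda_action) \<Rightarrow> (bool \<Rightarrow> bool set) \<Rightarrow> (nat, nat, bool \<times> nat, bool) npda" where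
  "action_pda act fin = \<lparr>states = {..3}, stack_symbols = {..2}, transitions = pda_transitions act fin,
    initial = 0, bottom = 2, accepting = {3}\<rparr>"

lemma action_pda_simps [simp]:
  "states (action_pda act fin) = {..3}" "stack_symbols (action_pda act fin) = {..2}"
  "transitions (action_pda act fin) = pda_transitions act fin" "initial (action_pda act fin) = 0"
  "bottom (action_pda act fin) = 2" "accepting (action_pda act fin) = {3}"
  by (simp_all add: action_pda_def)

lemma pda_move_stack:
  assumes "pda_move a v x Z v' \<gamma> y" "Z < 3"
  shows "set \<gamma> \<subseteq> {..2}" "length \<gamma> \<le> 2"
  using assms by (cases a; auto simp: of_bool_def)+

lemma wf_action_pda: "wf_npda (bits \<times> {..<7}) bits (action_pda act fin)"
proof -
  let ?S = "endmarked_symbols (bits \<times> {..<7 :: nat})"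
  have st: "pda_state v \<in> {..3} - {3}" for v by (simp add: pda_state_def)
  have "t \<in> (({..3} - {3}) \<times> ?S \<times> {..2}) \<times> ({..3} \<times> {\<gamma>. set \<gamma> \<subseteq> {..2} \<and> length \<gamma> \<le> 2} \<times> UNIV \<times> UNIV)"
    if "t \<in> pda_transitions act fin" for t
    using that unfolding pda_transitions_def
  proof (elim UnE CollectE exE conjE)
    fix v x \<kappa> Z v' \<gamma> y
    assume "t = ((pda_state v, Letter (x, \<kappa>), Z), pda_state v', \<gamma>, True, Some y)" "\<kappa> < 7" "Z < 3"
      "pda_move (act \<kappa>) v x Z v' \<gamma> y"
    then show ?thesis using st[of v] st[of v'] pda_move_stack[of "act \<kappa>" v x Z v' \<gamma> y]
      by (simp add: endmarked_symbols_def)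
  qed (use st in \<open>auto simp: endmarked_symbols_def\<close>)
  then have "pda_transitions act fin \<subseteq>
      (({..3} - {3}) \<times> ?S \<times> {..2}) \<times> ({..3} \<times> {\<gamma>. set \<gamma> \<subseteq> {..2} \<and> length \<gamma> \<le> 2} \<times> UNIV \<times> UNIV)"
    (is "_ \<subseteq> ?T") by blast
  moreover from this have "pda_transitions act fin \<subseteq>
      (({..3} - {3}) \<times> ?S \<times> {..2}) \<times> ({..3} \<times> lists {..2} \<times> UNIV \<times> insert None (Some ` bits))"
    by (rule order_trans) (auto simp: notin_range_Some)
  moreover have "finite ?T"
    by (intro finite_cartesian_product finite_lists_length_le) (auto simp: endmarked_symbols_def)
  ultimately show ?thesis
    unfolding wf_npda_def by (auto intro: finite_subset)
qed

text \<open>Every transition advances the input head, so no run has more steps than the endmarked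
  input has symbols.\<close>

lemma action_pda_step_length:
  assumes "npda_step (action_pda act fin) c c'"
  shows "length (fst (snd c)) = Suc (length (fst (snd c')))"
  using assms by cases (auto simp: pda_transitions_def)

lemma action_pda_linear_time: "npda_linear_time \<Sigma> (action_pda act fin)"
proof -
  have "length (fst (snd c')) + k = length (fst (snd c))"
    if "(npda_step (action_pda act fin) ^^ k) c c'" for k c c'
    using that
  proof (induction k arbitrary: c')
    case (Suc k)
    then obtain b where "(npda_step (action_pda act fin) ^^ k) c b" "npda_step (action_pda act fin) b c'"
      by auto
    with Suc.IH[of b] action_pda_step_length[of act fin b c'] show ?case by simp
  qed simp
  from this[of _ "npda_init (action_pda act fin) x" for x]
  have "k \<le> 2 * (length x + 1)" if "(npda_step (action_pda act fin) ^^ k) (npda_init (action_pda act fin) x) c" for k c x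
    using that by (fastforce simp: npda_init_def endmarked_word_def)
  then show ?thesis unfolding npda_linear_time_def by blast
qed

text \<open>The behaviour between the endmarkers as a relation. The intersection of the output sets
  has to be a singleton, so each block needs an equivalence covering all nondeterministic runs, not
  just the existence of a good one.\<close>

primrec pda_run ::
  "(nat \<Rightarrow> pda_action) \<Rightarrow> (bool \<times> nat) list \<Rightarrow> bool \<Rightarrow> nat list \<Rightarrow> bool list \<Rightarrow> bool \<Rightarrow> nat list \<Rightarrow> bool" where
  "pda_run act [] v s y v' s' \<longleftrightarrow> y = [] \<and> v' = v \<and> s' = s"
| "pda_run act (p # u) v s y v' s' \<longleftrightarrow> (\<exists>Z t v1 \<gamma> o' y'. s = Z # t \<and> y = o' # y' \<and> snd p < 7 \<and> Z < 3 \<and>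
     pda_move (act (snd p)) v (fst p) Z v1 \<gamma> o' \<and> pda_run act u v1 (\<gamma> @ t) y' v' s')"

lemma pda_run_append:
  "pda_run act (u @ w) v s y v' s' \<longleftrightarrow>
    (\<exists>y1 y2 v1 s1. y = y1 @ y2 \<and> pda_run act u v s y1 v1 s1 \<and> pda_run act w v1 s1 y2 v' s')"
proof (induction u arbitrary: v s y)
  case (Cons p u)
  show ?case (is "?L \<longleftrightarrow> ?R")
  proof
    assume ?L
    then obtain Z t v0 \<gamma> b y1 y2 v1 s1 where "s = Z # t" "y = (b # y1) @ y2" "snd p < 7" "Z < 3"
      "pda_move (act (snd p)) v (fst p) Z v0 \<gamma> b" "pda_run act u v0 (\<gamma> @ t) y1 v1 s1" "pda_run act w v1 s1 y2 v' s'"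
      unfolding append_Cons pda_run.simps Cons.IH by blast
    then show ?R unfolding pda_run.simps by blast
  next
    assume ?R
    then obtain Z t v0 \<gamma> b y1 y2 v1 s1 where "s = Z # t" "y = b # y1 @ y2" "snd p < 7" "Z < 3"
      "pda_move (act (snd p)) v (fst p) Z v0 \<gamma> b" "pda_run act u v0 (\<gamma> @ t) y1 v1 s1" "pda_run act w v1 s1 y2 v' s'"
      by auto
    then show ?L unfolding append_Cons pda_run.simps Cons.IH by blast
  qed
qed auto

lemma pda_run_appendI:
  "pda_run act u v s y1 v1 s1 \<Longrightarrow> pda_run act w v1 s1 y2 v' s' \<Longrightarrow> pda_run act (u @ w) v s (y1 @ y2) v' s'"
  unfolding pda_run_append by blast

lemma npda_step_nonempty:
  "npda_step M (q, a # w, Z # s, out) c \<longleftrightarrow> (\<exists>q' \<gamma> adv b. ((q, a, Z), (q', \<gamma>, adv, b)) \<in> transitions M \<and>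
    c = (q', (if adv then w else a # w), \<gamma> @ s, out @ written b))"
  unfolding npda_step.simps by auto

lemma npda_step_empty: "\<not> npda_step M (q, w, [], out) c"
  by (auto elim: npda_step.cases)

lemma pda_state_eq [simp]: "pda_state v = pda_state v' \<longleftrightarrow> v = v'" "pda_state v \<noteq> 3" "pda_state v \<noteq> 0"
    "3 \<noteq> pda_state v" "0 \<noteq> pda_state v"
  by (auto simp: pda_state_def)

lemma pda_transitions_iff:
  "((0, a, Z), r) \<in> pda_transitions act fin \<longleftrightarrow> a = LEnd \<and> Z = 2 \<and> r = (pda_state False, [2], True, None)"
  "((pda_state v, Letter p, Z), r) \<in> pda_transitions act fin \<longleftrightarrow> (\<exists>v' \<gamma> y. snd p < 7 \<and> Z < 3 \<and>
    pda_move (act (snd p)) v (fst p) Z v' \<gamma> y \<and> r = (pda_state v', \<gamma>, True, Some y))"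
  "((pda_state v, REnd, Z), r) \<in> pda_transitions act fin \<longleftrightarrow> (\<exists>y. Z < 3 \<and> y \<in> fin v \<and> r = (3, [Z], True, Some y))"
  "((3, a, Z), r) \<notin> pda_transitions act fin"
  by (cases p, auto simp: pda_transitions_def)+

lemma action_pda_step_letter:
  "npda_step (action_pda act fin) (pda_state v, Letter p # w, Z # t, out) c \<longleftrightarrow> (\<exists>v' \<gamma> y. snd p < 7 \<and> Z < 3 \<and>
    pda_move (act (snd p)) v (fst p) Z v' \<gamma> y \<and> c = (pda_state v', w, \<gamma> @ t, out @ [y]))" (is "?L \<longleftrightarrow> ?R")
proof
  assume ?R
  then obtain v' \<gamma> y where *: "snd p < 7" "Z < 3" "pda_move (act (snd p)) v (fst p) Z v' \<gamma> y"
    "c = (pda_state v', w, \<gamma> @ t, out @ [y])" by blast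
  then have "((pda_state v, Letter p, Z), (pda_state v', \<gamma>, True, Some y)) \<in> transitions (action_pda act fin)"
    by (simp add: pda_transitions_iff)
  from npda_step.intros[OF this, of w t out] show ?L by (simp add: * written_def)
qed (auto simp: npda_step_nonempty pda_transitions_iff written_def)

lemma action_pda_step_REnd:
  "npda_step (action_pda act fin) (pda_state v, REnd # w, Z # t, out) c \<longleftrightarrow>
    (\<exists>y. Z < 3 \<and> y \<in> fin v \<and> c = (3, w, Z # t, out @ [y]))" (is "?L \<longleftrightarrow> ?R")
proof
  assume ?R
  then obtain y where *: "Z < 3" "y \<in> fin v" "c = (3, w, Z # t, out @ [y])" by blast
  then have "((pda_state v, REnd, Z), (3, [Z], True, Some y)) \<in> transitions (action_pda act fin)"
    by (simp add: pda_transitions_iff)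
  from npda_step.intros[OF this, of w t out] show ?L by (simp add: * written_def)
qed (auto simp: npda_step_nonempty pda_transitions_iff written_def)

lemma action_pda_step_LEnd:
  "npda_step (action_pda act fin) (0, LEnd # w, Z # t, out) c \<longleftrightarrow> Z = 2 \<and> c = (pda_state False, w, Z # t, out)"
  by (auto simp: npda_step_nonempty pda_transitions_iff written_def)

lemmas action_pda_steps = action_pda_step_letter action_pda_step_REnd action_pda_step_LEnd

lemma npda_step_accepting: "\<not> npda_step (action_pda act fin) (3, c) c'"
  by (auto elim!: npda_step.cases simp: pda_transitions_iff)

lemma accepts_step:
  assumes "q \<noteq> 3"
  shows "(\<exists>w' s'. (npda_step (action_pda act fin))\<^sup>*\<^sup>* (q, c) (3, w', s', y)) \<longleftrightarrow>
    (\<exists>c1. npda_step (action_pda act fin) (q, c) c1 \<and>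
      (\<exists>w' s'. (npda_step (action_pda act fin))\<^sup>*\<^sup>* c1 (3, w', s', y)))"
  using assms by (blast elim: converse_rtranclpE intro: converse_rtranclp_into_rtranclp)

lemma accepts_from_bit_state:
  "(\<exists>w' s'. (npda_step (action_pda act fin))\<^sup>*\<^sup>* (pda_state v, map Letter u @ [REnd], s, out) (3, w', s', out')) \<longleftrightarrow>
   (\<exists>y v' s' b. pda_run act u v s y v' s' \<and> s' \<noteq> [] \<and> hd s' < 3 \<and> b \<in> fin v' \<and> out' = out @ y @ [b])"
proof (induction u arbitrary: v s out)
  case Nil
  have halted: "(npda_step (action_pda act fin))\<^sup>*\<^sup>* (3, c) (3, c') \<longleftrightarrow> c = c'" for c c'
    by (meson converse_rtranclpE npda_step_accepting rtranclp.rtrancl_refl prod.inject)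
  show ?case
  proof (cases s)
    case (Cons Z t)
    have "(\<exists>w' s'. (npda_step (action_pda act fin))\<^sup>*\<^sup>* (pda_state v, map Letter [] @ [REnd], s, out) (3, w', s', out')) \<longleftrightarrow>
      (\<exists>y. Z < 3 \<and> y \<in> fin v \<and>
        (\<exists>w' s'. (npda_step (action_pda act fin))\<^sup>*\<^sup>* (3, [], Z # t, out @ [y]) (3, w', s', out')))"
      unfolding accepts_step[OF pda_state_eq(2)] list.map append_Nil Cons action_pda_steps by blast
    then show ?thesis by (auto simp: halted Cons)
  qed (auto simp: accepts_step npda_step_empty)
next
  case (Cons p u)
  show ?case
  proof (cases s)
    case s: (Cons Z t)
    have "(\<exists>w' s'. (npda_step (action_pda act fin))\<^sup>*\<^sup>* (pda_state v, map Letter (p # u) @ [REnd], s, out) (3, w', s', out')) \<longleftrightarrow>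
      (\<exists>v1 \<gamma> o'. snd p < 7 \<and> Z < 3 \<and> pda_move (act (snd p)) v (fst p) Z v1 \<gamma> o' \<and>
        (\<exists>w' s'. (npda_step (action_pda act fin))\<^sup>*\<^sup>* (pda_state v1, map Letter u @ [REnd], \<gamma> @ t, out @ [o']) (3, w', s', out')))"
      unfolding list.map append_Cons s
      by (subst accepts_step[OF pda_state_eq(2)], unfold action_pda_steps, blast)
    then show ?thesis unfolding Cons.IH s pda_run.simps by fastforce
  qed (auto simp: accepts_step npda_step_empty)
qed

lemma npda_outputs_action_pda:
  "npda_outputs (action_pda act fin) u =
    {y @ [b] | y v s b. pda_run act u False [2] y v s \<and> s \<noteq> [] \<and> hd s < 3 \<and> b \<in> fin v}"
proof -
  have "y \<in> npda_outputs (action_pda act fin) u \<longleftrightarrow> (\<exists>w' s'. (npda_step (action_pda act fin))\<^sup>*\<^sup>*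
      (pda_state False, map Letter u @ [REnd], [2], []) (3, w', s', y))" for y
    unfolding npda_outputs_def npda_init_def endmarked_word_def
    by (auto simp: accepts_step action_pda_steps)
  then show ?thesis unfolding accepts_from_bit_state append_Nil by blast
qed

definition pda_stack :: "bool list \<Rightarrow> nat list" where
  "pda_stack s = map of_bool s @ [2]"

lemma pda_stack_simps [simp]:
  "pda_stack [] = [2]" "pda_stack (b # s) = of_bool b # pda_stack s" "pda_stack s \<noteq> []" "hd (pda_stack s) < 3"
  by (cases s; simp add: pda_stack_def)+

lemma npda_outputs_family:
  assumes "\<And>y v s. pda_run act u False [2] y v s \<longleftrightarrow> (\<exists>z. P z \<and> y = Y z \<and> v = V z \<and> s = pda_stack [])"
  shows "npda_outputs (action_pda act fin) u = {Y z @ [b] | z b. P z \<and> b \<in> fin (V z)}"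
  unfolding npda_outputs_action_pda assms using pda_stack_simps(3,4)[of "[]"] by blast

definition tagged :: "nat \<Rightarrow> bool list \<Rightarrow> (bool \<times> nat) list" where
  "tagged \<kappa> xs = zip xs (replicate (length xs) \<kappa>)"

definition tagged_pairs :: "nat \<Rightarrow> nat \<Rightarrow> (bool \<times> bool) list \<Rightarrow> (bool \<times> nat) list" where
  "tagged_pairs \<kappa> \<kappa>' ps = zip (flat ps) (flat (replicate (length ps) (\<kappa>, \<kappa>')))"

lemma tagged_simps [simp]:
  "tagged \<kappa> [] = []" "tagged \<kappa> (x # xs) = (x, \<kappa>) # tagged \<kappa> xs"
  "tagged_pairs \<kappa> \<kappa>' [] = []"
  "tagged_pairs \<kappa> \<kappa>' (p # ps) = (fst p, \<kappa>) # (snd p, \<kappa>') # tagged_pairs \<kappa> \<kappa>' ps"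
  by (simp_all add: tagged_def tagged_pairs_def)

lemma pda_stack_Cons: "pda_stack s = Z # t \<Longrightarrow> Z < 3"
  by (metis list.sel(1) pda_stack_simps(4))

lemma pda_run_copy:
  assumes "act \<kappa> = Copy" "\<kappa> < 7"
  shows "pda_run act (tagged \<kappa> xs) v (pda_stack s) y v' s' \<longleftrightarrow> y = xs \<and> v' = v \<and> s' = pda_stack s"
proof (induction xs arbitrary: y)
  case (Cons x xs)
  obtain Z t where "pda_stack s = Z # t" "Z < 3"
    using pda_stack_Cons by (metis list.exhaust pda_stack_simps(3))
  then show ?case using Cons assms by auto
qed auto

lemma pda_run_push:
  assumes "act \<kappa> = Push" "\<kappa> < 7"
  shows "pda_run act (tagged \<kappa> xs) v (pda_stack s) y v' s' \<longleftrightarrow> y = xs \<and> v' = v \<and> s' = pda_stack (rev xs @ s)"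
proof (induction xs arbitrary: y s)
  case (Cons x xs)
  obtain Z t where "pda_stack s = Z # t" "Z < 3"
    using pda_stack_Cons by (metis list.exhaust pda_stack_simps(3))
  then show ?case using Cons.IH[of "x # s"] assms by auto
qed auto

lemma pda_run_pop:
  assumes "act \<kappa> = Pop" "\<kappa> < 7" "length s = length xs"
  shows "pda_run act (tagged \<kappa> xs) v (pda_stack (s @ s0)) y v' s' \<longleftrightarrow>
    y = xs \<and> v' = (v \<noteq> parity (map2 (\<and>) s xs)) \<and> s' = pda_stack s0"
  using assms(3)
proof (induction xs arbitrary: y s v)
  case (Cons x xs)
  then obtain b t where s: "s = b # t" "length t = length xs" by (cases s) auto
  show ?case using Cons.IH[OF s(2)] assms(1,2) by (auto simp: s)
qed auto

text \<open>The state bit transports the product from the first component of a pair to the second,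
  where it is added and cleared. The stack is listed from the top, hence
  \<open>rev s\<close>.\<close>

lemma pda_run_unload:
  assumes "act \<kappa> = Pop" "\<kappa> < 7" "act \<kappa>' = Unload" "\<kappa>' < 7" "length s = length ps"
  shows "pda_run act (tagged_pairs \<kappa> \<kappa>' ps) False (pda_stack (s @ s0)) y v' s' \<longleftrightarrow>
    y = flat (mask (rev s) ps) \<and> v' = False \<and> s' = pda_stack s0"
  using assms(5)
proof (induction ps arbitrary: y s)
  case (Cons p ps)
  then obtain b t where s: "s = b # t" "length t = length ps" by (cases s) auto
  obtain Z t0 where Z: "pda_stack (t @ s0) = Z # t0" "Z < 3"
    using pda_stack_Cons by (metis list.exhaust pda_stack_simps(3))
  have "pda_run act (tagged_pairs \<kappa> \<kappa>' (p # ps)) False (pda_stack (s @ s0)) y v' s' \<longleftrightarrow>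
    (\<exists>y'. y = fst p # (snd p \<noteq> (b \<and> fst p)) # y' \<and>
      pda_run act (tagged_pairs \<kappa> \<kappa>' ps) False (pda_stack (t @ s0)) y' v' s')"
    using assms(1-4) Z by (simp add: s) auto
  then show ?case unfolding Cons.IH[OF s(2)] by (auto simp: s mask_def carry_def)
qed (auto simp: mask_def)

text \<open>The guessed word \<open>z\<close> replaces the second components; the stack receives the
  carries that would have produced it.\<close>

lemma pda_run_guess:
  assumes "act \<kappa> = Copy" "\<kappa> < 7" "act \<kappa>' = Guess" "\<kappa>' < 7"
  shows "pda_run act (tagged_pairs \<kappa> \<kappa>' ps) v (pda_stack s) y v' s' \<longleftrightarrow>
    (\<exists>z. length z = length ps \<and> y = flat (zip (map fst ps) z) \<and> v' = v \<and>
      s' = pda_stack (rev (map2 (\<noteq>) (map snd ps) z) @ s))"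
proof (induction ps arbitrary: y s)
  case (Cons p ps)
  obtain Z t0 where Z: "pda_stack s = Z # t0" "Z < 3"
    using pda_stack_Cons by (metis list.exhaust pda_stack_simps(3))
  have "pda_run act (tagged_pairs \<kappa> \<kappa>' (p # ps)) v (pda_stack s) y v' s' \<longleftrightarrow>
    (\<exists>b y'. y = fst p # b # y' \<and> pda_run act (tagged_pairs \<kappa> \<kappa>' ps) v (pda_stack ((snd p \<noteq> b) # s)) y' v' s')"
    using assms Z by auto
  also have "\<dots> \<longleftrightarrow> (\<exists>b z. length z = length ps \<and> y = fst p # b # flat (zip (map fst ps) z) \<and> v' = v \<and>
      s' = pda_stack (rev (map2 (\<noteq>) (map snd ps) z) @ (snd p \<noteq> b) # s))"
    unfolding Cons.IH by blast
  also have "\<dots> \<longleftrightarrow> (\<exists>z. length z = length (p # ps) \<and> y = flat (zip (map fst (p # ps)) z) \<and> v' = v \<and>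
      s' = pda_stack (rev (map2 (\<noteq>) (map snd (p # ps)) z) @ s))" (is "?L \<longleftrightarrow> ?R")
  proof
    assume ?L
    then obtain b z where "length z = length ps \<and> y = fst p # b # flat (zip (map fst ps) z) \<and> v' = v \<and>
      s' = pda_stack (rev (map2 (\<noteq>) (map snd ps) z) @ (snd p \<noteq> b) # s)" by blast
    then show ?R by (intro exI[of _ "b # z"]) simp
  next
    assume ?R
    then show ?L by (auto simp: length_Suc_conv)
  qed
  finally show ?case .
qed auto

section \<open>The two machines and the intersection of their outputs\<close>

text \<open>Indexed by the marks of \<open>block_advice\<close>: 0 and 5 for the outer blocks, 1 and
  2 for the pairs of the second block, 3 and 4 for those of the third, 6 for the rest.\<close>

definition act1 :: "nat \<Rightarrow> pda_action" where
  "act1 \<kappa> = [Push, Pop, Unload, Copy, Guess, Pop, Copy] ! \<kappa>"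

definition act2 :: "nat \<Rightarrow> pda_action" where
  "act2 \<kappa> = [Copy, Copy, Guess, Pop, Unload, Copy, Copy] ! \<kappa>"

definition block_advice :: "nat \<Rightarrow> nat list" where
  "block_advice n = (let m = n div 6 in replicate m 0 @ flat (replicate m (1, 2)) @
    flat (replicate m (3, 4)) @ replicate m 5 @ replicate (n - 6 * m) 6)"

lemma block_advice: "length_preserving_advice {..<7} block_advice"
  unfolding length_preserving_advice_def
proof
  fix n
  have "set (flat (replicate k (p, q))) \<subseteq> {p, q}" for k p q :: nat
    by (induction k) auto
  from this[of _ 1 2] this[of _ 3 4] show "block_advice n \<in> words {..<7} n"
    by (fastforce simp: block_advice_def Let_def words_def dest!: in_set_replicate[THEN iffD1])
qed

lemma zip_block_advice:
  assumes "x = a @ flat ps @ flat qs @ d @ r" "length a = m" "length ps = m" "length qs = m"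
    "length d = m" "length r < 6"
  shows "zip x (block_advice (length x)) =
    tagged 0 a @ tagged_pairs 1 2 ps @ tagged_pairs 3 4 qs @ tagged 5 d @ tagged 6 r"
proof -
  have "length x div 6 = m" "length x - 6 * m = length r" using assms by simp_all
  then show ?thesis
    unfolding block_advice_def Let_def assms(1) tagged_def tagged_pairs_def using assms by simp
qed

lemma outputs_act1:
  assumes "length a = m" "length ps = m" "length qs = m" "length d = m"
  shows "npda_outputs (action_pda act1 (\<lambda>v. {v}))
      (tagged 0 a @ tagged_pairs 1 2 ps @ tagged_pairs 3 4 qs @ tagged 5 d @ tagged 6 r) =
    {a @ flat (mask a ps) @ flat (zip (map fst qs) z) @ d @ r @
      [parity (map2 (\<and>) (rev (map2 (\<noteq>) (map snd qs) z)) d)] | z. length z = m}"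
proof -
  let ?v = "\<lambda>z. map2 (\<noteq>) (map snd qs) z"
  let ?u = "tagged 0 a @ tagged_pairs 1 2 ps @ tagged_pairs 3 4 qs @ tagged 5 d @ tagged 6 r"
  have push: "pda_run act1 (tagged 0 a) v [2] y v' s' \<longleftrightarrow> y = a \<and> v' = v \<and> s' = pda_stack (rev a @ [])" for v y v' s'
    using pda_run_push[of act1 0 a v "[]"] by (simp add: act1_def)
  have unload: "pda_run act1 (tagged_pairs 1 2 ps) False (pda_stack (rev a @ [])) y v' s' \<longleftrightarrow>
      y = flat (mask a ps) \<and> v' = False \<and> s' = pda_stack []" for y v' s'
    using pda_run_unload[of act1 1 2 "rev a" ps "[]" y v' s'] assms by (simp add: act1_def)
  have guess: "pda_run act1 (tagged_pairs 3 4 qs) v (pda_stack []) y v' s' \<longleftrightarrow> (\<exists>z. length z = m \<and>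
      y = flat (zip (map fst qs) z) \<and> v' = v \<and> s' = pda_stack (rev (?v z) @ []))" for v y v' s'
    using pda_run_guess[of act1 3 4 qs v "[]" y v' s'] assms by (simp add: act1_def)
  have pop: "pda_run act1 (tagged 5 d) v (pda_stack (s @ [])) y v' s' \<longleftrightarrow>
      y = d \<and> v' = (v \<noteq> parity (map2 (\<and>) s d)) \<and> s' = pda_stack []" if "length s = m" for v s y v' s'
    using pda_run_pop[of act1 5 s d v "[]" y v' s'] assms that by (simp add: act1_def)
  have copy: "pda_run act1 (tagged 6 r) v (pda_stack []) y v' s' \<longleftrightarrow> y = r \<and> v' = v \<and> s' = pda_stack []" for v y v' s'
    using pda_run_copy[of act1 6 r v "[]"] by (simp add: act1_def)
  have run: "pda_run act1 ?u False [2] y v' s' \<longleftrightarrow>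
    (\<exists>z. length z = m \<and> y = a @ flat (mask a ps) @ flat (zip (map fst qs) z) @ d @ r \<and>
      v' = parity (map2 (\<and>) (rev (?v z)) d) \<and> s' = pda_stack [])" (is "?L \<longleftrightarrow> ?R") for y v' s'
  proof
    assume ?L
    then obtain y1 y2 y3 y4 y5 v1 s1 v2 s2 v3 s3 v4 s4 where y: "y = y1 @ y2 @ y3 @ y4 @ y5"
      and 1: "pda_run act1 (tagged 0 a) False [2] y1 v1 s1" and 2: "pda_run act1 (tagged_pairs 1 2 ps) v1 s1 y2 v2 s2"
      and 3: "pda_run act1 (tagged_pairs 3 4 qs) v2 s2 y3 v3 s3" and 4: "pda_run act1 (tagged 5 d) v3 s3 y4 v4 s4"
      and 5: "pda_run act1 (tagged 6 r) v4 s4 y5 v' s'"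
      unfolding pda_run_append by blast
    from 1 have 1: "y1 = a" "v1 = False" "s1 = pda_stack (rev a @ [])" unfolding push by auto
    from 2 have 2: "y2 = flat (mask a ps)" "v2 = False" "s2 = pda_stack []" unfolding 1 unload by auto
    from 3 obtain z where z: "length z = m" "y3 = flat (zip (map fst qs) z)" "v3 = False"
      "s3 = pda_stack (rev (?v z) @ [])" unfolding 2 guess by auto
    have "length (rev (?v z)) = m" using z(1) assms by simp
    from 4[unfolded z(3,4) pop[OF this]] have 4: "y4 = d" "v4 = parity (map2 (\<and>) (rev (?v z)) d)"
      "s4 = pda_stack []" by auto
    from 5 show ?R unfolding 4 copy using y z(1,2) 1(1) 2(1) 4(1) by blast
  next
    assume ?R
    then obtain z where z: "length z = m" "y = a @ flat (mask a ps) @ flat (zip (map fst qs) z) @ d @ r"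
      "v' = (False \<noteq> parity (map2 (\<and>) (rev (?v z)) d))" "s' = pda_stack []" by auto
    have "length (rev (?v z)) = m" using z(1) assms by simp
    note pop = pop[OF this]
    show ?L unfolding z(2-4)
      by (rule pda_run_appendI[OF push[THEN iffD2] pda_run_appendI[OF unload[THEN iffD2]
            pda_run_appendI[OF guess[THEN iffD2] pda_run_appendI[OF pop[THEN iffD2] copy[THEN iffD2]]]]];
          use z(1) in blast)
  qed
  show ?thesis unfolding npda_outputs_family[OF run] by simp
qed

lemma outputs_act2:
  assumes "length a = m" "length ps = m" "length qs = m" "length d = m"
  shows "npda_outputs (action_pda act2 (\<lambda>_. UNIV))
      (tagged 0 a @ tagged_pairs 1 2 ps @ tagged_pairs 3 4 qs @ tagged 5 d @ tagged 6 r) =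
    {a @ flat (zip (map fst ps) z) @ flat (mask (map2 (\<noteq>) (map snd ps) z) qs) @ d @ r @ [b] | z b. length z = m}"
proof -
  let ?v = "\<lambda>z. map2 (\<noteq>) (map snd ps) z"
  let ?u = "tagged 0 a @ tagged_pairs 1 2 ps @ tagged_pairs 3 4 qs @ tagged 5 d @ tagged 6 r"
  have copy0: "pda_run act2 (tagged 0 a) v [2] y v' s' \<longleftrightarrow> y = a \<and> v' = v \<and> s' = pda_stack []" for v y v' s'
    using pda_run_copy[of act2 0 a v "[]"] by (simp add: act2_def)
  have guess: "pda_run act2 (tagged_pairs 1 2 ps) v (pda_stack []) y v' s' \<longleftrightarrow> (\<exists>z. length z = m \<and>
      y = flat (zip (map fst ps) z) \<and> v' = v \<and> s' = pda_stack (rev (?v z) @ []))" for v y v' s'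
    using pda_run_guess[of act2 1 2 ps v "[]" y v' s'] assms by (simp add: act2_def)
  have unload: "pda_run act2 (tagged_pairs 3 4 qs) False (pda_stack (rev s @ [])) y v' s' \<longleftrightarrow>
      y = flat (mask s qs) \<and> v' = False \<and> s' = pda_stack []" if "length s = m" for s y v' s'
    using pda_run_unload[of act2 3 4 "rev s" qs "[]" y v' s'] assms that by (simp add: act2_def)
  have copy5: "pda_run act2 (tagged 5 d) v (pda_stack []) y v' s' \<longleftrightarrow> y = d \<and> v' = v \<and> s' = pda_stack []" for v y v' s'
    using pda_run_copy[of act2 5 d v "[]"] by (simp add: act2_def)
  have copy: "pda_run act2 (tagged 6 r) v (pda_stack []) y v' s' \<longleftrightarrow> y = r \<and> v' = v \<and> s' = pda_stack []" for v y v' s'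
    using pda_run_copy[of act2 6 r v "[]"] by (simp add: act2_def)
  have run: "pda_run act2 ?u False [2] y v' s' \<longleftrightarrow>
    (\<exists>z. length z = m \<and> y = a @ flat (zip (map fst ps) z) @ flat (mask (?v z) qs) @ d @ r \<and>
      v' = False \<and> s' = pda_stack [])" (is "?L \<longleftrightarrow> ?R") for y v' s'
  proof
    assume ?L
    then obtain y1 y2 y3 y4 y5 v1 s1 v2 s2 v3 s3 v4 s4 where y: "y = y1 @ y2 @ y3 @ y4 @ y5"
      and 1: "pda_run act2 (tagged 0 a) False [2] y1 v1 s1" and 2: "pda_run act2 (tagged_pairs 1 2 ps) v1 s1 y2 v2 s2"
      and 3: "pda_run act2 (tagged_pairs 3 4 qs) v2 s2 y3 v3 s3" and 4: "pda_run act2 (tagged 5 d) v3 s3 y4 v4 s4"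
      and 5: "pda_run act2 (tagged 6 r) v4 s4 y5 v' s'"
      unfolding pda_run_append by blast
    from 1 have 1: "y1 = a" "v1 = False" "s1 = pda_stack []" unfolding copy0 by auto
    from 2 obtain z where z: "length z = m" "y2 = flat (zip (map fst ps) z)" "v2 = False"
      "s2 = pda_stack (rev (?v z) @ [])" unfolding 1 guess by auto
    have "length (?v z) = m" using z(1) assms by simp
    from 3[unfolded z(3,4) unload[OF this]] have 3: "y3 = flat (mask (?v z) qs)" "v3 = False"
      "s3 = pda_stack []" by auto
    from 4 have 4: "y4 = d" "v4 = False" "s4 = pda_stack []" unfolding 3 copy5 by auto
    from 5 show ?R unfolding 4 copy using y z(1,2) 1(1) 3(1) 4(1) by blast
  next
    assume ?R
    then obtain z where z: "length z = m" "y = a @ flat (zip (map fst ps) z) @ flat (mask (?v z) qs) @ d @ r"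
      "v' = False" "s' = pda_stack []" by auto
    have "length (?v z) = m" using z(1) assms by simp
    note unload = unload[OF this]
    show ?L unfolding z(2-4)
      by (rule pda_run_appendI[OF copy0[THEN iffD2] pda_run_appendI[OF guess[THEN iffD2]
            pda_run_appendI[OF unload[THEN iffD2] pda_run_appendI[OF copy5[THEN iffD2] copy[THEN iffD2]]]]];
          use z(1) in blast)
  qed
  show ?thesis unfolding npda_outputs_family[OF run] by simp
qed

text \<open>What \<open>Guess\<close> pushes if it guesses correctly: the true carries.\<close>

lemma flip_masked: "length s = length ps \<Longrightarrow> map2 (\<noteq>) (map snd ps) (map snd (mask s ps)) = carry s ps"
  by (auto simp: mask_def list_eq_iff_nth_eq)

text \<open>The first machine computes the second block correctly, so a common output forces the
  guess \<open>z'\<close> of the second machine to be the true one. Its stack then holds the true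
  carries, hence its third block is correct and forces the guess \<open>z\<close> of the first
  machine, whose final parity is then the inner bit.\<close>

lemma outputs_intersection:
  assumes "length a = m" "length ps = m" "length qs = m" "length d = m" "length r < 6"
  defines "u \<equiv> tagged 0 a @ tagged_pairs 1 2 ps @ tagged_pairs 3 4 qs @ tagged 5 d @ tagged 6 r"
  shows "npda_outputs (action_pda act1 (\<lambda>v. {v})) u \<inter> npda_outputs (action_pda act2 (\<lambda>_. UNIV)) u =
    {gip_gen (a @ flat ps @ flat qs @ d @ r)}"
proof -
  let ?o1 = "\<lambda>z. a @ flat (mask a ps) @ flat (zip (map fst qs) z) @ d @ r @
      [parity (map2 (\<and>) (rev (map2 (\<noteq>) (map snd qs) z)) d)]"
  let ?o2 = "\<lambda>z b. a @ flat (zip (map fst ps) z) @ flat (mask (map2 (\<noteq>) (map snd ps) z) qs) @ d @ r @ [b]"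
  let ?z = "map snd (mask (carry a ps) qs)"
  have zip_mask: "zip (map fst xs) (map snd (mask s xs)) = mask s xs" if "length s = length xs" for s xs
    using that by (metis map_fst_mask zip_map_fst_snd)
  have f1: "map2 (\<noteq>) (map snd ps) (map snd (mask a ps)) = carry a ps"
    by (rule flip_masked) (simp add: assms(1,2))
  have f2: "map2 (\<noteq>) (map snd qs) ?z = carry (carry a ps) qs"
    by (rule flip_masked) (simp add: assms(1-3))
  have gen: "gip_gen (a @ flat ps @ flat qs @ d @ r) = ?o1 ?z"
    unfolding f2 using assms(1-5) by (simp add: gip_gen_blocks masked_word_def inner_bit_def zip_mask)
  have mem: "?o1 ?z = ?o2 (map snd (mask a ps)) (last (?o1 ?z))"
    unfolding f1 using assms(1-5) by (simp add: zip_mask)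
  have uniq: "?o1 z = ?o1 ?z" if "length z = m" "length z' = m" "?o1 z = ?o2 z' b" for z z' b
  proof -
    have "flat (mask a ps) = flat (zip (map fst ps) z')"
      "flat (zip (map fst qs) z) = flat (mask (map2 (\<noteq>) (map snd ps) z') qs)"
      using that(3) that(1,2) assms(1-4) by simp_all
    then have 1: "mask a ps = zip (map fst ps) z'"
      and 2: "zip (map fst qs) z = mask (map2 (\<noteq>) (map snd ps) z') qs"
      by (metis unflat_flat)+
    have "z' = map snd (mask a ps)" unfolding 1 using that assms by simp
    then have "zip (map fst qs) z = mask (carry a ps) qs" using 2 f1 by simp
    then have "map snd (zip (map fst qs) z) = ?z" by simp
    then have "z = ?z" using that assms by simp
    then show ?thesis by simp
  qed
  have "?o1 ?z \<in> {?o1 z |z. length z = m}" using assms(1-3) by (intro CollectI exI[of _ ?z]) simp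
  moreover have "?o1 ?z \<in> {?o2 z b |z b. length z = m}"
    by (subst mem, intro CollectI exI conjI, rule refl) (simp add: assms(1,2))
  moreover have "y = ?o1 ?z" if "y \<in> {?o1 z |z. length z = m}" "y \<in> {?o2 z b |z b. length z = m}" for y
    using that uniq by blast
  ultimately have "{?o1 z |z. length z = m} \<inter> {?o2 z b |z b. length z = m} = {?o1 ?z}" by blast
  then show ?thesis unfolding gen u_def outputs_act1[OF assms(1-4)] outputs_act2[OF assms(1-4)] .
qed

lemma gip_gen_CFLMV2_advice: "(\<lambda>x. {gip_gen x}) \<in> CFLMV2_advice bits bits"
proof -
  let ?g1 = "npda_outputs (action_pda act1 (\<lambda>v. {v}))"
  let ?g2 = "npda_outputs (action_pda act2 (\<lambda>_. UNIV))"
  have "npda_outputs (action_pda act fin) \<in> CFLMV (bits \<times> {..<7}) bits" for act fin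
    unfolding CFLMV_def
    by (intro CollectI exI[of _ "action_pda act fin"] conjI wf_action_pda action_pda_linear_time ballI refl)
  then have mem: "(\<lambda>x. ?g1 x \<inter> ?g2 x) \<in> CFLMV2 (bits \<times> {..<7}) bits"
    unfolding CFLMV2_def by blast
  have eq: "{gip_gen x} = ?g1 (zip x (block_advice (length x))) \<inter> ?g2 (zip x (block_advice (length x)))" for x
  proof (rule blocks_cases[of x])
    fix a ps qs d r m
    assume x: "x = a @ flat ps @ flat qs @ d @ r"
      and l: "length a = m" "length ps = m" "length qs = m" "length d = m" "length r < 6"
    show ?thesis
      unfolding zip_block_advice[OF x l] outputs_intersection[OF l] by (simp only: x)
  qed
  have "alphabet {..<7 :: nat}" by (simp add: alphabet_def lessThan_empty_iff)
  then show ?thesis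
    unfolding CFLMV2_advice_def
    by (intro CollectI exI[of _ "{..<7}"] exI[of _ block_advice] bexI[OF _ mem] conjI ballI eq block_advice)
qed

section \<open>Counter machines in logarithmic space\<close>

datatype counter_op = Inc | Dec | Keep

instance counter_op :: finite
proof
  have "(UNIV :: counter_op set) = {Inc, Dec, Keep}" by (auto intro: counter_op.exhaust)
  then show "finite (UNIV :: counter_op set)" by (metis finite.emptyI finite_insert)
qed

primrec apply_op :: "counter_op \<Rightarrow> nat \<Rightarrow> nat" where
  "apply_op Inc n = Suc n"
| "apply_op Dec n = n - 1"
| "apply_op Keep n = n"

record ('q, 'k, 'a, 'b) counter_machine =
  cm_initial :: 'q
  cm_halting :: "'q set"
  cm_delta :: "'q \<Rightarrow> 'a endmarked \<Rightarrow> ('k \<Rightarrow> bool) \<Rightarrow> 'q \<times> dir \<times> ('k \<Rightarrow> counter_op) \<times> 'b option"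

type_synonym ('q, 'k, 'b) cm_config = "'q \<times> nat \<times> ('k \<Rightarrow> nat) \<times> 'b list"

text \<open>A step that decrements zero or lifts a counter above \<open>length x + 1\<close> does
  not exist. A halting run is thus also evidence that all counters stay small, which is what the
  simulation in logarithmic space needs.\<close>

inductive cm_step ::
  "('q, 'k, 'a, 'b) counter_machine \<Rightarrow> 'a list \<Rightarrow> ('q, 'k, 'b) cm_config \<Rightarrow> ('q, 'k, 'b) cm_config \<Rightarrow> bool"
  for N x where
  "q \<notin> cm_halting N \<Longrightarrow> cm_delta N q (endmarked_word x ! i) (\<lambda>k. c k = 0) = (q', d, ops, b) \<Longrightarrow>
   (\<And>k. ops k = Dec \<Longrightarrow> c k \<noteq> 0) \<Longrightarrow> (\<And>k. apply_op (ops k) (c k) \<le> length x + 1) \<Longrightarrow>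
   cm_step N x (q, i, c, out)
     (q', min (length x + 1) (move d i), (\<lambda>k. apply_op (ops k) (c k)), out @ written b)"

text \<open>The counters are kept in binary, least significant bit first, on parallel tracks; the first
  cell is marked. After each step of the counter machine, one sweep to the right performs all
  operations with carries and tests for zero, and one sweep to the left returns to the marked cell.\<close>

datatype ('q, 'k) sweep_state =
  Start
| Exec 'q "'k \<Rightarrow> bool"
| Sweep 'q "'k \<Rightarrow> counter_op" "'k \<Rightarrow> bool"
| Return 'q "'k \<Rightarrow> bool"

instance sweep_state :: (finite, finite) finite
proof
  let ?A = "{Start} \<union> range (\<lambda>(q, z). Exec q z) \<union> range (\<lambda>(q, f, z). Sweep q f z) \<union> range (\<lambda>(q, z). Return q z)"
  have "s \<in> ?A" for s :: "('a, 'b) sweep_state"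
  proof (cases s)
    case (Sweep q f z)
    then show ?thesis by (auto intro: image_eqI[of _ _ "(q, f, z)"])
  qed auto
  then have "UNIV = (?A :: ('a, 'b) sweep_state set)" by blast
  moreover have "finite (?A :: ('a, 'b) sweep_state set)" by simp
  ultimately show "finite (UNIV :: ('a, 'b) sweep_state set)" by simp
qed

type_synonym 'k cell = "(bool \<times> ('k \<Rightarrow> bool)) option"

text \<open>One digit of binary addition or subtraction of 1: a pending operation flips the digit,
  and \<open>new_op\<close> is the carry or borrow for the next cell.\<close>

definition new_bit :: "('k \<Rightarrow> counter_op) \<Rightarrow> ('k \<Rightarrow> bool) \<Rightarrow> 'k \<Rightarrow> bool" where
  "new_bit ops b k = (if ops k = Keep then b k else \<not> b k)"

definition new_op :: "('k \<Rightarrow> counter_op) \<Rightarrow> ('k \<Rightarrow> bool) \<Rightarrow> 'k \<Rightarrow> counter_op" where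
  "new_op ops b k = (case ops k of Inc \<Rightarrow> if b k then Inc else Keep | Dec \<Rightarrow> if b k then Keep else Dec | Keep \<Rightarrow> Keep)"

fun sweep_delta ::
  "('q, 'k, 'a, 'b) counter_machine \<Rightarrow> ('q, 'k) sweep_state \<Rightarrow> 'a endmarked \<Rightarrow> 'k cell \<Rightarrow>
   ('q, 'k) sweep_state \<times> dir \<times> 'k cell \<times> dir \<times> 'b option" where
  "sweep_delta N Start a g = (Exec (cm_initial N) (\<lambda>_. True), Stay, Some (True, \<lambda>_. False), Stay, None)"
| "sweep_delta N (Exec q z) a g =
    (case cm_delta N q a z of (q', d, ops, b) \<Rightarrow> (Sweep q' ops (\<lambda>_. True), d, g, Stay, b))"
| "sweep_delta N (Sweep q ops z) a (Some (f, b)) =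
    (Sweep q (new_op ops b) (\<lambda>k. z k \<and> \<not> new_bit ops b k), Stay, Some (f, new_bit ops b), Right, None)"
| "sweep_delta N (Sweep q ops z) a None =
    (if \<exists>k. ops k = Inc
     then (Return q (\<lambda>k. z k \<and> ops k \<noteq> Inc), Stay, Some (False, \<lambda>k. ops k = Inc), Left, None)
     else (Return q z, Stay, None, Left, None))"
| "sweep_delta N (Return q z) a g =
    (if g \<noteq> None \<and> fst (the g) then (Exec q z, Stay, g, Stay, None) else (Return q z, Stay, g, Left, None))"

definition sweep_tm ::
  "('q, 'k, 'a, 'b) counter_machine \<Rightarrow> (('q, 'k) sweep_state, 'k cell, 'a, 'b) tm" where
  "sweep_tm N = \<lparr>tm_states = UNIV, tm_symbols = UNIV, tm_blank = None, tm_initial = Start,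
    tm_halting = {Exec q z | q z. q \<in> cm_halting N}, tm_delta = sweep_delta N\<rparr>"

lemma sweep_tm_simps [simp]:
  "tm_states (sweep_tm N) = UNIV" "tm_symbols (sweep_tm N) = UNIV" "tm_blank (sweep_tm N) = None"
  "tm_initial (sweep_tm N) = Start" "tm_delta (sweep_tm N) = sweep_delta N"
  "Exec q z \<in> tm_halting (sweep_tm N) \<longleftrightarrow> q \<in> cm_halting N" "Start \<notin> tm_halting (sweep_tm N)"
  "Sweep q ops z \<notin> tm_halting (sweep_tm N)" "Return q z \<notin> tm_halting (sweep_tm N)"
  by (auto simp: sweep_tm_def)

text \<open>The digits written by the sweep to the right, together with the zero test. An increment
  still pending at the end opens a new digit; in a simulated step no decrement is pending there,
  because only nonzero counters are decremented.\<close>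

fun sweep :: "('k \<Rightarrow> counter_op) \<Rightarrow> ('k \<Rightarrow> bool) \<Rightarrow> ('k \<Rightarrow> bool) list \<Rightarrow> ('k \<Rightarrow> bool) list \<times> ('k \<Rightarrow> bool)" where
  "sweep ops z [] = (if \<exists>k. ops k = Inc then ([\<lambda>k. ops k = Inc], \<lambda>k. z k \<and> ops k \<noteq> Inc) else ([], z))"
| "sweep ops z (b # bs) = (let s = sweep (new_op ops b) (\<lambda>k. z k \<and> \<not> new_bit ops b k) bs
    in (new_bit ops b # fst s, snd s))"

primrec track_value :: "'k \<Rightarrow> ('k \<Rightarrow> bool) list \<Rightarrow> nat" where
  "track_value k [] = 0"
| "track_value k (b # bs) = of_bool (b k) + 2 * track_value k bs"

lemma sweep_value:
  assumes "\<And>k. ops k = Dec \<Longrightarrow> track_value k bs \<noteq> 0"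
  shows "track_value k (fst (sweep ops z bs)) = apply_op (ops k) (track_value k bs)"
  using assms
proof (induction bs arbitrary: ops z)
  case Nil
  then show ?case by (cases "ops k") auto
next
  case (Cons b bs)
  have "track_value k' bs \<noteq> 0" if "new_op ops b k' = Dec" for k'
    using Cons.prems[of k'] that by (auto simp: new_op_def split: counter_op.splits if_splits)
  note IH = Cons.IH[OF this]
  have "ops k = Dec \<Longrightarrow> track_value k (b # bs) \<noteq> 0" by (rule Cons.prems)
  then show ?case
    by (cases "ops k"; cases "b k") (auto simp: Let_def IH new_op_def[of ops b k] new_bit_def[of ops b k])
qed

lemma sweep_zero: "snd (sweep ops z bs) k \<longleftrightarrow> z k \<and> track_value k (fst (sweep ops z bs)) = 0"
  by (induction bs arbitrary: ops z) (auto simp: Let_def)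

text \<open>The tape grows only when a carry leaves the top digit, and then some counter has reached
  \<open>2 ^ length bs\<close>; the bound on the counters keeps the length logarithmic.\<close>

lemma sweep_length:
  "length (fst (sweep ops z bs)) = length bs \<or>
   length (fst (sweep ops z bs)) = Suc (length bs) \<and> (\<exists>k. 2 ^ length bs \<le> track_value k (fst (sweep ops z bs)))"
proof (induction bs arbitrary: ops z)
  case (Cons b bs)
  let ?s = "fst (sweep (new_op ops b) (\<lambda>k. z k \<and> \<not> new_bit ops b k) bs)"
  have len: "length (fst (sweep ops z (b # bs))) = Suc (length ?s)" by (simp add: Let_def)
  have "\<exists>k. 2 ^ length (b # bs) \<le> track_value k (fst (sweep ops z (b # bs)))" if "\<exists>k. 2 ^ length bs \<le> track_value k ?s"
  proof -
    from that obtain k where "2 ^ length bs \<le> track_value k ?s" by blast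
    then have "2 ^ length (b # bs) \<le> track_value k (fst (sweep ops z (b # bs)))" by (simp add: Let_def)
    then show ?thesis by blast
  qed
  then show ?case
    using Cons.IH[of "new_op ops b" "\<lambda>k. z k \<and> \<not> new_bit ops b k"] unfolding len length_Cons by blast
qed auto

definition tape_of :: "('k \<Rightarrow> bool) list \<Rightarrow> nat \<Rightarrow> 'k cell" where
  "tape_of bs j = (if j < length bs then Some (j = 0, bs ! j) else None)"

text \<open>The condition on the head position of the source configuration is the space bound in
  exponential form.\<close>

definition bounded_step ::
  "('q, 'g, 'a, 'b) tm \<Rightarrow> 'a list \<Rightarrow> ('q, 'g, 'b) tm_config \<Rightarrow> ('q, 'g, 'b) tm_config \<Rightarrow> bool" where
  "bounded_step M x c c' \<longleftrightarrow> c' = tm_step M x c \<and> 2 ^ fst (snd (snd c)) \<le> 2 * (length x + 1)"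

lemma bounded_step_run:
  assumes "(bounded_step M x)\<^sup>*\<^sup>* c (q, i, j, tape, out)" "q \<in> tm_halting M" "2 ^ j \<le> 2 * (length x + 1)"
  shows "(\<exists>t. (tm_step M x ^^ t) c = (q, i, j, tape, out)) \<and> (\<forall>t. 2 ^ fst (snd (snd ((tm_step M x ^^ t) c))) \<le> 2 * (length x + 1))"
  using assms(1)
proof (induction rule: converse_rtranclp_induct)
  case base
  have "(tm_step M x ^^ t) (q, i, j, tape, out) = (q, i, j, tape, out)" for t
    by (induction t) (use assms(2) in \<open>auto simp: tm_step_def\<close>)
  then show ?case using assms(3) by auto
next
  case (step c c')
  from step(3) obtain t where t: "(tm_step M x ^^ t) c' = (q, i, j, tape, out)" by blast
  have c': "c' = tm_step M x c" "2 ^ fst (snd (snd c)) \<le> 2 * (length x + 1)"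
    using step(1) by (auto simp: bounded_step_def)
  have "(tm_step M x ^^ Suc t) c = (q, i, j, tape, out)"
    using t by (simp only: c'(1) funpow_Suc_right o_apply)
  moreover have "2 ^ fst (snd (snd ((tm_step M x ^^ s) c))) \<le> 2 * (length x + 1)" for s
  proof (cases s)
    case 0
    then show ?thesis using c'(2) by simp
  next
    case (Suc r)
    then have "(tm_step M x ^^ s) c = (tm_step M x ^^ r) c'" by (simp only: c'(1) funpow_Suc_right o_apply)
    then show ?thesis using step(3) by auto
  qed
  ultimately show ?case by blast
qed

lemma sweep_right_run:
  assumes "i \<le> length x + 1" "pre @ bs \<noteq> []" "2 ^ length (pre @ bs) \<le> 2 * (length x + 1)"
  shows "(bounded_step (sweep_tm N) x)\<^sup>*\<^sup>* (Sweep q ops z, i, length pre, tape_of (pre @ bs), out)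
    (Return q (snd (sweep ops z bs)), i, length (pre @ bs) - 1, tape_of (pre @ fst (sweep ops z bs)), out)"
  using assms
proof (induction bs arbitrary: pre ops z)
  case Nil
  have tape: "tape_of (pre @ [b]) = (tape_of pre)(length pre := Some (False, b))" for b
    using Nil.prems(2) by (auto simp: tape_of_def fun_eq_iff nth_append)
  have "tm_step (sweep_tm N) x (Sweep q ops z, i, length pre, tape_of (pre @ []), out) =
    (Return q (snd (sweep ops z [])), i, length (pre @ []) - 1, tape_of (pre @ fst (sweep ops z [])), out)"
    using Nil.prems(1) by (auto simp: tm_step_def tape_of_def[of pre "length pre"] tape written_def fun_upd_idem)
  then show ?case using Nil.prems by (intro r_into_rtranclp) (simp add: bounded_step_def)
next
  case (Cons b bs)
  let ?b = "new_bit ops b"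
  have tape: "(tape_of (pre @ b # bs))(length pre := Some (pre = [], ?b)) = tape_of ((pre @ [?b]) @ bs)"
    by (auto simp: tape_of_def fun_eq_iff nth_append nth_Cons')
  have "tm_step (sweep_tm N) x (Sweep q ops z, i, length pre, tape_of (pre @ b # bs), out) =
    (Sweep q (new_op ops b) (\<lambda>k. z k \<and> \<not> ?b k), i, length (pre @ [?b]), tape_of ((pre @ [?b]) @ bs), out)"
    using Cons.prems(1) unfolding tape[symmetric]
    by (simp add: tm_step_def tape_of_def[of "pre @ b # bs" "length pre"] written_def)
  moreover have "2 ^ length pre \<le> 2 * (length x + 1)"
    by (rule order_trans[OF power_increasing Cons.prems(3)]) simp_all
  ultimately have "bounded_step (sweep_tm N) x (Sweep q ops z, i, length pre, tape_of (pre @ b # bs), out)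
    (Sweep q (new_op ops b) (\<lambda>k. z k \<and> \<not> ?b k), i, length (pre @ [?b]), tape_of ((pre @ [?b]) @ bs), out)"
    by (simp add: bounded_step_def)
  moreover have "(bounded_step (sweep_tm N) x)\<^sup>*\<^sup>*
    (Sweep q (new_op ops b) (\<lambda>k. z k \<and> \<not> ?b k), i, length (pre @ [?b]), tape_of ((pre @ [?b]) @ bs), out)
    (Return q (snd (sweep ops z (b # bs))), i, length (pre @ b # bs) - 1, tape_of (pre @ fst (sweep ops z (b # bs))), out)"
    using Cons.IH[of "pre @ [?b]" "new_op ops b" "\<lambda>k. z k \<and> \<not> ?b k"] Cons.prems by (simp add: Let_def)
  ultimately show ?case by (rule converse_rtranclp_into_rtranclp)
qed

lemma sweep_left_run:
  assumes "i \<le> length x + 1" "j < length bs" "2 ^ j \<le> 2 * (length x + 1)"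
  shows "(bounded_step (sweep_tm N) x)\<^sup>*\<^sup>* (Return q z, i, j, tape_of bs, out) (Exec q z, i, 0, tape_of bs, out)"
  using assms(2,3)
proof (induction j)
  case 0
  then show ?case
    using assms(1) by (intro r_into_rtranclp)
      (auto simp: bounded_step_def tm_step_def tape_of_def[of bs 0] written_def fun_upd_idem)
next
  case (Suc j)
  then have "bounded_step (sweep_tm N) x (Return q z, i, Suc j, tape_of bs, out) (Return q z, i, j, tape_of bs, out)"
    using assms(1)
    by (auto simp: bounded_step_def tm_step_def tape_of_def[of bs "Suc j"] written_def fun_upd_idem)
  then show ?case using Suc by (auto intro: converse_rtranclp_into_rtranclp)
qed

text \<open>Between two simulated steps the head is back on the marked cell and the control already
  knows which counters vanish, since \<open>cm_delta\<close> depends on the counters only through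
  this.\<close>

definition sweep_rep ::
  "'a list \<Rightarrow> ('q, 'k, 'b) cm_config \<Rightarrow> (('q, 'k) sweep_state, 'k cell, 'b) tm_config \<Rightarrow> bool" where
  "sweep_rep x c C \<longleftrightarrow> (case c of (q, i, v, out) \<Rightarrow> i \<le> length x + 1 \<and> (\<exists>bs. bs \<noteq> [] \<and>
    2 ^ length bs \<le> 2 * (length x + 1) \<and> (\<forall>k. track_value k bs = v k) \<and>
    C = (Exec q (\<lambda>k. v k = 0), i, 0, tape_of bs, out)))"

lemma sweep_rep_step:
  assumes "cm_step N x c c'" "sweep_rep x c C"
  shows "\<exists>C'. (bounded_step (sweep_tm N) x)\<^sup>*\<^sup>* C C' \<and> sweep_rep x c' C'"
  using assms(1)
proof cases
  case (1 q i v q' d ops b out)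
  obtain bs where bs: "bs \<noteq> []" "2 ^ length bs \<le> 2 * (length x + 1)" "\<And>k. track_value k bs = v k" "i \<le> length x + 1"
    "C = (Exec q (\<lambda>k. v k = 0), i, 0, tape_of bs, out)"
    using assms(2) unfolding sweep_rep_def 1 by auto
  let ?i = "min (length x + 1) (move d i)"
  let ?bs = "fst (sweep ops (\<lambda>_. True) bs)"
  let ?z = "snd (sweep ops (\<lambda>_. True) bs)"
  have val: "track_value k ?bs = apply_op (ops k) (v k)" for k
    using sweep_value[of ops bs k] 1(5) by (simp add: bs(3))
  have z: "?z = (\<lambda>k. apply_op (ops k) (v k) = 0)"
    by (rule ext) (simp add: sweep_zero val)
  have len: "?bs \<noteq> []" "length bs \<le> length ?bs" "2 ^ length ?bs \<le> 2 * (length x + 1)"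
  proof -
    show "length bs \<le> length ?bs" using sweep_length[of ops "\<lambda>_. True" bs] by auto
    with bs(1) show "?bs \<noteq> []" by auto
    show "2 ^ length ?bs \<le> 2 * (length x + 1)"
    proof (cases "length ?bs = length bs")
      case False
      then obtain k where "length ?bs = Suc (length bs)" "2 ^ length bs \<le> apply_op (ops k) (v k)"
        using sweep_length[of ops "\<lambda>_. True" bs] unfolding val by blast
      then show ?thesis using 1(6)[of k] by simp
    qed (use bs(2) in simp)
  qed
  have "bounded_step (sweep_tm N) x C (Sweep q' ops (\<lambda>_. True), ?i, 0, tape_of bs, out @ written b)"
    unfolding bs(5) using 1 by (simp add: bounded_step_def tm_step_def fun_upd_idem)
  moreover have "(bounded_step (sweep_tm N) x)\<^sup>*\<^sup>* (Sweep q' ops (\<lambda>_. True), ?i, 0, tape_of bs, out @ written b)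
      (Return q' ?z, ?i, length bs - 1, tape_of ?bs, out @ written b)"
    using sweep_right_run[of ?i x "[]" bs N q' ops "\<lambda>_. True"] bs by simp
  moreover have "(bounded_step (sweep_tm N) x)\<^sup>*\<^sup>* (Return q' ?z, ?i, length bs - 1, tape_of ?bs, out @ written b)
      (Exec q' ?z, ?i, 0, tape_of ?bs, out @ written b)"
  proof (rule sweep_left_run)
    show "length bs - 1 < length ?bs" using len bs(1) by (cases bs) auto
    have "(2 :: nat) ^ (length bs - 1) \<le> 2 ^ length bs" by (rule power_increasing) simp_all
    then show "2 ^ (length bs - 1) \<le> 2 * (length x + 1)" using bs(2) by linarith
  qed simp
  ultimately have "(bounded_step (sweep_tm N) x)\<^sup>*\<^sup>* C (Exec q' ?z, ?i, 0, tape_of ?bs, out @ written b)"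
    by (meson converse_rtranclp_into_rtranclp rtranclp_trans)
  moreover have "sweep_rep x c' (Exec q' ?z, ?i, 0, tape_of ?bs, out @ written b)"
    unfolding 1 sweep_rep_def prod.case z using len val by auto
  ultimately show ?thesis by blast
qed

lemma sweep_rep_steps:
  assumes "(cm_step N x)\<^sup>*\<^sup>* c c'" "sweep_rep x c C"
  shows "\<exists>C'. (bounded_step (sweep_tm N) x)\<^sup>*\<^sup>* C C' \<and> sweep_rep x c' C'"
  using assms
proof (induction rule: rtranclp_induct)
  case (step c' c'')
  then obtain C' where "(bounded_step (sweep_tm N) x)\<^sup>*\<^sup>* C C'" "sweep_rep x c' C'" by blast
  then show ?case using sweep_rep_step[OF step(2)] by (meson rtranclp_trans)
qed blast

definition tm_reaches_bounded :: "('q, 'g, 'a, 'b) tm \<Rightarrow> 'a list \<Rightarrow> 'b list \<Rightarrow> bool" where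
  "tm_reaches_bounded M x y \<longleftrightarrow> (\<exists>t q i j tape. tm_run M x t = (q, i, j, tape, y) \<and> q \<in> tm_halting M) \<and>
    (\<forall>t. 2 ^ fst (snd (snd (tm_run M x t))) \<le> 2 * (length x + 1))"

lemma sweep_tm_simulates:
  assumes "(cm_step N x)\<^sup>*\<^sup>* (cm_initial N, 0, \<lambda>_. 0, []) (q, i, v, y)" "q \<in> cm_halting N"
  shows "tm_reaches_bounded (sweep_tm N) x y"
proof -
  have "tape_of [\<lambda>_. False] = (\<lambda>_. None)(0 := Some (True, \<lambda>_. False))"
    by (auto simp: tape_of_def fun_eq_iff)
  then have start: "bounded_step (sweep_tm N) x (Start, 0, 0, \<lambda>_. None, [])
      (Exec (cm_initial N) (\<lambda>_. True), 0, 0, tape_of [\<lambda>_. False], [])"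
    by (simp add: bounded_step_def tm_step_def written_def)
  have "sweep_rep x (cm_initial N, 0, \<lambda>_. 0, []) (Exec (cm_initial N) (\<lambda>_. True), 0, 0, tape_of [\<lambda>_. False], [])"
    by (auto simp: sweep_rep_def intro!: exI[of _ "[\<lambda>_. False]"])
  from sweep_rep_steps[OF assms(1) this] obtain C where
    C: "(bounded_step (sweep_tm N) x)\<^sup>*\<^sup>* (Exec (cm_initial N) (\<lambda>_. True), 0, 0, tape_of [\<lambda>_. False], []) C"
      "sweep_rep x (q, i, v, y) C" by blast
  then obtain bs where bs: "C = (Exec q (\<lambda>k. v k = 0), i, 0, tape_of bs, y)" by (auto simp: sweep_rep_def)
  have "(bounded_step (sweep_tm N) x)\<^sup>*\<^sup>* (Start, 0, 0, \<lambda>_. None, []) (Exec q (\<lambda>k. v k = 0), i, 0, tape_of bs, y)"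
    using converse_rtranclp_into_rtranclp[of "bounded_step (sweep_tm N) x", OF start] C(1) bs by simp
  note run = bounded_step_run[OF this]
  have "(\<exists>t. tm_run (sweep_tm N) x t = (Exec q (\<lambda>k. v k = 0), i, 0, tape_of bs, y)) \<and>
      (\<forall>t. 2 ^ fst (snd (snd (tm_run (sweep_tm N) x t))) \<le> 2 * (length x + 1))"
    unfolding tm_run_def sweep_tm_simps by (rule run) (simp_all add: assms(2))
  moreover have "Exec q (\<lambda>k. v k = 0) \<in> tm_halting (sweep_tm N)" using assms(2) by simp
  ultimately show ?thesis unfolding tm_reaches_bounded_def by blast
qed

section \<open>Renaming states and tape symbols, and membership in \<open>FL\<close>\<close>

definition map_config :: "('q \<Rightarrow> 'r) \<Rightarrow> ('g \<Rightarrow> 'h) \<Rightarrow> ('q, 'g, 'b) tm_config \<Rightarrow> ('r, 'h, 'b) tm_config" where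
  "map_config f g = (\<lambda>(q, i, j, tape, out). (f q, i, j, g \<circ> tape, out))"

text \<open>The class \<open>FL\<close> asks for numbers as states and symbols; a machine over
  finite types is transported along two injections.\<close>

definition rename_tm :: "('q \<Rightarrow> 'r) \<Rightarrow> ('g \<Rightarrow> 'h) \<Rightarrow> ('q, 'g, 'a, 'b) tm \<Rightarrow> ('r, 'h, 'a, 'b) tm" where
  "rename_tm f g M = \<lparr>tm_states = f ` tm_states M, tm_symbols = g ` tm_symbols M, tm_blank = g (tm_blank M),
    tm_initial = f (tm_initial M), tm_halting = f ` tm_halting M,
    tm_delta = (\<lambda>q a s. case tm_delta M (inv f q) a (inv g s) of (q', d, s', e, b) \<Rightarrow> (f q', d, g s', e, b))\<rparr>"

lemma rename_tm_step:
  assumes "inj f" "inj g"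
  shows "tm_step (rename_tm f g M) x (map_config f g c) = map_config f g (tm_step M x c)"
proof -
  obtain q i j tape out where c: "c = (q, i, j, tape, out)" by (cases c)
  obtain q' d s' e b where \<delta>: "tm_delta M q (endmarked_word x ! i) (tape j) = (q', d, s', e, b)"
    by (cases "tm_delta M q (endmarked_word x ! i) (tape j)")
  have "f q \<in> f ` tm_halting M \<longleftrightarrow> q \<in> tm_halting M" by (rule inj_image_mem_iff[OF assms(1)])
  then show ?thesis
    by (simp add: c \<delta> tm_step_def map_config_def rename_tm_def fun_upd_comp inv_f_f[OF assms(1)] inv_f_f[OF assms(2)])
qed

lemma rename_tm_run:
  assumes "inj f" "inj g"
  shows "tm_run (rename_tm f g M) x t = map_config f g (tm_run M x t)"
proof (induction t)
  case 0
  show ?case by (simp add: tm_run_def rename_tm_def map_config_def comp_def)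
next
  case (Suc t)
  then show ?case using rename_tm_step[OF assms] by (simp add: tm_run_def)
qed

lemma wf_rename_tm:
  assumes "inj f" "inj g" "wf_tm \<Sigma> \<Gamma> M"
  shows "wf_tm \<Sigma> \<Gamma> (rename_tm f g M)"
proof -
  have "tm_delta (rename_tm f g M) q a s \<in> tm_states (rename_tm f g M) \<times> UNIV \<times> tm_symbols (rename_tm f g M) \<times>
      UNIV \<times> insert None (Some ` \<Gamma>)"
    if q: "q \<in> tm_states (rename_tm f g M) - tm_halting (rename_tm f g M)" and a: "a \<in> endmarked_symbols \<Sigma>"
      and s: "s \<in> tm_symbols (rename_tm f g M)" for q a s
  proof -
    obtain q0 where q0: "q = f q0" "q0 \<in> tm_states M - tm_halting M" using q by (auto simp: rename_tm_def)
    obtain s0 where s0: "s = g s0" "s0 \<in> tm_symbols M" using s by (auto simp: rename_tm_def)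
    have "tm_delta M q0 a s0 \<in> tm_states M \<times> UNIV \<times> tm_symbols M \<times> UNIV \<times> insert None (Some ` \<Gamma>)"
      using assms(3) q0(2) a s0(2) unfolding wf_tm_def by blast
    then show ?thesis
      unfolding q0(1) s0(1) rename_tm_def
      by (cases "tm_delta M q0 a s0") (simp add: inv_f_f[OF assms(1)] inv_f_f[OF assms(2)])
  qed
  moreover have "finite (tm_states (rename_tm f g M))" "finite (tm_symbols (rename_tm f g M))"
    "tm_blank (rename_tm f g M) \<in> tm_symbols (rename_tm f g M)" "tm_initial (rename_tm f g M) \<in> tm_states (rename_tm f g M)"
    "tm_halting (rename_tm f g M) \<subseteq> tm_states (rename_tm f g M)"
    using assms(3) by (auto simp: wf_tm_def rename_tm_def)
  ultimately show ?thesis unfolding wf_tm_def by blast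
qed

text \<open>Reduces the bound on the output at all times to the length of the final output.\<close>

lemma tm_output_mono:
  "length (snd (snd (snd (snd (tm_run M x t))))) \<le> length (snd (snd (snd (snd (tm_run M x (t + s))))))"
proof (induction s)
  case (Suc s)
  have "length (snd (snd (snd (snd c)))) \<le> length (snd (snd (snd (snd (tm_step M x c)))))" for c
    by (auto simp: tm_step_def split: prod.splits)
  from this[of "tm_run M x (t + s)"] show ?case using Suc by (simp add: tm_run_def)
qed simp

lemma tm_run_halted:
  assumes "tm_run M x t = c" "fst c \<in> tm_halting M"
  shows "tm_run M x (t + s) = c"
proof (induction s)
  case (Suc s)
  have "tm_step M x c = c" using assms(2) by (auto simp: tm_step_def split: prod.splits)
  then show ?case using Suc by (simp add: tm_run_def)
qed (simp add: assms)

lemma FL_I: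
  fixes M :: "('q :: finite, 'g :: finite, 'a, 'b) tm"
  assumes "wf_tm \<Sigma> \<Gamma> M" and M: "\<And>x. x \<in> lists \<Sigma> \<Longrightarrow> tm_reaches_bounded M x (F x)"
    and F: "\<And>x. x \<in> lists \<Sigma> \<Longrightarrow> length (F x) \<le> poly p (length x)"
  shows "F \<in> FL \<Sigma> \<Gamma>"
proof -
  obtain f :: "'q \<Rightarrow> nat" where f: "inj f" using finite_imp_inj_to_nat_seg[of "UNIV :: 'q set"] by auto
  obtain g :: "'g \<Rightarrow> nat" where g: "inj g" using finite_imp_inj_to_nat_seg[of "UNIV :: 'g set"] by auto
  let ?M = "rename_tm f g M"
  have "tm_computes \<Sigma> ?M F"
    unfolding tm_computes_def
  proof
    fix x assume "x \<in> lists \<Sigma>"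
    then obtain t q i j tape where "tm_run M x t = (q, i, j, tape, F x)" "q \<in> tm_halting M"
      using M unfolding tm_reaches_bounded_def by blast
    then have "tm_run ?M x t = (f q, i, j, g \<circ> tape, F x)" "f q \<in> tm_halting ?M"
      unfolding rename_tm_run[OF f g] by (simp_all add: map_config_def rename_tm_def)
    then show "\<exists>t q i j tape. tm_run ?M x t = (q, i, j, tape, F x) \<and> q \<in> tm_halting ?M" by blast
  qed
  moreover have "tm_log_space \<Sigma> ?M"
    unfolding tm_log_space_def
  \<comment> \<open>The head position is at most \<open>1 + y\<close> with \<open>y\<close> the
    logarithm, and \<open>y \<ge> 1\<close>; counting cells adds one more, so \<open>3 * y\<close>
    suffices.\<close>
  proof (intro exI[of _ 3] ballI allI impI)
    fix x t q i j tape out assume x: "x \<in> lists \<Sigma>" and "tm_run ?M x t = (q, i, j, tape, out)"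
    then have "fst (snd (snd (tm_run M x t))) = j"
      unfolding rename_tm_run[OF f g] map_config_def by (auto split: prod.splits)
    then have "2 ^ j \<le> 2 * (length x + 1)" using M[OF x] unfolding tm_reaches_bounded_def by metis
    then have "real (2 ^ j) \<le> real (2 * (length x + 1))" by (rule of_nat_mono)
    then have "log 2 (2 ^ j) \<le> log 2 (2 * (real (length x) + 2))" by (intro log_mono) auto
    also have "\<dots> = 1 + log 2 (real (length x) + 2)" by (subst log_mult) simp_all
    finally have "real j \<le> 1 + log 2 (real (length x) + 2)" by simp
    moreover have "1 \<le> log 2 (real (length x) + 2)" by (simp add: le_log_iff)
    moreover have "u + 1 \<le> 3 * y" if "u \<le> 1 + y" "1 \<le> y" for u y :: real using that by simp
    ultimately have "real j + 1 \<le> 3 * log 2 (real (length x) + 2)" by blast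
    then show "real (j + 1) \<le> 3 * log 2 (real (length x + 2))" by (simp add: add.commute)
  qed
  moreover have "tm_poly_output \<Sigma> ?M"
    unfolding tm_poly_output_def
  proof (intro exI[of _ p] ballI allI impI)
    fix x t q i j tape out assume x: "x \<in> lists \<Sigma>" and "tm_run ?M x t = (q, i, j, tape, out)"
    then have out: "snd (snd (snd (snd (tm_run M x t)))) = out"
      unfolding rename_tm_run[OF f g] map_config_def by (auto split: prod.splits)
    obtain t' q' i' j' tape' where t': "tm_run M x t' = (q', i', j', tape', F x)" "q' \<in> tm_halting M"
      using M[OF x] unfolding tm_reaches_bounded_def by blast
    have "length out \<le> length (snd (snd (snd (snd (tm_run M x (t + t'))))))"
      unfolding out[symmetric] by (rule tm_output_mono)
    also have "tm_run M x (t + t') = (q', i', j', tape', F x)"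
      using tm_run_halted[OF t'(1), of t] t'(2) by (simp add: add.commute)
    finally show "length out \<le> poly p (length x)" using F[OF x] by simp
  qed
  ultimately show ?thesis unfolding FL_def using wf_rename_tm[OF f g assms(1)] by blast
qed

lemma counter_machine_FL:
  fixes N :: "('q :: finite, 'k :: finite, 'a, 'b) counter_machine"
  assumes "\<And>q a z. snd (snd (snd (cm_delta N q a z))) \<in> insert None (Some ` \<Gamma>)"
    and "\<And>x. x \<in> lists \<Sigma> \<Longrightarrow> \<exists>q i v. (cm_step N x)\<^sup>*\<^sup>* (cm_initial N, 0, \<lambda>_. 0, []) (q, i, v, F x) \<and> q \<in> cm_halting N"
    and "\<And>x. x \<in> lists \<Sigma> \<Longrightarrow> length (F x) \<le> poly p (length x)"
  shows "F \<in> FL \<Sigma> \<Gamma>"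
proof (rule FL_I)
  have "sweep_delta N q a g \<in> UNIV \<times> UNIV \<times> UNIV \<times> UNIV \<times> insert None (Some ` \<Gamma>)" for q a g
  proof (cases "(N, q, a, g)" rule: sweep_delta.cases)
    case (2 N' q' z a' g')
    then show ?thesis using assms(1)[of q' a' z] by (cases "cm_delta N q' a' z") simp
  qed auto
  then show "wf_tm \<Sigma> \<Gamma> (sweep_tm N)" unfolding wf_tm_def by simp
  fix x assume "x \<in> lists \<Sigma>"
  from assms(2)[OF this] obtain q i v where
    "(cm_step N x)\<^sup>*\<^sup>* (cm_initial N, 0, \<lambda>_. 0, []) (q, i, v, F x)" "q \<in> cm_halting N" by blast
  then show "tm_reaches_bounded (sweep_tm N) x (F x)" by (rule sweep_tm_simulates)
qed (rule assms(3))

section \<open>A counter machine for the generator\<close>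

text \<open>The number of letters read so far modulo 6. Every sixth letter increments
  \<open>CS\<close>, so that it ends as the block length \<open>m\<close>.\<close>

datatype residue = R0 | R1 | R2 | R3 | R4 | R5

primrec residue_suc :: "residue \<Rightarrow> residue" where
  "residue_suc R0 = R1" | "residue_suc R1 = R2" | "residue_suc R2 = R3"
| "residue_suc R3 = R4" | "residue_suc R4 = R5" | "residue_suc R5 = R0"

definition residue_of :: "nat \<Rightarrow> residue" where
  "residue_of s = [R0, R1, R2, R3, R4, R5] ! (s mod 6)"

lemma residue_of_Suc: "residue_of (Suc s) = residue_suc (residue_of s)"
proof -
  have "s mod 6 \<in> {0, 1, 2, 3, 4, 5}" by auto
  then show ?thesis unfolding residue_of_def mod_Suc by auto
qed

lemma residue_of_eq_R5: "residue_of s = R5 \<longleftrightarrow> s mod 6 = 5"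
proof -
  have "s mod 6 \<in> {0, 1, 2, 3, 4, 5}" by auto
  then show ?thesis unfolding residue_of_def by auto
qed

instance residue :: finite
proof
  have "(UNIV :: residue set) = {R0, R1, R2, R3, R4, R5}" by (auto intro: residue.exhaust)
  then show "finite (UNIV :: residue set)" by (metis finite.emptyI finite_insert)
qed

datatype counter = CT | CS | CU | CV

instance counter :: finite
proof
  have "(UNIV :: counter set) = {CT, CS, CU, CV}" by (auto intro: counter.exhaust)
  then show "finite (UNIV :: counter set)" by (metis finite.emptyI finite_insert)
qed

datatype phase = P1 | P2 | P3 | P4

instance phase :: finite
proof
  have "(UNIV :: phase set) = {P1, P2, P3, P4}" by (auto intro: phase.exhaust)
  then show "finite (UNIV :: phase set)" by (metis finite.emptyI finite_insert)
qed

datatype location =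
  Count residue | Rewind | Test counter | Move1 counter | Move2 counter | Move3 counter
| MaskB | MaskC | RewindCopy | CopyRest | Done

instance location :: finite
proof
  have "l \<in> range Count \<union> range Test \<union> range Move1 \<union> range Move2 \<union> range Move3 \<union>
      {Rewind, MaskB, MaskC, RewindCopy, CopyRest, Done}" for l
    by (cases l) auto
  then have "(UNIV :: location set) = range Count \<union> range Test \<union> range Move1 \<union> range Move2 \<union> range Move3 \<union>
      {Rewind, MaskB, MaskC, RewindCopy, CopyRest, Done}" by blast
  then show "finite (UNIV :: location set)" by (metis finite finite_Un finite_imageI finite.emptyI finite_insert)
qed

primrec partner :: "counter \<Rightarrow> counter" where
  "partner CT = CU" | "partner CU = CT" | "partner CS = CV" | "partner CV = CS"

text \<open>With \<open>m = T + S + 1\<close> the block length disappears from the distances between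
  the four letters: for instance from offset \<open>T\<close> to offset \<open>m + 2 * S\<close> it
  is \<open>3 * S + 1\<close>. The coefficients are the strides, so the head is steered by
  \<open>T\<close> and \<open>S\<close> alone; \<open>CT\<close>, in turn, leads from the left end
  to offset \<open>T\<close>.\<close>

primrec stride :: "counter \<Rightarrow> nat" where
  "stride CT = 1" | "stride CS = 3" | "stride CU = 4" | "stride CV = 3"

text \<open>The test itself moves the head by one cell, which leaves \<open>stride c - 1\<close>
  further moves.\<close>

primrec after_test :: "counter \<Rightarrow> location" where
  "after_test CT = Test CT" | "after_test CS = Move2 CS" | "after_test CU = Move3 CU" | "after_test CV = Move2 CV"

fun letter_bit :: "bool endmarked \<Rightarrow> bool" where
  "letter_bit (Letter b) = b"
| "letter_bit _ = False"

definition no_ops :: "counter \<Rightarrow> counter_op" where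
  "no_ops = (\<lambda>_. Keep)"

definition shift_ops :: "counter \<Rightarrow> counter \<Rightarrow> counter \<Rightarrow> counter_op" where
  "shift_ops c c' = no_ops(c := Dec, c' := Inc)"

definition emit_in :: "phase \<Rightarrow> phase \<Rightarrow> bool \<Rightarrow> bool option" where
  "emit_in p ph b = (if ph = p then Some b else None)"

type_synonym gip_state = "location \<times> phase \<times> bool \<times> bool"

text \<open>A state consists of a location, the block being printed, the product of the bits fetched so
  far, and the parity. For \<open>T + S = m - 1\<close> the fetch loop visits \<open>X\<^sub>1[T]\<close>, \<open>Y\<^sub>2[S]\<close>, \<open>Y\<^sub>3[T]\<close>, \<open>X\<^sub>4[S]\<close>, whose
  distances are \<open>3S + 1\<close>, \<open>4T + 2\<close> and \<open>3S + 2\<close>; skipping moves \<open>T\<close> to \<open>U\<close> and \<open>S\<close> to \<open>V\<close> and back.\<close>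

fun fetch_exit ::
  "counter \<Rightarrow> phase \<Rightarrow> bool \<Rightarrow> bool \<Rightarrow> bool \<Rightarrow> (counter \<Rightarrow> bool) \<Rightarrow> gip_state \<times> (counter \<Rightarrow> counter_op) \<times> bool option" where
  "fetch_exit CT ph acc par b z = ((Test CS, ph, b, par), no_ops, emit_in P1 ph b)"
| "fetch_exit CS ph acc par b z = ((MaskB, ph, acc \<and> b, par), no_ops, emit_in P2 ph b)"
| "fetch_exit CU ph acc par b z = ((MaskC, ph, acc \<and> b, par), no_ops, emit_in P3 ph b)"
| "fetch_exit CV P1 acc par b z =
    (if z CS then ((Rewind, P2, False, par), no_ops, None) else ((Rewind, P1, False, par), shift_ops CS CT, None))"
| "fetch_exit CV P2 acc par b z =
    (if z CT then ((Rewind, P3, False, par), no_ops, None) else ((Rewind, P2, False, par), shift_ops CT CS, None))"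
| "fetch_exit CV P3 acc par b z =
    (if z CS then ((Rewind, P4, False, par), no_ops, None) else ((Rewind, P3, False, par), shift_ops CS CT, None))"
| "fetch_exit CV P4 acc par b z =
    (if z CT then ((CopyRest, P4, False, par \<noteq> (acc \<and> b)), no_ops, Some b)
     else ((Rewind, P4, False, par \<noteq> (acc \<and> b)), shift_ops CT CS, Some b))"

text \<open>When counting ends, \<open>CS\<close> holds \<open>m\<close>. Decrementing it
  establishes \<open>T + S = m - 1\<close> with \<open>T = 0\<close>; if \<open>m = 0\<close> this
  is impossible, and the whole input is copied instead.\<close>

fun gip_delta ::
  "gip_state \<Rightarrow> bool endmarked \<Rightarrow> (counter \<Rightarrow> bool) \<Rightarrow> gip_state \<times> dir \<times> (counter \<Rightarrow> counter_op) \<times> bool option" where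
  "gip_delta (Count j, ph, acc, par) a z = (case a of
      LEnd \<Rightarrow> ((Count j, ph, acc, par), Right, no_ops, None)
    | Letter b \<Rightarrow> ((Count (residue_suc j), ph, acc, par), Right, if j = R5 then no_ops(CS := Inc) else no_ops, None)
    | REnd \<Rightarrow> if z CS then ((RewindCopy, ph, acc, par), Stay, no_ops, None)
        else ((Rewind, ph, acc, par), Stay, no_ops(CS := Dec), None))"
| "gip_delta (Rewind, ph, acc, par) a z =
    (if a = LEnd then ((Test CT, ph, acc, par), Right, no_ops, None) else ((Rewind, ph, acc, par), Left, no_ops, None))"
| "gip_delta (Test c, ph, acc, par) a z =
    (if z c then (case fetch_exit c ph acc par (letter_bit a) z of (q, ops, b) \<Rightarrow> (q, Right, ops, b))
     else ((after_test c, ph, acc, par), Right, shift_ops c (partner c), None))"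
| "gip_delta (Move3 c, ph, acc, par) a z = ((Move2 c, ph, acc, par), Right, no_ops, None)"
| "gip_delta (Move2 c, ph, acc, par) a z = ((Move1 c, ph, acc, par), Right, no_ops, None)"
| "gip_delta (Move1 c, ph, acc, par) a z = ((Test c, ph, acc, par), Right, no_ops, None)"
| "gip_delta (MaskB, ph, acc, par) a z = ((Test CU, ph, acc, par), Right, no_ops, emit_in P2 ph (letter_bit a \<noteq> acc))"
| "gip_delta (MaskC, ph, acc, par) a z = ((Test CV, ph, acc, par), Right, no_ops, emit_in P3 ph (letter_bit a \<noteq> acc))"
| "gip_delta (RewindCopy, ph, acc, par) a z =
    (if a = LEnd then ((CopyRest, ph, acc, par), Right, no_ops, None) else ((RewindCopy, ph, acc, par), Left, no_ops, None))"
| "gip_delta (CopyRest, ph, acc, par) a z =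
    (case a of Letter b \<Rightarrow> ((CopyRest, ph, acc, par), Right, no_ops, Some b)
     | _ \<Rightarrow> ((Done, ph, acc, par), Stay, no_ops, Some par))"
| "gip_delta (Done, ph, acc, par) a z = ((Done, ph, acc, par), Stay, no_ops, None)"

definition gip_machine :: "(gip_state, counter, bool, bool) counter_machine" where
  "gip_machine = \<lparr>cm_initial = (Count R0, P1, False, False), cm_halting = {Done} \<times> UNIV, cm_delta = gip_delta\<rparr>"

section \<open>Correctness of the counter machine\<close>

lemma gip_step:
  assumes "gip_delta (l, s) (endmarked_word x ! i) (\<lambda>k. v k = 0) = (q', d, ops, b)" "l \<noteq> Done"
    and "\<And>k. ops k = Dec \<Longrightarrow> v k \<noteq> 0" "\<And>k. v k \<le> length x"
    and "i' = min (length x + 1) (move d i)" "\<And>k. v' k = apply_op (ops k) (v k)" "out' = out @ written b"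
  shows "cm_step gip_machine x ((l, s), i, v, out) (q', i', v', out')"
proof -
  have "apply_op (ops k) (v k) \<le> length x + 1" for k
    using assms(4)[of k] by (cases "ops k") auto
  moreover have "v' = (\<lambda>k. apply_op (ops k) (v k))" using assms(6) by auto
  moreover have "(l, s) \<notin> cm_halting gip_machine" using assms(2) by (simp add: gip_machine_def)
  moreover have "cm_delta gip_machine (l, s) (endmarked_word x ! i) (\<lambda>k. v k = 0) = (q', d, ops, b)"
    using assms(1) by (simp add: gip_machine_def)
  ultimately show ?thesis
    using cm_step.intros[of "(l, s)" gip_machine x i v q' d ops b out] assms(3,5,7) by blast
qed

definition ctrs :: "nat \<Rightarrow> nat \<Rightarrow> nat \<Rightarrow> nat \<Rightarrow> counter \<Rightarrow> nat" where
  "ctrs t s u v k = (case k of CT \<Rightarrow> t | CS \<Rightarrow> s | CU \<Rightarrow> u | CV \<Rightarrow> v)"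

lemma ctrs_simps [simp]:
  "ctrs t s u v CT = t" "ctrs t s u v CS = s" "ctrs t s u v CU = u" "ctrs t s u v CV = v"
  by (simp_all add: ctrs_def)

lemma ctrs_upd [simp]:
  "(ctrs t s u v)(CT := k) = ctrs k s u v" "(ctrs t s u v)(CS := k) = ctrs t k u v"
  "(ctrs t s u v)(CU := k) = ctrs t s k v" "(ctrs t s u v)(CV := k) = ctrs t s u k"
  by (auto simp: ctrs_def fun_eq_iff split: counter.splits)

lemma ctrs_le: "t \<le> n \<Longrightarrow> s \<le> n \<Longrightarrow> u \<le> n \<Longrightarrow> v \<le> n \<Longrightarrow> ctrs t s u v k \<le> n"
  by (cases k) auto

lemma endmarked_nth [simp]:
  "endmarked_word x ! 0 = LEnd" "p < length x \<Longrightarrow> endmarked_word x ! Suc p = Letter (x ! p)"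
  "endmarked_word x ! Suc (length x) = REnd"
  by (auto simp: endmarked_word_def nth_append)

lemma endmarked_nth_pos: "0 < i \<Longrightarrow> i \<le> length x + 1 \<Longrightarrow> endmarked_word x ! i \<noteq> LEnd"
  by (cases i) (auto simp: le_less)

abbreviation gip_steps ::
  "bool list \<Rightarrow> (gip_state, counter, bool) cm_config \<Rightarrow> (gip_state, counter, bool) cm_config \<Rightarrow> bool" where
  "gip_steps x \<equiv> (cm_step gip_machine x)\<^sup>*\<^sup>*"

lemma gip_rewind:
  assumes "i \<le> length x + 1" "\<And>k. v k \<le> length x" "l = Rewind \<and> l' = Test CT \<or> l = RewindCopy \<and> l' = CopyRest"
  shows "gip_steps x ((l, s), i, v, out) ((l', s), 1, v, out)"
  using assms(1)
proof (induction i)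
  case 0
  obtain ph acc par where s: "s = (ph, acc, par)" by (cases s)
  show ?case
    by (rule r_into_rtranclp, rule gip_step[where d = Right and ops = no_ops and b = None])
      (use assms in \<open>auto simp: s no_ops_def written_def\<close>)
next
  case (Suc i)
  obtain ph acc par where s: "s = (ph, acc, par)" by (cases s)
  have "cm_step gip_machine x ((l, s), Suc i, v, out) ((l, s), i, v, out)"
    by (rule gip_step[where d = Left and ops = no_ops and b = None])
      (use assms Suc.prems endmarked_nth_pos[of "Suc i" x] in \<open>auto simp: s no_ops_def written_def\<close>)
  then show ?case using Suc by (auto intro: converse_rtranclp_into_rtranclp)
qed

lemma gip_count:
  assumes "s \<le> length x"
  shows "gip_steps x ((Count R0, q), 0, ctrs 0 0 0 0, []) ((Count (residue_of s), q), s + 1, ctrs 0 (s div 6) 0 0, [])"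
  using assms
proof (induction s)
  case 0
  obtain ph acc par where q: "q = (ph, acc, par)" by (cases q)
  show ?case
    by (rule r_into_rtranclp, rule gip_step[where d = Right and ops = no_ops and b = None])
      (auto simp: q no_ops_def written_def residue_of_def ctrs_def split: counter.splits)
next
  case (Suc s)
  obtain ph acc par where q: "q = (ph, acc, par)" by (cases q)
  have div: "Suc s div 6 = s div 6 + (if s mod 6 = 5 then 1 else 0)"
    by (simp add: div_Suc mod_Suc)
  have "cm_step gip_machine x ((Count (residue_of s), q), s + 1, ctrs 0 (s div 6) 0 0, [])
     ((Count (residue_of (Suc s)), q), Suc s + 1, ctrs 0 (Suc s div 6) 0 0, [])"
    by (rule gip_step[where d = Right and ops = "if residue_of s = R5 then no_ops(CS := Inc) else no_ops" and b = None])
      (use Suc.prems in \<open>auto simp: q residue_of_Suc residue_of_eq_R5 div no_ops_def written_def ctrs_def split: counter.splits if_splits\<close>)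
  then show ?case using Suc by (auto intro: rtranclp.rtrancl_into_rtrancl)
qed

lemma gip_move:
  assumes "\<And>k. v k \<le> length x" "i \<le> length x"
  shows "cm_step gip_machine x ((Move3 c, s), i, v, out) ((Move2 c, s), i + 1, v, out)"
    and "cm_step gip_machine x ((Move2 c, s), i, v, out) ((Move1 c, s), i + 1, v, out)"
    and "cm_step gip_machine x ((Move1 c, s), i, v, out) ((Test c, s), i + 1, v, out)"
proof -
  obtain ph acc par where s: "s = (ph, acc, par)" by (cases s)
  show "cm_step gip_machine x ((Move3 c, s), i, v, out) ((Move2 c, s), i + 1, v, out)"
    "cm_step gip_machine x ((Move2 c, s), i, v, out) ((Move1 c, s), i + 1, v, out)"
    "cm_step gip_machine x ((Move1 c, s), i, v, out) ((Test c, s), i + 1, v, out)"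
    using assms by (auto intro!: gip_step[where d = Right and ops = no_ops and b = None]
        simp: s no_ops_def written_def)
qed

lemma partner_neq [simp]: "partner c \<noteq> c" "c \<noteq> partner c"
  by (cases c; simp)+

lemma gip_loop_body:
  assumes "v c \<noteq> 0" "\<And>k. v k \<le> length x" "v (partner c) < length x" "i + stride c \<le> length x + 1"
  shows "gip_steps x ((Test c, s), i, v, out)
    ((Test c, s), i + stride c, v(c := v c - 1, partner c := Suc (v (partner c))), out)"
proof -
  obtain ph acc par where s: "s = (ph, acc, par)" by (cases s)
  define w where "w = v(c := v c - 1, partner c := Suc (v (partner c)))"
  have w: "w k \<le> length x" for k using assms(2)[of k] assms(2)[of c] assms(3) by (auto simp: w_def)
  have i: "i \<le> length x" "c \<noteq> CT \<Longrightarrow> i + 2 \<le> length x" "c = CU \<Longrightarrow> i + 3 \<le> length x"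
    using assms(4) by (cases c; simp)+
  have test: "cm_step gip_machine x ((Test c, s), i, v, out) ((after_test c, s), i + 1, w, out)"
    by (rule gip_step[where d = Right and ops = "shift_ops c (partner c)" and b = None])
      (use assms(1,2) i(1) in \<open>auto simp: s w_def shift_ops_def no_ops_def written_def split: if_splits\<close>)
  have move: "cm_step gip_machine x ((Move3 c, s), j, w, out) ((Move2 c, s), j + 1, w, out)"
    "cm_step gip_machine x ((Move2 c, s), j, w, out) ((Move1 c, s), j + 1, w, out)"
    "cm_step gip_machine x ((Move1 c, s), j, w, out) ((Test c, s), j + 1, w, out)" if "j \<le> length x" for j
    using gip_move[of w x j c s out] w that by blast+
  have move2: "gip_steps x ((Move2 c, s), j, w, out) ((Test c, s), j + 2, w, out)" if "j + 1 \<le> length x" for j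
    using move(2)[of j] move(3)[of "j + 1"] that by (simp add: rtranclp.rtrancl_into_rtrancl[OF r_into_rtranclp])
  have move3: "gip_steps x ((Move3 c, s), j, w, out) ((Test c, s), j + 3, w, out)" if "j + 2 \<le> length x" for j
    using move(1)[of j] move2[of "j + 1"] that by (simp add: converse_rtranclp_into_rtranclp numeral_3_eq_3)
  have "gip_steps x ((after_test c, s), i + 1, w, out) ((Test c, s), i + stride c, w, out)"
    using i move2[of "i + 1"] move3[of "i + 1"] by (cases c) (auto simp: eval_nat_numeral)
  with test have "gip_steps x ((Test c, s), i, v, out) ((Test c, s), i + stride c, w, out)"
    by (rule converse_rtranclp_into_rtranclp[where r = "cm_step gip_machine x"])
  then show ?thesis unfolding w_def .
qed

lemma gip_loop:
  assumes "\<And>k. v k \<le> length x" "v c + v (partner c) \<le> length x" "i + stride c * v c \<le> length x + 1"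
  shows "gip_steps x ((Test c, s), i, v, out)
    ((Test c, s), i + stride c * v c, v(c := 0, partner c := v (partner c) + v c), out)"
  using assms
proof (induction "v c" arbitrary: v i)
  case 0
  then have vc: "v c = 0" by simp
  have "v(c := 0, partner c := v (partner c) + v c) = v" by (rule ext) (simp add: vc)
  then show ?case by (simp add: vc del: fun_upd_apply)
next
  case (Suc n)
  have vc: "v c = Suc n" using Suc.hyps(2) by simp
  define w where "w = v(c := v c - 1, partner c := Suc (v (partner c)))"
  have wc: "w c = n" "w (partner c) = Suc (v (partner c))" by (simp_all add: w_def vc)
  have le: "v (partner c) < length x" using Suc.prems(2) vc by simp
  have i: "i + stride c + stride c * n \<le> length x + 1" using Suc.prems(3) by (simp add: vc)
  have first: "gip_steps x ((Test c, s), i, v, out) ((Test c, s), i + stride c, w, out)"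
    unfolding w_def by (rule gip_loop_body) (use Suc.prems(1) le i vc in auto)
  have rest: "gip_steps x ((Test c, s), i + stride c, w, out) ((Test c, s), i + stride c + stride c * w c,
      w(c := 0, partner c := w (partner c) + w c), out)"
  proof (rule Suc.hyps(1))
    show "n = w c" using wc by simp
    show "w k \<le> length x" for k using Suc.prems(1)[of k] le vc Suc.prems(1)[of c] by (auto simp: w_def)
    show "w c + w (partner c) \<le> length x" using Suc.prems(2) by (simp add: wc vc)
    show "i + stride c + stride c * w c \<le> length x + 1" using i by (simp add: wc)
  qed
  have "w(c := 0, partner c := w (partner c) + w c) = v(c := 0, partner c := v (partner c) + v c)"
    by (rule ext) (simp add: w_def vc)
  moreover have "i + stride c + stride c * w c = i + stride c * v c" by (simp add: wc vc)
  ultimately show ?case using rtranclp_trans[OF first rest] by argo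
qed

lemma written_emit [simp]: "written (emit_in p ph b) = (if ph = p then [b] else [])"
  by (simp add: written_def emit_in_def)

lemma no_ops_Keep [simp]: "no_ops k = Keep"
  by (simp add: no_ops_def)

lemma gip_test_exit:
  assumes "fetch_exit c ph acc par b (\<lambda>k. v k = 0) = (q, ops, y)" "endmarked_word x ! i = Letter b" "v c = 0"
    and "\<And>k. v k \<le> length x" "\<And>k. ops k = Dec \<Longrightarrow> v k \<noteq> 0" "i \<le> length x"
    and "v' = (\<lambda>k. apply_op (ops k) (v k))" "i' = i + 1" "out' = out @ written y"
  shows "gip_steps x ((Test c, ph, acc, par), i, v, out) (q, i', v', out')"
  by (rule r_into_rtranclp, rule gip_step[where d = Right and ops = ops and b = y]) (use assms in auto)

lemma gip_mask:
  assumes "endmarked_word x ! i = Letter b" "\<And>k. v k \<le> length x" "i \<le> length x"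
    "(l, l', p) = (MaskB, Test CU, P2) \<or> (l, l', p) = (MaskC, Test CV, P3)"
    "i' = i + 1" "out' = out @ (if ph = p then [b \<noteq> acc] else [])"
  shows "gip_steps x ((l, ph, acc, par), i, v, out) ((l', ph, acc, par), i', v, out')"
  by (rule r_into_rtranclp, rule gip_step[where d = Right and ops = no_ops and b = "emit_in p ph (b \<noteq> acc)"])
    (use assms in \<open>auto simp: no_ops_def\<close>)

lemma gip_loop_to:
  assumes "\<And>k. v k \<le> length x" "v c + v (partner c) \<le> length x" "i' = i + stride c * v c" "i' \<le> length x + 1"
    "v' = v(c := 0, partner c := v (partner c) + v c)"
  shows "gip_steps x ((Test c, s), i, v, out) ((Test c, s), i', v', out)"
  unfolding assms(3,5) by (rule gip_loop) (use assms in auto)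

lemma nth_flat: "s < length ps \<Longrightarrow> flat ps ! (2 * s) = fst (ps ! s)" "s < length ps \<Longrightarrow> flat ps ! Suc (2 * s) = snd (ps ! s)"
proof (induction ps arbitrary: s)
  case (Cons p ps)
  { case 1 then show ?case using Cons.IH by (cases s) auto }
  { case 2 then show ?case using Cons.IH by (cases s) auto }
qed auto

text \<open>Block offsets rewritten with \<open>m = t + s + 1\<close>, plus one for the left
  endmarker; these are the head positions at which the tests of a fetch round end.\<close>

lemma block_letters:
  assumes x: "x = a @ flat ps @ flat qs @ d @ r"
    and l: "length a = m" "length ps = m" "length qs = m" "length d = m" and ts: "t + s + 1 = m"
  shows "endmarked_word x ! (t + 1) = Letter (a ! t)"
    and "endmarked_word x ! (t + 2 + 3 * s) = Letter (fst (ps ! s))"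
    and "endmarked_word x ! (t + 3 + 3 * s) = Letter (snd (ps ! s))"
    and "endmarked_word x ! (5 * t + 4 + 3 * s) = Letter (fst (qs ! t))"
    and "endmarked_word x ! (5 * t + 5 + 3 * s) = Letter (snd (qs ! t))"
    and "endmarked_word x ! (5 * t + 6 + 6 * s) = Letter (d ! s)"
proof -
  have lx: "length x = 6 * m + length r" using l by (simp add: x)
  have e: "endmarked_word x ! (p + 1) = Letter (x ! p)" if "p < 6 * m" for p
    using that lx by simp
  have "x ! t = a ! t" using l ts by (simp add: x nth_append)
  then show "endmarked_word x ! (t + 1) = Letter (a ! t)" using e[of t] ts by simp
  have b: "x ! (m + p) = flat ps ! p" if "p < 2 * m" for p using that l by (simp add: x nth_append)
  have p: "t + 1 + 3 * s = m + 2 * s" "t + 2 + 3 * s = m + Suc (2 * s)" using ts by auto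
  have "x ! (t + 1 + 3 * s) = fst (ps ! s)"
    unfolding p using b[of "2 * s"] nth_flat[of s ps] l ts by simp
  moreover have "x ! (t + 2 + 3 * s) = snd (ps ! s)"
    unfolding p using b[of "Suc (2 * s)"] nth_flat[of s ps] l ts by simp
  ultimately show "endmarked_word x ! (t + 2 + 3 * s) = Letter (fst (ps ! s))"
    "endmarked_word x ! (t + 3 + 3 * s) = Letter (snd (ps ! s))"
    using e[of "t + 1 + 3 * s"] e[of "t + 2 + 3 * s"] ts by (auto simp: eval_nat_numeral)
  have c: "x ! (3 * m + p) = flat qs ! p" if "p < 2 * m" for p using that l by (simp add: x nth_append)
  have p: "5 * t + 3 + 3 * s = 3 * m + 2 * t" "5 * t + 4 + 3 * s = 3 * m + Suc (2 * t)" using ts by auto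
  have "x ! (5 * t + 3 + 3 * s) = fst (qs ! t)"
    unfolding p using c[of "2 * t"] nth_flat[of t qs] l ts by simp
  moreover have "x ! (5 * t + 4 + 3 * s) = snd (qs ! t)"
    unfolding p using c[of "Suc (2 * t)"] nth_flat[of t qs] l ts by simp
  ultimately show "endmarked_word x ! (5 * t + 4 + 3 * s) = Letter (fst (qs ! t))"
    "endmarked_word x ! (5 * t + 5 + 3 * s) = Letter (snd (qs ! t))"
    using e[of "5 * t + 3 + 3 * s"] e[of "5 * t + 4 + 3 * s"] ts by (auto simp: eval_nat_numeral)
  have p: "5 * t + 5 + 6 * s = 5 * m + s" using ts by auto
  have "x ! (5 * t + 5 + 6 * s) = d ! s" unfolding p using l ts by (simp add: x nth_append)
  then show "endmarked_word x ! (5 * t + 6 + 6 * s) = Letter (d ! s)"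
    using e[of "5 * t + 5 + 6 * s"] ts by (auto simp: eval_nat_numeral)
qed

primrec fetched_output ::
  "bool list \<Rightarrow> (bool \<times> bool) list \<Rightarrow> (bool \<times> bool) list \<Rightarrow> bool list \<Rightarrow> nat \<Rightarrow> nat \<Rightarrow> phase \<Rightarrow> bool list" where
  "fetched_output a ps qs d t s P1 = [a ! t]"
| "fetched_output a ps qs d t s P2 = [fst (ps ! s), snd (ps ! s) \<noteq> (a ! t \<and> fst (ps ! s))]"
| "fetched_output a ps qs d t s P3 =
    [fst (qs ! t), snd (qs ! t) \<noteq> ((a ! t \<and> fst (ps ! s)) \<and> fst (qs ! t))]"
| "fetched_output a ps qs d t s P4 = [d ! s]"

text \<open>A round restores its counters: \<open>T\<close> is emptied into \<open>U\<close> on the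
  way to the first block and refilled on the way to the third, and likewise \<open>S\<close> and
  \<open>V\<close> on the ways to the second and the fourth. In phase \<open>P4\<close> nothing is
  printed yet, since that bit is written by the exit of the last test, together with the update of
  the parity.\<close>

lemma gip_fetch:
  assumes x: "x = a @ flat ps @ flat qs @ d @ r"
    and l: "length a = m" "length ps = m" "length qs = m" "length d = m" and ts: "t + s + 1 = m"
    and i: "i \<le> length x + 1"
  shows "gip_steps x ((Rewind, ph, acc, par), i, ctrs t s 0 0, out)
    ((Test CV, ph, (a ! t \<and> fst (ps ! s)) \<and> fst (qs ! t), par), 5 * t + 6 + 6 * s, ctrs t s 0 0,
     out @ (if ph = P4 then [] else fetched_output a ps qs d t s ph))"
proof -
  let ?b = "a ! t \<and> fst (ps ! s)"
  let ?c = "?b \<and> fst (qs ! t)"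
  note L = block_letters[OF x l ts]
  have lx: "length x = 6 * m + length r" using l by (simp add: x)
  have le: "ctrs t' s' u v k \<le> length x" if "t' \<le> m" "s' \<le> m" "u \<le> m" "v \<le> m" for t' s' u v k
    using ctrs_le[of t' "length x" s' u v k] that lx by simp
  let ?o1 = "out @ (if ph = P1 then [a ! t] else [])"
  let ?o2 = "?o1 @ (if ph = P2 then [fst (ps ! s)] else [])"
  let ?o3 = "?o2 @ (if ph = P2 then [snd (ps ! s) \<noteq> ?b] else [])"
  let ?o4 = "?o3 @ (if ph = P3 then [fst (qs ! t)] else [])"
  let ?o5 = "?o4 @ (if ph = P3 then [snd (qs ! t) \<noteq> (?c)] else [])"
  have h0: "gip_steps x ((Rewind, ph, acc, par), i, ctrs t s 0 0, out) ((Test CT, ph, acc, par), 1, ctrs t s 0 0, out)"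
    by (rule gip_rewind) (use i le ts in auto)
  have h1: "gip_steps x ((Test CT, ph, acc, par), 1, ctrs t s 0 0, out) ((Test CT, ph, acc, par), t + 1, ctrs 0 s t 0, out)"
    by (rule gip_loop_to) (use le ts lx in auto)
  have h2: "gip_steps x ((Test CT, ph, acc, par), t + 1, ctrs 0 s t 0, out)
      ((Test CS, ph, a ! t, par), t + 2, ctrs 0 s t 0, ?o1)"
    by (rule gip_test_exit[OF _ L(1)]) (use le ts lx in \<open>auto simp: no_ops_def\<close>)
  have h3: "gip_steps x ((Test CS, ph, a ! t, par), t + 2, ctrs 0 s t 0, ?o1)
      ((Test CS, ph, a ! t, par), t + 2 + 3 * s, ctrs 0 0 t s, ?o1)"
    by (rule gip_loop_to) (use le ts lx in auto)
  have h4: "gip_steps x ((Test CS, ph, a ! t, par), t + 2 + 3 * s, ctrs 0 0 t s, ?o1)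
      ((MaskB, ph, ?b, par), t + 3 + 3 * s, ctrs 0 0 t s, ?o2)"
    by (rule gip_test_exit[OF _ L(2)]) (use le ts lx in \<open>auto simp: no_ops_def\<close>)
  have h5: "gip_steps x ((MaskB, ph, ?b, par), t + 3 + 3 * s, ctrs 0 0 t s, ?o2)
      ((Test CU, ph, ?b, par), t + 4 + 3 * s, ctrs 0 0 t s, ?o3)"
    by (rule gip_mask[OF L(3)]) (use le ts lx in auto)
  have h6: "gip_steps x ((Test CU, ph, ?b, par), t + 4 + 3 * s, ctrs 0 0 t s, ?o3)
      ((Test CU, ph, ?b, par), 5 * t + 4 + 3 * s, ctrs t 0 0 s, ?o3)"
    by (rule gip_loop_to) (use le ts lx in auto)
  have h7: "gip_steps x ((Test CU, ph, ?b, par), 5 * t + 4 + 3 * s, ctrs t 0 0 s, ?o3)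
      ((MaskC, ph, ?c, par), 5 * t + 5 + 3 * s, ctrs t 0 0 s, ?o4)"
    by (rule gip_test_exit[OF _ L(4)]) (use le ts lx in \<open>auto simp: no_ops_def\<close>)
  have h8: "gip_steps x ((MaskC, ph, ?c, par), 5 * t + 5 + 3 * s, ctrs t 0 0 s, ?o4)
      ((Test CV, ph, ?c, par), 5 * t + 6 + 3 * s, ctrs t 0 0 s, ?o5)"
    by (rule gip_mask[OF L(5)]) (use le ts lx in auto)
  have h9: "gip_steps x ((Test CV, ph, ?c, par), 5 * t + 6 + 3 * s, ctrs t 0 0 s, ?o5)
      ((Test CV, ph, ?c, par), 5 * t + 6 + 6 * s, ctrs t s 0 0, ?o5)"
    by (rule gip_loop_to) (use le ts lx in auto)
  have "?o5 = out @ (if ph = P4 then [] else fetched_output a ps qs d t s ph)"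
    by (cases ph) simp_all
  then show ?thesis
    using rtranclp_trans[OF h0 rtranclp_trans[OF h1 rtranclp_trans[OF h2 rtranclp_trans[OF h3 rtranclp_trans[OF h4
      rtranclp_trans[OF h5 rtranclp_trans[OF h6 rtranclp_trans[OF h7 rtranclp_trans[OF h8 h9]]]]]]]]] by simp
qed

text \<open>Phases \<open>P1\<close> and \<open>P3\<close> print blocks indexed by \<open>T\<close>
  and run \<open>T\<close> upwards; \<open>P2\<close> and \<open>P4\<close> print blocks indexed by
  \<open>S\<close> and run back. Each phase thus starts with the counters as the previous one left
  them.\<close>

lemma gip_forward_phase:
  assumes x: "x = a @ flat ps @ flat qs @ d @ r"
    and l: "length a = m" "length ps = m" "length qs = m" "length d = m" and ts: "t + s + 1 = m"
    and i: "i \<le> length x + 1" and ph: "(ph, ph') = (P1, P2) \<or> (ph, ph') = (P3, P4)"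
  shows "\<exists>i' \<le> length x + 1. gip_steps x ((Rewind, ph, acc, par), i, ctrs t s 0 0, out)
    ((Rewind, ph', False, par), i', ctrs (m - 1) 0 0 0,
     out @ concat (map (\<lambda>t. fetched_output a ps qs d t (m - 1 - t) ph) [t..<m]))"
  using ts i
proof (induction s arbitrary: t i acc out)
  case 0
  then have m: "m = Suc t" by simp
  have lx: "length x = 6 * m + length r" using l by (simp add: x)
  let ?acc = "(a ! t \<and> fst (ps ! 0)) \<and> fst (qs ! t)"
  let ?out = "out @ fetched_output a ps qs d t 0 ph"
  have 1: "gip_steps x ((Rewind, ph, acc, par), i, ctrs t 0 0 0, out)
      ((Test CV, ph, ?acc, par), 5 * t + 6 + 6 * 0, ctrs t 0 0 0, ?out)"
    using gip_fetch[OF x l 0, of ph acc par out] ph by auto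
  have 2: "gip_steps x ((Test CV, ph, ?acc, par), 5 * t + 6 + 6 * 0, ctrs t 0 0 0, ?out)
      ((Rewind, ph', False, par), 5 * t + 7, ctrs t 0 0 0, ?out)"
    using ph
    by (elim disjE; intro gip_test_exit[OF _ block_letters(6)[OF x l 0(1)], where ops = no_ops and y = None])
      (auto simp: written_def m lx intro: ctrs_le)
  have "[t..<m] = [t]" by (simp add: m)
  then have "?out = out @ concat (map (\<lambda>t. fetched_output a ps qs d t (m - 1 - t) ph) [t..<m])" by (simp add: m)
  then show ?case using rtranclp_trans[OF 1 2] m lx by (intro exI[of _ "5 * t + 7"]) simp
next
  case (Suc s)
  have lx: "length x = 6 * m + length r" using l by (simp add: x)
  let ?acc = "(a ! t \<and> fst (ps ! Suc s)) \<and> fst (qs ! t)"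
  let ?out = "out @ fetched_output a ps qs d t (Suc s) ph"
  have 1: "gip_steps x ((Rewind, ph, acc, par), i, ctrs t (Suc s) 0 0, out)
      ((Test CV, ph, ?acc, par), 5 * t + 6 + 6 * Suc s, ctrs t (Suc s) 0 0, ?out)"
    using gip_fetch[OF x l Suc.prems, of ph acc par out] ph by auto
  have 2: "gip_steps x ((Test CV, ph, ?acc, par), 5 * t + 6 + 6 * Suc s, ctrs t (Suc s) 0 0, ?out)
      ((Rewind, ph, False, par), 5 * t + 7 + 6 * Suc s, ctrs (Suc t) s 0 0, ?out)"
    using ph Suc.prems
    by (elim disjE; intro gip_test_exit[OF _ block_letters(6)[OF x l Suc.prems(1)], where ops = "shift_ops CS CT" and y = None])
      (auto simp: written_def lx shift_ops_def no_ops_def ctrs_def fun_eq_iff split: counter.splits if_splits)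
  have "Suc t + s + 1 = m" "5 * t + 7 + 6 * Suc s \<le> length x + 1" using Suc.prems lx by auto
  from Suc.IH[OF this] obtain i' where i': "i' \<le> length x + 1"
    "gip_steps x ((Rewind, ph, False, par), 5 * t + 7 + 6 * Suc s, ctrs (Suc t) s 0 0, ?out)
      ((Rewind, ph', False, par), i', ctrs (m - 1) 0 0 0,
       ?out @ concat (map (\<lambda>t. fetched_output a ps qs d t (m - 1 - t) ph) [Suc t..<m]))"
    by blast
  have "[t..<m] = t # [Suc t..<m]" using Suc.prems by (simp add: upt_conv_Cons)
  moreover have "m - 1 - t = Suc s" using Suc.prems by simp
  ultimately have "?out @ concat (map (\<lambda>t. fetched_output a ps qs d t (m - 1 - t) ph) [Suc t..<m]) =
      out @ concat (map (\<lambda>t. fetched_output a ps qs d t (m - 1 - t) ph) [t..<m])" by simp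
  then show ?case using i' rtranclp_trans[OF 1 rtranclp_trans[OF 2 i'(2)]] by auto
qed

text \<open>The parity is accumulated in \<open>P4\<close> only, where every index occurs once. The
  last round has \<open>t = 0\<close> and \<open>s = m - 1\<close>, so the head ends at
  \<open>6 * m + 1\<close>, the first letter of the rest.\<close>

lemma gip_backward_phase:
  assumes x: "x = a @ flat ps @ flat qs @ d @ r"
    and l: "length a = m" "length ps = m" "length qs = m" "length d = m" and ts: "t + s + 1 = m"
    and i: "i \<le> length x + 1" and ph: "(ph, l', ph') = (P2, Rewind, P3) \<or> (ph, l', ph') = (P4, CopyRest, P4)"
  defines "pbit \<equiv> \<lambda>t s. ((a ! t \<and> fst (ps ! s)) \<and> fst (qs ! t)) \<and> d ! s"
  shows "gip_steps x ((Rewind, ph, acc, par), i, ctrs t s 0 0, out)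
    ((l', ph', False, par \<noteq> (ph = P4 \<and> parity (map (\<lambda>s. pbit (m - 1 - s) s) [s..<m]))), 6 * m + 1, ctrs 0 (m - 1) 0 0,
     out @ concat (map (\<lambda>s. fetched_output a ps qs d (m - 1 - s) s ph) [s..<m]))"
  using ts i
proof (induction t arbitrary: s i acc par out)
  case 0
  then have m: "m = Suc s" by simp
  have lx: "length x = 6 * m + length r" using l by (simp add: x)
  let ?acc = "(a ! 0 \<and> fst (ps ! s)) \<and> fst (qs ! 0)"
  let ?out = "out @ (if ph = P4 then [] else fetched_output a ps qs d 0 s ph)"
  let ?out' = "out @ fetched_output a ps qs d 0 s ph"
  have 1: "gip_steps x ((Rewind, ph, acc, par), i, ctrs 0 s 0 0, out)
      ((Test CV, ph, ?acc, par), 5 * 0 + 6 + 6 * s, ctrs 0 s 0 0, ?out)"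
    using gip_fetch[OF x l 0, of ph acc par out] by auto
  have 2: "gip_steps x ((Test CV, ph, ?acc, par), 5 * 0 + 6 + 6 * s, ctrs 0 s 0 0, ?out)
      ((l', ph', False, par \<noteq> (ph = P4 \<and> ?acc \<and> d ! s)), 6 * m + 1, ctrs 0 s 0 0, ?out')"
    using ph
    by (elim disjE; intro gip_test_exit[OF _ block_letters(6)[OF x l 0(1)], where ops = no_ops and
          y = "if ph = P4 then Some (d ! s) else None"])
      (auto simp: written_def m lx intro: ctrs_le)
  have u: "[s..<m] = [s]" by (simp add: m)
  have e: "m - 1 = s" by (simp add: m)
  show ?case
    using rtranclp_trans[OF 1 2] unfolding u list.map concat.simps parity.simps e pbit_def diff_self_eq_0
    by (simp add: conj_ac)
next
  case (Suc t)
  have lx: "length x = 6 * m + length r" using l by (simp add: x)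
  let ?acc = "(a ! Suc t \<and> fst (ps ! s)) \<and> fst (qs ! Suc t)"
  let ?out = "out @ (if ph = P4 then [] else fetched_output a ps qs d (Suc t) s ph)"
  let ?out' = "out @ fetched_output a ps qs d (Suc t) s ph"
  let ?par = "par \<noteq> (ph = P4 \<and> pbit (Suc t) s)"
  have 1: "gip_steps x ((Rewind, ph, acc, par), i, ctrs (Suc t) s 0 0, out)
      ((Test CV, ph, ?acc, par), 5 * Suc t + 6 + 6 * s, ctrs (Suc t) s 0 0, ?out)"
    using gip_fetch[OF x l Suc.prems, of ph acc par out] by auto
  have 2: "gip_steps x ((Test CV, ph, ?acc, par), 5 * Suc t + 6 + 6 * s, ctrs (Suc t) s 0 0, ?out)
      ((Rewind, ph, False, ?par), 5 * Suc t + 7 + 6 * s, ctrs t (Suc s) 0 0, ?out')"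
    using ph Suc.prems
    by (elim disjE; intro gip_test_exit[OF _ block_letters(6)[OF x l Suc.prems(1)], where ops = "shift_ops CT CS" and
          y = "if ph = P4 then Some (d ! s) else None"])
      (auto simp: pbit_def written_def lx shift_ops_def no_ops_def ctrs_def fun_eq_iff split: counter.splits if_splits)
  have "t + Suc s + 1 = m" "5 * Suc t + 7 + 6 * s \<le> length x + 1" using Suc.prems lx by auto
  note 3 = Suc.IH[OF this, of False ?par ?out']
  have u: "[s..<m] = s # [Suc s..<m]" using Suc.prems by (simp add: upt_conv_Cons)
  have e: "m - 1 - s = Suc t" using Suc.prems by simp
  have e1: "(?par \<noteq> (ph = P4 \<and> parity (map (\<lambda>s. pbit (m - 1 - s) s) [Suc s..<m]))) =
      (par \<noteq> (ph = P4 \<and> parity (map (\<lambda>s. pbit (m - 1 - s) s) [s..<m])))"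
    unfolding u list.map e parity.simps by blast
  have e2: "?out' @ concat (map (\<lambda>s. fetched_output a ps qs d (m - 1 - s) s ph) [Suc s..<m]) =
      out @ concat (map (\<lambda>s. fetched_output a ps qs d (m - 1 - s) s ph) [s..<m])"
    unfolding u list.map e by simp
  show ?case using rtranclp_trans[OF 1 rtranclp_trans[OF 2 3]] unfolding e1 e2 .
qed

lemma gip_copy:
  assumes "p \<le> length x" "\<And>k. v k \<le> length x"
  shows "\<exists>i. gip_steps x ((CopyRest, ph, acc, par), p + 1, v, out) ((Done, ph, acc, par), i, v, out @ drop p x @ [par])"
  using assms(1)
proof (induction p arbitrary: out rule: inc_induct)
  case base
  have "cm_step gip_machine x ((CopyRest, ph, acc, par), length x + 1, v, out)
      ((Done, ph, acc, par), length x + 1, v, out @ [par])"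
    by (rule gip_step[where d = Stay and ops = no_ops and b = "Some par"]) (auto simp: assms(2) written_def no_ops_def)
  then show ?case by auto
next
  case (step p)
  have "cm_step gip_machine x ((CopyRest, ph, acc, par), p + 1, v, out)
      ((CopyRest, ph, acc, par), Suc p + 1, v, out @ [x ! p])"
    by (rule gip_step[where d = Right and ops = no_ops and b = "Some (x ! p)"])
      (use step in \<open>auto simp: assms(2) written_def no_ops_def\<close>)
  moreover obtain i where "gip_steps x ((CopyRest, ph, acc, par), Suc p + 1, v, out @ [x ! p])
      ((Done, ph, acc, par), i, v, (out @ [x ! p]) @ drop (Suc p) x @ [par])"
    using step.IH by blast
  ultimately have "gip_steps x ((CopyRest, ph, acc, par), p + 1, v, out)
      ((Done, ph, acc, par), i, v, (out @ [x ! p]) @ drop (Suc p) x @ [par])"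
    by (rule converse_rtranclp_into_rtranclp[where r = "cm_step gip_machine x"])
  moreover have eq: "(out @ [x ! p]) @ drop (Suc p) x @ [par] = out @ drop p x @ [par]"
  proof -
    have "drop p x = x ! p # drop (Suc p) x" using step.hyps by (simp add: Cons_nth_drop_Suc)
    then show ?thesis by simp
  qed
  ultimately show ?case unfolding eq by blast
qed

lemma flat_conv_nth: "flat ps = concat (map (\<lambda>s. [fst (ps ! s), snd (ps ! s)]) [0..<length ps])"
proof (induction ps)
  case (Cons p ps)
  have "[0..<length (p # ps)] = 0 # map Suc [0..<length ps]" by (simp add: upt_conv_Cons map_Suc_upt del: upt_Suc)
  then show ?case using Cons by (simp add: comp_def)
qed simp

lemma gip_machine_computes:
  "\<exists>q i v. gip_steps x (cm_initial gip_machine, 0, \<lambda>_. 0, []) (q, i, v, gip_gen x) \<and> q \<in> cm_halting gip_machine"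
proof (rule blocks_cases[of x])
  fix a ps qs d r m
  assume x: "x = a @ flat ps @ flat qs @ d @ r" and l: "length a = m" "length ps = m" "length qs = m" "length d = m"
    and r: "length r < 6"
  have lx: "length x = 6 * m + length r" using l by (simp add: x)
  have le: "ctrs t s u v k \<le> length x" if "t \<le> m" "s \<le> m" "u \<le> m" "v \<le> m" for t s u v k
    using ctrs_le[of t "length x" s u v k] that lx by simp
  have z: "(\<lambda>_. 0) = ctrs 0 0 0 0" by (auto simp: ctrs_def fun_eq_iff split: counter.splits)
  let ?q = "(P1, False, False)"
  obtain j where j: "gip_steps x ((Count R0, ?q), 0, ctrs 0 0 0 0, []) ((Count j, ?q), length x + 1, ctrs 0 m 0 0, [])"
    using gip_count[of "length x" x ?q] lx r by auto
  have gen: "gip_gen x = masked_word a ps qs d r @ [inner_bit a ps qs d]"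
    unfolding x by (rule gip_gen_blocks[OF l r])
  have halted: "(Done, s) \<in> cm_halting gip_machine" for s by (simp add: gip_machine_def)
  have init: "cm_initial gip_machine = (Count R0, ?q)" by (simp add: gip_machine_def)
  have "\<exists>ph acc par i v. gip_steps x ((Count j, ?q), length x + 1, ctrs 0 m 0 0, [])
      ((Done, ph, acc, par), i, v, gip_gen x)"
  proof (cases "m = 0")
    \<comment> \<open>Fewer than six letters: all blocks are empty, and the appended parity of the
      empty word is \<open>False\<close>.\<close>
    case True
    have "cm_step gip_machine x ((Count j, ?q), length x + 1, ctrs 0 m 0 0, []) ((RewindCopy, ?q), length x + 1, ctrs 0 m 0 0, [])"
      by (rule gip_step[where d = Stay and ops = no_ops and b = None]) (use le True in \<open>auto simp: written_def no_ops_def\<close>)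
    moreover have "gip_steps x ((RewindCopy, ?q), length x + 1, ctrs 0 m 0 0, []) ((CopyRest, ?q), 0 + 1, ctrs 0 m 0 0, [])"
      using gip_rewind[of "length x + 1" x "ctrs 0 m 0 0" RewindCopy CopyRest ?q "[]"] le by simp
    moreover obtain i where "gip_steps x ((CopyRest, ?q), 0 + 1, ctrs 0 m 0 0, []) ((Done, ?q), i, ctrs 0 m 0 0, [] @ drop 0 x @ [False])"
      using gip_copy[of 0 x "ctrs 0 m 0 0" P1 False False "[]"] le by blast
    moreover have "gip_gen x = [] @ drop 0 x @ [False]"
    proof -
      have "x = r" using True l x by simp
      then show ?thesis using True l unfolding gen by (simp add: masked_word_def inner_bit_def mask_def)
    qed
    ultimately show ?thesis by (metis (no_types, lifting) converse_rtranclp_into_rtranclp rtranclp_trans)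
  next
    case False
    let ?p2 = "a @ flat (mask a ps)"
    let ?p3 = "?p2 @ flat (mask (carry a ps) qs)"
    have o1: "concat (map (\<lambda>t. fetched_output a ps qs d t (m - 1 - t) P1) [0..<m]) = a"
      using l(1) map_nth[of a] by (simp add: concat_map_singleton)
    have o2: "concat (map (\<lambda>s. fetched_output a ps qs d (m - 1 - s) s P2) [0..<m]) = flat (mask a ps)"
      unfolding flat_conv_nth[of "mask a ps"] using l
      by (intro arg_cong[of _ _ concat] map_cong) (auto simp: mask_def carry_def rev_nth)
    have o3: "concat (map (\<lambda>t. fetched_output a ps qs d t (m - 1 - t) P3) [0..<m]) = flat (mask (carry a ps) qs)"
      unfolding flat_conv_nth[of "mask (carry a ps) qs"] using l
      by (intro arg_cong[of _ _ concat] map_cong) (auto simp: mask_def carry_def rev_nth)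
    have o4: "concat (map (\<lambda>s. fetched_output a ps qs d (m - 1 - s) s P4) [0..<m]) = d"
      using l(4) map_nth[of d] by (simp add: concat_map_singleton)
    \<comment> \<open>Phase \<open>P4\<close> runs through \<open>s\<close> upwards, that is through
      \<open>t\<close> downwards, so the carries appear reversed, as in
      \<open>inner_bit\<close>.\<close>
    have bits_eq: "map (\<lambda>s. ((a ! (m - 1 - s) \<and> fst (ps ! s)) \<and> fst (qs ! (m - 1 - s))) \<and> d ! s) [0..<m] =
        map2 (\<and>) (rev (carry (carry a ps) qs)) d"
      using l by (intro nth_equalityI) (auto simp: carry_def rev_nth)
    have "cm_step gip_machine x ((Count j, ?q), length x + 1, ctrs 0 m 0 0, []) ((Rewind, ?q), length x + 1, ctrs 0 (m - 1) 0 0, [])"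
      by (rule gip_step[where d = Stay and ops = "no_ops(CS := Dec)" and b = None])
        (use le False in \<open>auto simp: written_def no_ops_def ctrs_def split: counter.splits if_splits\<close>)
    then have 0: "gip_steps x ((Count j, ?q), length x + 1, ctrs 0 m 0 0, []) ((Rewind, ?q), length x + 1, ctrs 0 (m - 1) 0 0, [])" ..
    have ts: "0 + (m - 1) + 1 = m" "(m - 1) + 0 + 1 = m" using False by auto
    obtain i1 where i1: "i1 \<le> length x + 1" and
      1: "gip_steps x ((Rewind, ?q), length x + 1, ctrs 0 (m - 1) 0 0, []) ((Rewind, P2, False, False), i1, ctrs (m - 1) 0 0 0, a)"
      using gip_forward_phase[OF x l ts(1) order_refl, of P1 P2 False False "[]"] unfolding o1 by auto
    have 2: "gip_steps x ((Rewind, P2, False, False), i1, ctrs (m - 1) 0 0 0, a)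
        ((Rewind, P3, False, False), 6 * m + 1, ctrs 0 (m - 1) 0 0, ?p2)"
      using gip_backward_phase[OF x l ts(2) i1, of P2 Rewind P3 False False a] unfolding o2 by simp
    have "6 * m + 1 \<le> length x + 1" using lx by simp
    then obtain i3 where i3: "i3 \<le> length x + 1" and
      3: "gip_steps x ((Rewind, P3, False, False), 6 * m + 1, ctrs 0 (m - 1) 0 0, ?p2)
        ((Rewind, P4, False, False), i3, ctrs (m - 1) 0 0 0, ?p3)"
      using gip_forward_phase[OF x l ts(1), of "6 * m + 1" P3 P4 False False ?p2] unfolding o3 by auto
    have 4: "gip_steps x ((Rewind, P4, False, False), i3, ctrs (m - 1) 0 0 0, ?p3)
        ((CopyRest, P4, False, inner_bit a ps qs d), 6 * m + 1, ctrs 0 (m - 1) 0 0, ?p3 @ d)"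
      using gip_backward_phase[OF x l ts(2) i3, of P4 CopyRest P4 False False ?p3] unfolding o4 bits_eq by (simp add: inner_bit_def)
    obtain i5 where 5: "gip_steps x ((CopyRest, P4, False, inner_bit a ps qs d), 6 * m + 1, ctrs 0 (m - 1) 0 0, ?p3 @ d)
        ((Done, P4, False, inner_bit a ps qs d), i5, ctrs 0 (m - 1) 0 0, (?p3 @ d) @ drop (6 * m) x @ [inner_bit a ps qs d])"
      using gip_copy[of "6 * m" x "ctrs 0 (m - 1) 0 0" P4 False "inner_bit a ps qs d" "?p3 @ d"] le lx by auto
    have "drop (6 * m) x = r" using l by (simp add: x)
    then have out: "(?p3 @ d) @ drop (6 * m) x @ [inner_bit a ps qs d] = gip_gen x"
      unfolding gen by (simp add: masked_word_def)
    from rtranclp_trans[OF 0 rtranclp_trans[OF 1 rtranclp_trans[OF 2 rtranclp_trans[OF 3 rtranclp_trans[OF 4 5]]]]]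
    show ?thesis unfolding out by blast
  qed
  then show ?thesis unfolding init z using rtranclp_trans[OF j] halted by blast
qed

lemma gip_gen_FL: "gip_gen \<in> FL bits bits"
proof (rule counter_machine_FL)
  show "snd (snd (snd (cm_delta gip_machine q a z))) \<in> insert None (Some ` bits)" for q a z
    by (metis UNIV_I UNIV_option_conv)
  show "\<exists>q i v. gip_steps x (cm_initial gip_machine, 0, \<lambda>_. 0, []) (q, i, v, gip_gen x) \<and> q \<in> cm_halting gip_machine" for x
    by (rule gip_machine_computes)
  show "length (gip_gen x) \<le> poly [:1, 1:] (length x)" for x
    by (simp add: length_gip_gen)
qed

theorem theorem3p2:
  shows "\<exists>G :: bool list \<Rightarrow> bool list.
    has_stretch bits (\<lambda>n. n + 1) G \<and>
    almost_one_to_one bits G \<and>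
    pseudorandom_against bits (\<lambda>n. n + 1) G (CFL_advice bits) \<and>
    G \<in> FL bits bits \<and>
    (\<lambda>x. {G x}) \<in> CFLMV2_advice bits bits"
  using gip_gen_almost_one_to_one gip_gen_pseudorandom gip_gen_FL gip_gen_CFLMV2_advice
  unfolding pseudorandom_against_def by blast

end
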